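(* Let $\omega\in\mathcal{W}$ with associated function $\tau$, and let $\mu$ be a finite positive Borel measure on $\mathbb{D}$. Then: (i) $T_\mu:A^2_\omega\to A^2_\omega$ is bounded if and only if for each $\delta>0$ small enough one has $$C_\mu:=\sup_{z\in\mathbb{D}}\widehat{\mu}_\delta(z)<\infty .$$ Moreover, in that case, $\|T_\mu\|\asymp C_\mu$ (with constants independent of $\mu$). (ii) $T_\mu:A^2_\omega\to A^2_\omega$ is compact if and only if for each $\delta>0$ small enough one has $$\lim_{r\to1^-}\ \sup_{|z|>r}\widehat{\mu}_\delta(z)=0 .$$
   Context: $\mathbb{D}$ is the open unit disk in $\mathbb{C}$, $H(\mathbb{D})$ the space of analytic functions on $\mathbb{D}$, and $dA=\frac{dx\,dy}{\pi}$ normalized area measure. A weight is a positive function $\omega\in L^1(\mathbb{D},dA)$. $A^2_\omega$ is the space of $f\in H(\mathbb{D})$ with $\|f\|_{A^2_\omega}^2=\int_{\mathbb{D}}|f|^2\omega\,dA<\infty$, with inner product $\langle f,g\rangle_\omega=\int_{\mathbb{D}} f\,\overline{g}\,\omega\,dA$. The notation $a\lesssim b$ means $a\le Cb$ for a constant $C>0$, and $a\asymp b$ means $a\lesssim b$ and $b\lesssim a$. Class $\mathcal{W}$: radial decreasing weights $\omega=e^{-2\varphi}$, where $\varphi\in C^2(\mathbb{D})$ is radial with $(\Delta\varphi(z))^{-1/2}\asymp\tau(z)$ ($\Delta$ is the standard Laplacian) for a radial positive function $\tau$ (the function associated to $\omega$) that decreases to $0$ as $|z|\to1^-$ and satisfies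 $\lim_{r\to1^-}\tau'(r)=0$; moreover, either there is a constant $C>0$ such that $\tau(r)(1-r)^{-C}$ increases for $r$ close to $1$, or $\lim_{r\to1^-}\tau'(r)\log\frac1{\tau(r)}=0$. The function $\tau$ belongs to the class $\mathcal{L}$, i.e. there are constants $c_1,c_2$ with (A) $\tau(z)\le c_1(1-|z|)$ for all $z\in\mathbb{D}$, and (B) $|\tau(z)-\tau(\zeta)|\le c_2|z-\zeta|$ for all $z,\zeta\in\mathbb{D}$. Put $m_\tau=\frac14\min(1,c_1^{-1},c_2^{-1})$. For such $\omega$, point evaluations are bounded on $A^2_\omega$; $K_z\in A^2_\omega$ denotes the reproducing kernel, $f(z)=\langle f,K_z\rangle_\omega$ for $f\in A^2_\omega$. Toeplitz operator: $T_\mu f(z)=\int_{\mathbb{D}} f(\xi)\,\overline{K_z(\xi)}\,\omega(\xi)\,d\mu(\xi)$. $D(\delta\tau(z))$ is the Euclidean disk centered at $z$ with radius $\delta\tau(z)$, and the averaging function is $\widehat{\mu}_\delta(z)=\mu(D(\delta\tau(z)))/\tau(z)^2$, $z\in\mathbb{D}$. "For each $\delta>0$ small enough" means: for all $\delta\in(0,\delta_0)$, for some $\delta_0\in(0,m_\tau]$ depending only on $\omega$ and $\tau$. *)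

theory Defs
  imports "HOL-Analysis.Analysis"
begin

abbreviation disk :: "complex set" where
  "disk \<equiv> ball 0 1"

definition dA :: "complex measure" where
  "dA = density (restrict_space lborel disk) (\<lambda>_. ennreal (1 / pi))"

text \<open>Functions on the disk are modelled as functions on the whole plane; every definition
  below only depends on their values on \<^term>\<open>disk\<close>.\<close>

section \<open>Smoothness and the Laplacian\<close>

definition dir_deriv :: "complex \<Rightarrow> (complex \<Rightarrow> real) \<Rightarrow> complex \<Rightarrow> real" where
  "dir_deriv v u z = deriv (\<lambda>t::real. u (z + t *\<^sub>R v)) 0"

text \<open>The standard basis of the real vector space of complex numbers is
  \<^term>\<open>Basis = {1, \<i>}\<close>, so the derivatives along it are the partial derivatives
  with respect to \<open>x\<close> and \<open>y\<close>.\<close>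

definition C1_on :: "complex set \<Rightarrow> (complex \<Rightarrow> real) \<Rightarrow> bool" where
  "C1_on S u \<longleftrightarrow> continuous_on S u \<and>
     (\<forall>b\<in>Basis. (\<forall>z\<in>S. (\<lambda>t::real. u (z + t *\<^sub>R b)) differentiable at 0) \<and>
                continuous_on S (dir_deriv b u))"

definition C2_on :: "complex set \<Rightarrow> (complex \<Rightarrow> real) \<Rightarrow> bool" where
  "C2_on S u \<longleftrightarrow> C1_on S u \<and> (\<forall>b\<in>Basis. C1_on S (dir_deriv b u))"

definition laplacian :: "(complex \<Rightarrow> real) \<Rightarrow> complex \<Rightarrow> real" where
  "laplacian u z = (\<Sum>b\<in>Basis. dir_deriv b (dir_deriv b u) z)"

section \<open>Weights\<close>

definition weight :: "(complex \<Rightarrow> real) \<Rightarrow> bool" where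
  "weight \<omega> \<longleftrightarrow> (\<forall>z\<in>disk. \<omega> z > 0) \<and> integrable dA \<omega>"

definition radial :: "(complex \<Rightarrow> real) \<Rightarrow> bool" where
  "radial u \<longleftrightarrow> (\<forall>z\<in>disk. \<forall>w\<in>disk. norm z = norm w \<longrightarrow> u z = u w)"

definition radially_decreasing :: "(complex \<Rightarrow> real) \<Rightarrow> bool" where
  "radially_decreasing u \<longleftrightarrow> radial u \<and> (\<forall>z\<in>disk. \<forall>w\<in>disk. norm z \<le> norm w \<longrightarrow> u w \<le> u z)"

abbreviation profile :: "(complex \<Rightarrow> real) \<Rightarrow> real \<Rightarrow> real" where
  "profile u \<equiv> (\<lambda>r. u (complex_of_real r))"

definition class_L :: "(complex \<Rightarrow> real) \<Rightarrow> real \<Rightarrow> real \<Rightarrow> bool" where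
  "class_L \<tau> c1 c2 \<longleftrightarrow>
     (\<forall>z\<in>disk. \<tau> z \<le> c1 * (1 - norm z)) \<and>
     (\<forall>z\<in>disk. \<forall>\<zeta>\<in>disk. \<bar>\<tau> z - \<tau> \<zeta>\<bar> \<le> c2 * norm (z - \<zeta>))"

definition m_const :: "real \<Rightarrow> real \<Rightarrow> real" where
  "m_const c1 c2 = 1 / 4 * min 1 (min (inverse c1) (inverse c2))"

text \<open>Positivity of the Laplacian is stated explicitly because \<open>powr\<close> is total. Only the
  behaviour of \<open>\<tau>'(r)\<close> as \<open>r\<close> tends to 1 is relevant, so differentiability of the profile
  is only required near 1.\<close>

definition class_W :: "(complex \<Rightarrow> real) \<Rightarrow> (complex \<Rightarrow> real) \<Rightarrow> bool" where
  "class_W \<omega> \<tau> \<longleftrightarrow>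
     weight \<omega> \<and> radially_decreasing \<omega> \<and>
     (\<exists>\<phi>. radial \<phi> \<and> C2_on disk \<phi> \<and>
        (\<forall>z\<in>disk. \<omega> z = exp (- 2 * \<phi> z)) \<and>
        (\<forall>z\<in>disk. laplacian \<phi> z > 0) \<and>
        (\<exists>a>0. \<exists>b>0. \<forall>z\<in>disk.
           a * \<tau> z \<le> laplacian \<phi> z powr (- 1 / 2) \<and>
           laplacian \<phi> z powr (- 1 / 2) \<le> b * \<tau> z)) \<and>
     (\<forall>z\<in>disk. \<tau> z > 0) \<and> radially_decreasing \<tau> \<and>
     (profile \<tau> \<longlongrightarrow> 0) (at_left 1) \<and>
     (\<forall>\<^sub>F r in at_left 1. profile \<tau> differentiable at r) \<and>
     (deriv (profile \<tau>) \<longlongrightarrow> 0) (at_left 1) \<and>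
     ((\<exists>C>0. \<exists>r0<1. mono_on {r0<..<1} (\<lambda>r. profile \<tau> r * (1 - r) powr (- C))) \<or>
      ((\<lambda>r. deriv (profile \<tau>) r * ln (1 / profile \<tau> r)) \<longlongrightarrow> 0) (at_left 1)) \<and>
     (\<exists>c1 c2. class_L \<tau> c1 c2)"

section \<open>The weighted Bergman space and its reproducing kernel\<close>

definition A2 :: "(complex \<Rightarrow> real) \<Rightarrow> (complex \<Rightarrow> complex) set" where
  "A2 \<omega> = {f. f holomorphic_on disk \<and> integrable dA (\<lambda>z. (norm (f z))\<^sup>2 * \<omega> z)}"

definition A2_norm :: "(complex \<Rightarrow> real) \<Rightarrow> (complex \<Rightarrow> complex) \<Rightarrow> real" where
  "A2_norm \<omega> f = sqrt (LINT z|dA. (norm (f z))\<^sup>2 * \<omega> z)"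

definition A2_inner ::
    "(complex \<Rightarrow> real) \<Rightarrow> (complex \<Rightarrow> complex) \<Rightarrow> (complex \<Rightarrow> complex) \<Rightarrow> complex" where
  "A2_inner \<omega> f g = (LINT z|dA. f z * cnj (g z) * complex_of_real (\<omega> z))"

text \<open>The kernel function is determined on \<^term>\<open>disk\<close> only, hence \<open>SOME\<close> rather than
  \<open>THE\<close>; the choice of its values elsewhere plays no role.\<close>

definition kernel :: "(complex \<Rightarrow> real) \<Rightarrow> complex \<Rightarrow> complex \<Rightarrow> complex" where
  "kernel \<omega> z = (SOME k. k \<in> A2 \<omega> \<and> (\<forall>f\<in>A2 \<omega>. f z = A2_inner \<omega> f k))"

section \<open>Bounded and compact operators\<close>

definition A2_bounded ::
    "(complex \<Rightarrow> real) \<Rightarrow> ((complex \<Rightarrow> complex) \<Rightarrow> complex \<Rightarrow> complex) \<Rightarrow> bool" where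
  "A2_bounded \<omega> T \<longleftrightarrow> (\<forall>f\<in>A2 \<omega>. T f \<in> A2 \<omega>) \<and>
     (\<exists>C. \<forall>f\<in>A2 \<omega>. A2_norm \<omega> (T f) \<le> C * A2_norm \<omega> f)"

definition A2_opnorm ::
    "(complex \<Rightarrow> real) \<Rightarrow> ((complex \<Rightarrow> complex) \<Rightarrow> complex \<Rightarrow> complex) \<Rightarrow> real" where
  "A2_opnorm \<omega> T = (SUP f\<in>{f \<in> A2 \<omega>. A2_norm \<omega> f \<le> 1}. A2_norm \<omega> (T f))"

definition A2_compact ::
    "(complex \<Rightarrow> real) \<Rightarrow> ((complex \<Rightarrow> complex) \<Rightarrow> complex \<Rightarrow> complex) \<Rightarrow> bool" where
  "A2_compact \<omega> T \<longleftrightarrow> (\<forall>f\<in>A2 \<omega>. T f \<in> A2 \<omega>) \<and>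
     (\<forall>F :: nat \<Rightarrow> complex \<Rightarrow> complex.
        (\<forall>n. F n \<in> A2 \<omega>) \<and> (\<exists>B. \<forall>n. A2_norm \<omega> (F n) \<le> B) \<longrightarrow>
        (\<exists>g\<in>A2 \<omega>. \<exists>s :: nat \<Rightarrow> nat. strict_mono s \<and>
           (\<lambda>n. A2_norm \<omega> (\<lambda>z. T (F (s n)) z - g z)) \<longlonglongrightarrow> 0))"

section \<open>Toeplitz operators\<close>

definition finite_borel_disk :: "complex measure \<Rightarrow> bool" where
  "finite_borel_disk \<mu> \<longleftrightarrow> sets \<mu> = sets (restrict_space borel disk) \<and> finite_measure \<mu>"

definition toeplitz ::
    "(complex \<Rightarrow> real) \<Rightarrow> complex measure \<Rightarrow> (complex \<Rightarrow> complex) \<Rightarrow> complex \<Rightarrow> complex" where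
  "toeplitz \<omega> \<mu> f z = (LINT \<xi>|\<mu>. f \<xi> * cnj (kernel \<omega> z \<xi>) * complex_of_real (\<omega> \<xi>))"

text \<open>The Bochner integral of a non-integrable function is 0, so that the integral defining
  \<open>T\<^sub>\<mu> f\<close> exists is a separate condition.\<close>

definition toeplitz_defined :: "(complex \<Rightarrow> real) \<Rightarrow> complex measure \<Rightarrow> bool" where
  "toeplitz_defined \<omega> \<mu> \<longleftrightarrow> (\<forall>f\<in>A2 \<omega>. \<forall>z\<in>disk.
     integrable \<mu> (\<lambda>\<xi>. f \<xi> * cnj (kernel \<omega> z \<xi>) * complex_of_real (\<omega> \<xi>)))"

definition toeplitz_bounded :: "(complex \<Rightarrow> real) \<Rightarrow> complex measure \<Rightarrow> bool" where
  "toeplitz_bounded \<omega> \<mu> \<longleftrightarrow> toeplitz_defined \<omega> \<mu> \<and> A2_bounded \<omega> (toeplitz \<omega> \<mu>)"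

definition toeplitz_compact :: "(complex \<Rightarrow> real) \<Rightarrow> complex measure \<Rightarrow> bool" where
  "toeplitz_compact \<omega> \<mu> \<longleftrightarrow> toeplitz_defined \<omega> \<mu> \<and> A2_compact \<omega> (toeplitz \<omega> \<mu>)"

definition averaging ::
    "(complex \<Rightarrow> real) \<Rightarrow> complex measure \<Rightarrow> real \<Rightarrow> complex \<Rightarrow> real" where
  "averaging \<tau> \<mu> \<delta> z = measure \<mu> (ball z (\<delta> * \<tau> z)) / (\<tau> z)\<^sup>2"

text \<open>Suprema of the averaging function are taken in \<^typ>\<open>ennreal\<close>, so that unbounded
  families have supremum \<^term>\<open>\<infinity> :: ennreal\<close>.\<close>

definition sup_averaging ::
    "(complex \<Rightarrow> real) \<Rightarrow> complex measure \<Rightarrow> real \<Rightarrow> ennreal" where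
  "sup_averaging \<tau> \<mu> \<delta> = (SUP z\<in>disk. ennreal (averaging \<tau> \<mu> \<delta> z))"

end

theory Submission
  imports Defs "HOL-Complex_Analysis.Complex_Analysis"
begin

text \<open>Since the weight \<open>\<omega> = e\<^sup>-\<^sup>2\<^sup>\<phi>\<close> is radial, everything reduces to one variable. With
  \<open>q r = r \<phi>' r\<close> one has \<open>q' r = r \<Delta>\<phi> r\<close>, which is comparable to \<open>r / \<tau>\<^sup>2\<close>. Near \<open>a\<close>, on the
  scale \<open>\<tau> a\<close>, the function \<open>\<phi>\<close> differs boundedly from \<open>\<phi> a + q |a| ln |z / a|\<close>, so \<open>\<omega>\<close> is comparable to
  \<open>\<omega> a\<close> times the squared modulus of a power of \<open>z / a\<close>; this yields the weighted sub-mean value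
  inequality, hence a Carleson embedding controlled by the averages of \<open>\<mu>\<close>.

  No special test functions are needed: monomials are orthogonal, and the roughly \<open>1 / \<tau> z\<close>
  exponents \<open>n\<close> just above \<open>q |z|\<close> satisfy \<open>\<parallel>\<xi>\<^sup>n\<parallel>\<^sup>2 \<le> C \<tau> z |z|\<^sup>2\<^sup>n \<omega> z\<close> by Laplace's method, which
  gives \<open>\<parallel>K\<^sub>z\<parallel>\<^sup>2 \<ge> c / (\<omega> z \<tau> z\<^sup>2)\<close>. Consequently \<open>|K\<^sub>z|\<^sup>2 \<omega>\<close> is bounded below by
  \<open>c \<parallel>K\<^sub>z\<parallel>\<^sup>2 / \<tau> z\<^sup>2\<close> near \<open>z\<close>, so the averages of \<open>\<mu>\<close> are dominated by the Berezin transform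
  \<open>T\<^sub>\<mu> K\<^sub>z z / \<parallel>K\<^sub>z\<parallel>\<^sup>2\<close>.\<close>

section \<open>Rotation invariance and the area mean value property\<close>

text \<open>Off-diagonal decay of the kernel is never estimated. The upper bounds go through the
  form \<open>b f g\<close>, the integral of \<open>f * cnj g * \<omega>\<close> against
  \<open>\<mu>\<close>: the Carleson embedding bounds it, the Riesz theorem represents it, and
  testing with the kernel identifies the representing function with the Toeplitz integral. The same
  argument bounds the squared norm of the image of \<open>f\<close> by the integral of
  \<open>|f|^2 * \<omega>\<close> against \<open>\<mu>\<close>, so compactness only concerns the
  embedding: small averages control it near the boundary, locally uniform convergence inside. Two
  scales occur. Up to radius \<open>m * \<tau> z\<close> disks stay inside the unit disk and
  \<open>\<tau>\<close> is constant up to a factor, which suffices for the upper bounds. The lower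
  bound needs a radius on which the kernel cannot drop to 0; this smaller multiple of
  \<open>\<tau>\<close> becomes \<open>\<delta>0\<close>. The number of exponents has order
  \<open>1 / \<tau>\<close> because \<open>q\<close> has slope of order \<open>1 / \<tau>^2\<close>:
  its growth over a distance \<open>\<tau>\<close> is how far an exponent may lie from
  \<open>q |z|\<close> while its monomial still peaks within \<open>\<tau>\<close> of
  \<open>|z|\<close>.\<close>

lemma distr_lborel_Complex:
  "distr (lborel \<Otimes>\<^sub>M lborel) borel (\<lambda>(x, y). Complex x y) = (lborel :: complex measure)"
proof (rule lborel_eqI[symmetric])
  have m: "(\<lambda>(x, y). Complex x y) \<in> borel_measurable (lborel \<Otimes>\<^sub>M lborel)"
    unfolding Complex_eq by measurable
  show "sets (distr (lborel \<Otimes>\<^sub>M lborel) borel (\<lambda>(x, y). Complex x y)) = sets borel"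
    by simp
  fix l u :: complex
  assume lu: "\<And>b. b \<in> Basis \<Longrightarrow> l \<bullet> b \<le> u \<bullet> b"
  have le: "Re l \<le> Re u" "Im l \<le> Im u"
    using lu[of 1] lu[of \<i>] by (auto simp: Basis_complex_def)
  have eq: "(\<lambda>(x, y). Complex x y) -` box l u = {Re l<..<Re u} \<times> {Im l<..<Im u}"
    by (auto simp: box_def Basis_complex_def)
  have "emeasure (distr (lborel \<Otimes>\<^sub>M lborel) borel (\<lambda>(x, y). Complex x y)) (box l u)
      = emeasure (lborel \<Otimes>\<^sub>M lborel) ({Re l<..<Re u} \<times> {Im l<..<Im u})"
    using m by (subst emeasure_distr) (auto simp: eq space_pair_measure)
  also have "\<dots> = ennreal (Re u - Re l) * ennreal (Im u - Im l)"
    using le by (subst lborel.emeasure_pair_measure_Times) auto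
  also have "\<dots> = ennreal (\<Prod>b\<in>Basis. (u - l) \<bullet> b)"
    using le by (simp add: Basis_complex_def ennreal_mult'')
  finally show "emeasure (distr (lborel \<Otimes>\<^sub>M lborel) borel (\<lambda>(x, y). Complex x y)) (box l u)
     = ennreal (\<Prod>b\<in>Basis. (u - l) \<bullet> b)" .
qed

text \<open>Both orders of integration are recorded because a shear moves one coordinate only, and
  that coordinate has to be the inner variable.\<close>

lemma nn_integral_lborel_complex:
  fixes f :: "complex \<Rightarrow> ennreal"
  assumes [measurable]: "f \<in> borel_measurable borel"
  shows "(\<integral>\<^sup>+z. f z \<partial>lborel) = (\<integral>\<^sup>+x. \<integral>\<^sup>+y. f (Complex x y) \<partial>lborel \<partial>lborel)"
    and "(\<integral>\<^sup>+z. f z \<partial>lborel) = (\<integral>\<^sup>+y. \<integral>\<^sup>+x. f (Complex x y) \<partial>lborel \<partial>lborel)"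
proof -
  have m[measurable]: "(\<lambda>(x, y). Complex x y) \<in> borel_measurable (lborel \<Otimes>\<^sub>M lborel)"
    unfolding Complex_eq by measurable
  have m'[measurable]: "(\<lambda>x. f (Complex (fst x) (snd x))) \<in> borel_measurable (lborel \<Otimes>\<^sub>M lborel)"
    using measurable_compose[OF m, of f borel] by (simp add: case_prod_beta)
  have "(\<integral>\<^sup>+z. f z \<partial>lborel) = (\<integral>\<^sup>+p. f (Complex (fst p) (snd p)) \<partial>(lborel \<Otimes>\<^sub>M lborel))"
    by (subst distr_lborel_Complex[symmetric], subst nn_integral_distr) (auto simp: case_prod_beta)
  then show "(\<integral>\<^sup>+z. f z \<partial>lborel) = (\<integral>\<^sup>+x. \<integral>\<^sup>+y. f (Complex x y) \<partial>lborel \<partial>lborel)"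
    and "(\<integral>\<^sup>+z. f z \<partial>lborel) = (\<integral>\<^sup>+y. \<integral>\<^sup>+x. f (Complex x y) \<partial>lborel \<partial>lborel)"
    using lborel.nn_integral_fst[OF m'] lborel_pair.nn_integral_snd[OF m'] 
    by (auto simp: case_prod_beta)
qed

text \<open>On each horizontal line the shear is a translation, under which one-dimensional Lebesgue
  measure is invariant.\<close>

lemma nn_integral_shear_Re:
  fixes f :: "complex \<Rightarrow> ennreal"
  assumes [measurable]: "f \<in> borel_measurable borel"
  shows "(\<integral>\<^sup>+z. f (z + of_real (t * Im z)) \<partial>lborel) = (\<integral>\<^sup>+z. f z \<partial>lborel)"
proof -
  have "(\<integral>\<^sup>+z. f (z + of_real (t * Im z)) \<partial>lborel)
      = (\<integral>\<^sup>+y. \<integral>\<^sup>+x. f (Complex (t * y + 1 * x) y) \<partial>lborel \<partial>lborel)"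
    by (subst nn_integral_lborel_complex(2))
      (auto intro!: nn_integral_cong arg_cong[where f = f] simp: complex_eq_iff)
  also have "\<dots> = (\<integral>\<^sup>+y. \<integral>\<^sup>+x. f (Complex x y) \<partial>lborel \<partial>lborel)"
  proof (rule nn_integral_cong)
    fix y :: real
    have [measurable]: "(\<lambda>x. f (Complex x y)) \<in> borel_measurable borel"
      unfolding Complex_eq by measurable
    show "(\<integral>\<^sup>+x. f (Complex (t * y + 1 * x) y) \<partial>lborel) = (\<integral>\<^sup>+x. f (Complex x y) \<partial>lborel)"
      using nn_integral_real_affine[of "\<lambda>x. f (Complex x y)" 1 "t * y"] by simp
  qed
  finally show ?thesis
    by (simp add: nn_integral_lborel_complex(2)[of f])
qed

lemma nn_integral_shear_Im:
  fixes f :: "complex \<Rightarrow> ennreal"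
  assumes [measurable]: "f \<in> borel_measurable borel"
  shows "(\<integral>\<^sup>+z. f (z + \<i> * of_real (t * Re z)) \<partial>lborel) = (\<integral>\<^sup>+z. f z \<partial>lborel)"
proof -
  have "(\<integral>\<^sup>+z. f (z + \<i> * of_real (t * Re z)) \<partial>lborel)
      = (\<integral>\<^sup>+x. \<integral>\<^sup>+y. f (Complex x (t * x + 1 * y)) \<partial>lborel \<partial>lborel)"
    by (subst nn_integral_lborel_complex(1))
      (auto intro!: nn_integral_cong arg_cong[where f = f] simp: complex_eq_iff)
  also have "\<dots> = (\<integral>\<^sup>+x. \<integral>\<^sup>+y. f (Complex x y) \<partial>lborel \<partial>lborel)"
  proof (rule nn_integral_cong)
    fix x :: real
    have [measurable]: "(\<lambda>y. f (Complex x y)) \<in> borel_measurable borel"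
      unfolding Complex_eq by measurable
    show "(\<integral>\<^sup>+y. f (Complex x (t * x + 1 * y)) \<partial>lborel) = (\<integral>\<^sup>+y. f (Complex x y) \<partial>lborel)"
      using nn_integral_real_affine[of "\<lambda>y. f (Complex x y)" 1 "t * x"] by simp
  qed
  finally show ?thesis
    by (simp add: nn_integral_lborel_complex(1)[of f])
qed

text \<open>A rotation other than \<open>z \<mapsto> -z\<close> is a product of three shears.\<close>

lemma nn_integral_rotate:
  fixes f :: "complex \<Rightarrow> ennreal"
  assumes f[measurable]: "f \<in> borel_measurable borel" and c: "norm c = 1" "c \<noteq> -1"
  shows "(\<integral>\<^sup>+z. f (c * z) \<partial>lborel) = (\<integral>\<^sup>+z. f z \<partial>lborel)"
proof -
  define a b where "a = Re c" and "b = Im c"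
  have ab: "a * a + b * b = 1"
    using c(1) cmod_power2[of c] unfolding a_def b_def power2_eq_square by simp
  have "a \<noteq> -1"
  proof
    assume "a = -1"
    with ab have "b = 0" by simp
    with \<open>a = -1\<close> have "c = -1" unfolding a_def b_def by (simp add: complex_eq_iff)
    with c(2) show False by simp
  qed
  then have a1: "1 + a \<noteq> 0" by simp
  \<comment> \<open>For \<open>c = cis \<theta>\<close> this is \<open>- tan (\<theta> / 2)\<close>,
    the parameter of the two outer shears; it breaks down exactly at the half turn. The middle shear
    has parameter \<open>b = sin \<theta>\<close>.\<close>
  define t where "t = - b / (1 + a)"
  have tb: "t * b = a - 1"
  proof -
    have "t * b * (1 + a) = (a - 1) * (1 + a)"
    proof -
      have "t * b * (1 + a) = - (b * b)"
        using a1 by (simp add: t_def)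
      also have "\<dots> = (a - 1) * (1 + a)"
        using ab by (simp add: algebra_simps)
      finally show ?thesis .
    qed
    then show ?thesis using a1 by simp
  qed
  have "t * (1 + a) = - b"
    using a1 by (simp add: t_def)
  then have t1: "t + t * a = - b"
    by (simp add: algebra_simps)
  define S where "S s z = z + of_real (s * Im z)" for s z
  define S' where "S' s z = z + \<i> * of_real (s * Re z)" for s z
  have "c * z = S t (S' b (S t z))" for z
  proof -
    have "Re (S t (S' b (S t z))) = Re z * (1 + t * b) + Im z * (t + t * (1 + t * b))"
      by (simp add: S_def S'_def algebra_simps)
    also have "\<dots> = Re (c * z)"
      using t1 unfolding tb by (simp add: a_def b_def algebra_simps)
    finally have 1: "Re (c * z) = Re (S t (S' b (S t z)))" ..
    have "Im (S t (S' b (S t z))) = b * Re z + (1 + t * b) * Im z"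
      by (simp add: S_def S'_def algebra_simps)
    also have "\<dots> = Im (c * z)"
      unfolding tb by (simp add: a_def b_def algebra_simps)
    finally show ?thesis using 1 by (simp add: complex_eq_iff)
  qed
  moreover have [measurable]: "S s \<in> borel_measurable borel" "S' s \<in> borel_measurable borel" for s
    unfolding S_def S'_def by measurable
  moreover have "(\<integral>\<^sup>+z. f (S t (S' b (S t z))) \<partial>lborel) = (\<integral>\<^sup>+z. f (S t (S' b z)) \<partial>lborel)"
    using nn_integral_shear_Re[of "\<lambda>z. f (S t (S' b z))" t] by (simp add: S_def)
  moreover have "(\<integral>\<^sup>+z. f (S t (S' b z)) \<partial>lborel) = (\<integral>\<^sup>+z. f (S t z) \<partial>lborel)"
    using nn_integral_shear_Im[of "\<lambda>z. f (S t z)" b] by (simp add: S'_def)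
  moreover have "(\<integral>\<^sup>+z. f (S t z) \<partial>lborel) = (\<integral>\<^sup>+z. f z \<partial>lborel)"
    using nn_integral_shear_Re[of f t] by (simp add: S_def)
  ultimately show ?thesis by simp
qed

lemma distr_lborel_rotate:
  assumes "norm c = 1" "c \<noteq> -1"
  shows "distr lborel borel ((*) c) = (lborel :: complex measure)"
proof (rule measure_eqI)
  fix A :: "complex set" assume "A \<in> sets (distr lborel borel ((*) c))"
  then have A[measurable]: "A \<in> sets borel" by simp
  have "emeasure (distr lborel borel ((*) c)) A = (\<integral>\<^sup>+z. indicator A (c * z) \<partial>lborel)"
    by (simp add: nn_integral_distr flip: nn_integral_indicator)
  also have "\<dots> = emeasure lborel A"
    using nn_integral_rotate[of "indicator A" c] assms by simp
  finally show "emeasure (distr lborel borel ((*) c)) A = emeasure lborel A" .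
qed simp

text \<open>Turning the disk by \<open>pi / (2 * k)\<close> multiplies \<open>z ^ k\<close> by
  \<open>\<i>\<close>, so the integral equals \<open>\<i>\<close> times itself.\<close>

lemma integral_power_zero:
  assumes "k > 0"
  shows "(LINT z:cball 0 s|lborel. z ^ k) = (0::complex)"
proof -
  \<comment> \<open>The angle \<open>pi / k\<close>, with factor -1, would for \<open>k = 1\<close>
    be the half turn excluded in \<open>distr_lborel_rotate\<close>.\<close>
  define c where "c = cis (pi / (2 * real k))"
  have nc: "norm c = 1" by (simp add: c_def)
  have "c \<noteq> -1"
  proof
    assume "c = -1"
    then have "cos (pi / (2 * real k)) = -1"
      by (simp add: c_def complex_eq_iff)
    moreover have "cos (pi / (2 * real k)) \<ge> 0"
    proof (rule cos_ge_zero)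
      have "0 \<le> pi / (2 * real k)" by simp
      then show "- (pi / 2) \<le> pi / (2 * real k)" using pi_ge_zero by linarith
      show "pi / (2 * real k) \<le> pi / 2" using assms by (simp add: field_simps)
    qed
    ultimately show False by simp
  qed
  have ck: "c ^ k = \<i>"
    using assms unfolding c_def Complex.DeMoivre by simp
  have "(LINT z:cball 0 s|lborel. z ^ k) = (LINT z|distr lborel borel ((*) c). indicator (cball 0 s) z *\<^sub>R z ^ k)"
    by (simp add: distr_lborel_rotate[OF nc \<open>c \<noteq> -1\<close>] set_lebesgue_integral_def)
  also have "\<dots> = (LINT z|lborel. indicator (cball 0 s) (c * z) *\<^sub>R (c * z) ^ k)"
    by (rule integral_distr) (auto intro!: borel_measurable_scaleR borel_measurable_power borel_measurable_indicator)
  also have "\<dots> = (LINT z|lborel. \<i> * (indicator (cball 0 s) z *\<^sub>R z ^ k))"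
    by (rule Bochner_Integration.integral_cong)
      (auto simp: indicator_def dist_norm norm_mult nc power_mult_distrib ck)
  also have "\<dots> = \<i> * (LINT z:cball 0 s|lborel. z ^ k)"
    unfolding set_lebesgue_integral_def by (rule integral_mult_right_zero)
  finally have "(1 - \<i>) * (LINT z:cball 0 s|lborel. z ^ k) = 0"
    by (metis diff_self left_diff_distrib mult_1)
  moreover have "1 - \<i> \<noteq> 0"
    by (simp add: complex_eq_iff)
  ultimately show ?thesis by simp
qed

text \<open>The Taylor series is integrated term by term, and by \<open>integral_power_zero\<close>
  only the constant term survives.\<close>

lemma area_mean_value:
  assumes f: "f holomorphic_on ball 0 r" and s: "0 < s" "s < r"
  shows "(LINT z:cball 0 s|lborel. f z) = of_real (pi * s\<^sup>2) * f 0"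
proof -
  define c where "c k = (deriv ^^ k) f 0 / fact k" for k
  have sums: "(\<lambda>k. c k * z ^ k) sums f z" if "z \<in> ball 0 r" for z
    using holomorphic_power_series[OF f that] by (simp add: c_def)
  \<comment> \<open>Convergence at a point of modulus strictly between \<open>s\<close> and
    \<open>r\<close> gives absolute convergence at \<open>s\<close>; this is the majorant for
    exchanging sum and integral.\<close>
  have summ: "summable (\<lambda>k. norm (c k * of_real s ^ k))"
  proof (rule powser_insidea)
    have "complex_of_real ((s + r) / 2) \<in> ball 0 r"
      unfolding mem_ball_0 norm_of_real using s by simp
    then show "summable (\<lambda>n. c n * of_real ((s + r) / 2) ^ n)"
      by (rule sums_summable[OF sums])
    show "norm (complex_of_real s) < norm (complex_of_real ((s + r) / 2))"
      unfolding norm_of_real using s by simp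
  qed
  have fin: "emeasure lborel (cball 0 s :: complex set) < \<infinity>"
    by (rule emeasure_lborel_cball_finite)
  have int: "integrable lborel (\<lambda>z. indicator (cball 0 s) z *\<^sub>R (c k * z ^ k))" for k
    by (rule borel_integrable_compact) (auto intro!: continuous_intros)
  have bd: "norm (indicator (cball 0 s) z *\<^sub>R (c k * z ^ k)) \<le> norm (c k * of_real s ^ k) * indicator (cball 0 s) z"
    for k and z :: complex
    using s by (auto simp: indicator_def norm_mult norm_power intro!: mult_left_mono power_mono)
  have "(LINT z:cball 0 s|lborel. f z) = (LINT z|lborel. (\<Sum>k. indicator (cball 0 s) z *\<^sub>R (c k * z ^ k)))"
    unfolding set_lebesgue_integral_def
  proof (rule Bochner_Integration.integral_cong)
    fix z :: complex
    show "indicator (cball 0 s) z *\<^sub>R f z = (\<Sum>k. indicator (cball 0 s) z *\<^sub>R (c k * z ^ k))"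
      using sums[of z] s by (auto simp: indicator_def sums_iff)
  qed simp
  also have "\<dots> = (\<Sum>k. LINT z|lborel. indicator (cball 0 s) z *\<^sub>R (c k * z ^ k))"
  proof (rule integral_suminf[OF int])
    show "AE z in lborel. summable (\<lambda>k. norm (indicator (cball 0 s) z *\<^sub>R (c k * z ^ k)))"
    proof (rule AE_I2)
      fix z :: complex
      show "summable (\<lambda>k. norm (indicator (cball 0 s) z *\<^sub>R (c k * z ^ k)))"
        using bd[of z] by (intro summable_comparison_test[OF _ summable_mult2[OF summ, of "indicator (cball 0 s) z"]]) auto
    qed
    show "summable (\<lambda>k. LINT z|lborel. norm (indicator (cball 0 s) z *\<^sub>R (c k * z ^ k)))"
    proof (rule summable_comparison_test[OF _ summable_mult2[OF summ, of "measure lborel (cball 0 s :: complex set)"]])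
      have "(LINT z|lborel. norm (indicator (cball 0 s) z *\<^sub>R (c k * z ^ k))) 
          \<le> (LINT z|lborel. norm (c k * of_real s ^ k) * indicator (cball 0 s :: complex set) z)" for k
        using fin by (intro integral_mono integrable_norm int bd) (auto intro!: integrable_mult_right)
      then show "\<exists>N. \<forall>k\<ge>N. norm (LINT z|lborel. norm (indicator (cball 0 s) z *\<^sub>R (c k * z ^ k)))
           \<le> norm (c k * of_real s ^ k) * measure lborel (cball 0 s :: complex set)"
        by (auto simp: integral_nonneg_AE)
    qed
  qed
  also have "\<dots> = (\<Sum>k. c k * (LINT z:cball 0 s|lborel. z ^ k))"
    unfolding set_lebesgue_integral_def by (simp flip: integral_mult_right_zero)
  also have "\<dots> = (\<Sum>k\<in>{0}. c k * (LINT z:cball 0 s|lborel. z ^ k))"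
    by (rule suminf_finite) (auto simp: integral_power_zero)
  also have "\<dots> = of_real (pi * s\<^sup>2) * f 0"
  proof -
    have "measure lborel (cball 0 s :: complex set) = pi * s\<^sup>2"
      using content_cball[of s "0::complex"] s by (simp add: eval_unit_ball_vol)
    then show ?thesis
      using sums[of 0] s fin by (simp add: set_lebesgue_integral_def c_def scaleR_conv_of_real)
  qed
  finally show ?thesis .
qed

section \<open>Normalised area measure and the mean value inequality on the disk\<close>

lemma sets_dA: "sets dA = sets (restrict_space borel disk)"
  by (simp add: dA_def sets_restrict_space)

lemma space_dA [simp]: "space dA = disk"
  by (simp add: dA_def space_restrict_space)

lemma borel_measurable_dA:
  fixes f :: "complex \<Rightarrow> 'a::topological_space"
  shows "f \<in> borel_measurable dA \<longleftrightarrow> f \<in> borel_measurable (restrict_space borel disk)"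
  by (simp only: measurable_cong_sets[OF sets_dA refl])

lemma continuous_on_borel_measurable_dA:
  fixes f :: "complex \<Rightarrow> 'a::topological_space"
  shows "continuous_on disk f \<Longrightarrow> f \<in> borel_measurable dA"
  by (simp add: borel_measurable_dA borel_measurable_continuous_on_restrict)

lemma nn_integral_dA:
  assumes "f \<in> borel_measurable dA"
  shows "(\<integral>\<^sup>+z. f z \<partial>dA) = ennreal (1 / pi) * (\<integral>\<^sup>+z. f z * indicator disk z \<partial>lborel)"
proof -
  have f[measurable]: "f \<in> borel_measurable (restrict_space lborel disk)"
  proof -
    have "sets dA = sets (restrict_space lborel disk)"
      by (simp add: dA_def)
    then show ?thesis using assms measurable_cong_sets[OF _ refl] by blast
  qed
  have "(\<integral>\<^sup>+z. f z \<partial>dA) = (\<integral>\<^sup>+z. ennreal (1 / pi) * f z \<partial>restrict_space lborel disk)"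
    unfolding dA_def by (rule nn_integral_density) auto
  also have "\<dots> = ennreal (1 / pi) * (\<integral>\<^sup>+z. f z \<partial>restrict_space lborel disk)"
    by (rule nn_integral_cmult) auto
  also have "(\<integral>\<^sup>+z. f z \<partial>restrict_space lborel disk) = (\<integral>\<^sup>+z. f z * indicator disk z \<partial>lborel)"
    by (rule nn_integral_restrict_space) auto
  finally show ?thesis .
qed

lemma sets_dA_iff: "A \<in> sets dA \<longleftrightarrow> A \<in> sets borel \<and> A \<subseteq> disk"
  unfolding sets_dA by (subst sets_restrict_space_iff) auto

lemma emeasure_dA:
  assumes "A \<in> sets borel" "A \<subseteq> disk"
  shows "emeasure dA A = ennreal (1 / pi) * emeasure lborel A"
proof -
  have A: "A \<in> sets dA" using assms by (simp add: sets_dA_iff)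
  have "emeasure dA A = (\<integral>\<^sup>+z. indicator A z \<partial>dA)"
    using A by simp
  also have "\<dots> = ennreal (1 / pi) * (\<integral>\<^sup>+z. indicator A z * indicator disk z \<partial>lborel)"
    using A by (intro nn_integral_dA) auto
  also have "(\<integral>\<^sup>+z. indicator A z * indicator disk z \<partial>lborel) = (\<integral>\<^sup>+z. indicator A z \<partial>lborel)"
    using assms(2) by (intro nn_integral_cong) (auto simp: indicator_def)
  finally show ?thesis using assms by simp
qed

lemma emeasure_dA_ball:
  assumes "0 \<le> r" "r \<le> 1"
  shows "emeasure dA (ball 0 r) = ennreal (r\<^sup>2)"
proof -
  have "emeasure lborel (ball 0 r :: complex set) = ennreal (pi * r\<^sup>2)"
    using emeasure_ball[of r "0::complex"] assms by (simp add: eval_unit_ball_vol)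
  then show ?thesis
    using assms by (simp add: emeasure_dA ennreal_mult'[symmetric] subset_ball)
qed

lemma finite_measure_dA: "finite_measure dA"
  by (rule finite_measureI) (simp add: emeasure_dA_ball)

text \<open>Stated for \<open>dA\<close> itself because the weight, in the orthogonality of the
  monomials, is only known to be measurable on the disk.\<close>

lemma distr_dA_rotate:
  assumes "norm c = 1" "c \<noteq> -1"
  shows "distr dA dA ((*) c) = dA"
proof (rule measure_eqI)
  have m: "(*) c \<in> measurable dA dA"
    unfolding measurable_cong_sets[OF sets_dA sets_dA]
    by (rule measurable_restrict_space3) (auto simp: norm_mult assms)
  fix A assume "A \<in> sets (distr dA dA ((*) c))"
  then have A: "A \<in> sets dA" and A'[measurable]: "A \<in> sets borel" and "A \<subseteq> disk"
    by (auto simp: sets_dA_iff)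
  have sub: "(*) c -` A \<subseteq> disk"
  proof
    fix z assume "z \<in> (*) c -` A"
    then have "c * z \<in> disk" using \<open>A \<subseteq> disk\<close> by blast
    then show "z \<in> disk" by (simp add: norm_mult assms)
  qed
  then have eq: "(*) c -` A \<inter> space dA = (*) c -` A" by auto
  have meas: "(*) c -` A \<in> sets borel"
    using measurable_sets[of "(*) c" borel borel A] by simp
  have "emeasure (distr dA dA ((*) c)) A = emeasure dA ((*) c -` A)"
    by (simp add: emeasure_distr[OF m A] eq del: space_dA)
  also have "\<dots> = ennreal (1 / pi) * emeasure lborel ((*) c -` A)"
    using sub meas by (rule emeasure_dA[rotated])
  also have "emeasure lborel ((*) c -` A) = emeasure (distr lborel borel ((*) c)) A"
    by (simp add: emeasure_distr)
  also have "\<dots> = emeasure lborel A"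
    by (simp add: distr_lborel_rotate assms)
  finally show "emeasure (distr dA dA ((*) c)) A = emeasure dA A"
    using \<open>A \<subseteq> disk\<close> by (simp add: emeasure_dA)
qed simp

text \<open>The mean value property is applied to \<open>f\<^sup>2\<close>; working on the disk of half the radius
  avoids a limit at the expense of the constant 4.\<close>

lemma norm_squared_le_mean:
  assumes f: "f holomorphic_on ball a \<rho>" and \<rho>: "\<rho> > 0" and sub: "ball a \<rho> \<subseteq> disk"
  shows "ennreal ((norm (f a))\<^sup>2 * \<rho>\<^sup>2 / 4)
     \<le> (\<integral>\<^sup>+z. ennreal ((norm (f z))\<^sup>2) * indicator (ball a \<rho>) z \<partial>dA)"
proof -
  define s where "s = \<rho> / 2"
  define h where "h w = (f (a + w))\<^sup>2" for w
  define F where "F z = ennreal (indicator (cball a s) z *\<^sub>R (norm (f z))\<^sup>2)" for z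
  have s: "0 < s" "s < \<rho>" using \<rho> by (auto simp: s_def)
  have sub': "cball a s \<subseteq> ball a \<rho>" using s by auto
  have contf: "continuous_on (ball a \<rho>) f"
    by (rule holomorphic_on_imp_continuous_on[OF f])
  have [measurable]: "F \<in> borel_measurable borel"
    unfolding F_def
    by (intro measurable_compose[OF _ measurable_ennreal] borel_measurable_continuous_on_indicator
         continuous_intros continuous_on_subset[OF contf sub']) auto
  have h: "h holomorphic_on ball 0 \<rho>"
    unfolding h_def
    by (intro holomorphic_intros holomorphic_on_compose_gen[OF _ f, unfolded o_def])
       (auto simp: dist_norm)
  have int: "set_integrable lborel (cball 0 s) h"
    unfolding set_integrable_def using s
    by (intro borel_integrable_compact continuous_on_subset[OF holomorphic_on_imp_continuous_on[OF h]]) auto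
  have "ennreal (pi * s\<^sup>2 * (norm (f a))\<^sup>2) = ennreal (norm (LINT w:cball 0 s|lborel. h w))"
    using area_mean_value[OF h s] by (simp add: h_def norm_mult norm_power)
  also have "\<dots> \<le> (\<integral>\<^sup>+w. ennreal (norm (indicator (cball 0 s) w *\<^sub>R h w)) \<partial>lborel)"
    unfolding set_lebesgue_integral_def
    by (rule integral_norm_bound_ennreal[OF int[unfolded set_integrable_def]])
  also have "\<dots> = (\<integral>\<^sup>+w. F (a + w) \<partial>lborel)"
    by (rule nn_integral_cong) (auto simp: F_def h_def indicator_def norm_power dist_norm)
  also have "\<dots> = (\<integral>\<^sup>+z. F z \<partial>lborel)"
    using nn_integral_distr[of "(+) a" lborel borel F] lborel_distr_plus[of a] by simp
  also have "\<dots> = (\<integral>\<^sup>+z. F z * indicator disk z \<partial>lborel)"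
    using subset_trans[OF sub' sub]
    by (intro nn_integral_cong) (auto simp: F_def indicator_def subset_eq)
  finally have 1: "ennreal (pi * s\<^sup>2 * (norm (f a))\<^sup>2) \<le> (\<integral>\<^sup>+z. F z * indicator disk z \<partial>lborel)" .
  have "ennreal (s\<^sup>2 * (norm (f a))\<^sup>2) = ennreal (1 / pi) * ennreal (pi * s\<^sup>2 * (norm (f a))\<^sup>2)"
    by (simp add: ennreal_mult'[symmetric])
  also have "\<dots> \<le> ennreal (1 / pi) * (\<integral>\<^sup>+z. F z * indicator disk z \<partial>lborel)"
    by (rule mult_left_mono[OF 1]) simp
  also have "\<dots> = (\<integral>\<^sup>+z. F z \<partial>dA)"
    by (rule nn_integral_dA[symmetric])
      (simp add: borel_measurable_dA measurable_restrict_space1)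
  also have "\<dots> \<le> (\<integral>\<^sup>+z. ennreal ((norm (f z))\<^sup>2) * indicator (ball a \<rho>) z \<partial>dA)"
    using sub' by (intro nn_integral_mono) (auto simp: F_def indicator_def)
  finally show ?thesis by (simp add: s_def power_divide mult.commute)
qed

section \<open>Radial weights\<close>

lemma has_real_derivative_dir_deriv:
  assumes "C1_on S u" "b \<in> Basis" "z \<in> S"
  shows "((\<lambda>t. u (z + t *\<^sub>R b)) has_real_derivative dir_deriv b u z) (at 0)"
  using assms unfolding C1_on_def dir_deriv_def
  by (simp add: DERIV_deriv_iff_real_differentiable)

lemma profile_has_real_derivative:
  assumes "C1_on disk u" "\<bar>r\<bar> < 1"
  shows "(profile u has_real_derivative dir_deriv 1 u (of_real r)) (at r)"
proof -
  have "((\<lambda>t. u (of_real r + t *\<^sub>R 1)) has_real_derivative dir_deriv 1 u (of_real r)) (at 0)"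
    using assms by (intro has_real_derivative_dir_deriv) (auto simp: Basis_complex_def)
  then have "((\<lambda>t. profile u (t + r)) has_real_derivative dir_deriv 1 u (of_real r)) (at 0)"
    by (simp add: scaleR_conv_of_real add.commute)
  then show ?thesis
    using DERIV_shift[of "profile u" "dir_deriv 1 u (of_real r)" 0 r] by simp
qed

lemma real_mean_value_bound:
  fixes f :: "real \<Rightarrow> real"
  assumes "\<And>x. x \<in> {a..b} \<Longrightarrow> (f has_real_derivative f' x) (at x)"
    and "\<And>x. x \<in> {a..b} \<Longrightarrow> \<bar>f' x\<bar> \<le> K" and "x \<in> {a..b}" "y \<in> {a..b}"
  shows "\<bar>f x - f y\<bar> \<le> K * \<bar>x - y\<bar>"
  using field_differentiable_bound[of "{a..b}" f f' K x y] assms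
  by (simp add: has_field_derivative_at_within)

lemma radialD: "\<lbrakk>radial u; z \<in> disk; w \<in> disk; norm z = norm w\<rbrakk> \<Longrightarrow> u z = u w"
  unfolding radial_def by blast

text \<open>On the vertical line through \<open>r\<close> the function is its profile at
  \<open>\<rho> t = sqrt (r^2 + t^2)\<close>. The first derivative there is
  \<open>p1 (\<rho> t) * t / \<rho> t\<close>, which vanishes at \<open>t = 0\<close> with slope
  \<open>p1 r / r\<close>.\<close>

lemma laplacian_radial:
  assumes C2: "C2_on disk u" and rad: "radial u" and r: "0 < r" "r < 1"
  shows "laplacian u (of_real r)
    = dir_deriv 1 (dir_deriv 1 u) (of_real r) + dir_deriv 1 u (of_real r) / r"
proof -
  define p1 where "p1 s = dir_deriv 1 u (of_real s)" for s
  define p2 where "p2 s = dir_deriv 1 (dir_deriv 1 u) (of_real s)" for s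
  have C1: "C1_on disk u" "C1_on disk (dir_deriv 1 u)"
    using C2 by (auto simp: C2_on_def Basis_complex_def)
  have p: "(profile u has_real_derivative p1 s) (at s)" if "\<bar>s\<bar> < 1" for s
    using profile_has_real_derivative[OF C1(1) that] by (simp add: p1_def)
  have p1: "(p1 has_real_derivative p2 s) (at s)" if "\<bar>s\<bar> < 1" for s
    using profile_has_real_derivative[OF C1(2) that] by (simp add: p1_def[abs_def] p2_def)
  define \<rho> where "\<rho> t = sqrt (r\<^sup>2 + t\<^sup>2)" for t
  have \<rho>0: "\<rho> 0 = r" using r by (simp add: \<rho>_def)
  have \<rho>_pos: "\<rho> t > 0" for t
    using r by (simp add: \<rho>_def add_pos_nonneg)
  have \<rho>': "(\<rho> has_real_derivative t / \<rho> t) (at t)" for t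
    unfolding \<rho>_def using \<rho>_pos[of t] r
    by (auto intro!: derivative_eq_intros add_pos_nonneg simp: \<rho>_def divide_simps)
  have "isCont \<rho> 0"
    using \<rho>' by (rule DERIV_isCont)
  then have ev: "\<forall>\<^sub>F t in nhds 0. \<rho> t < 1"
    using \<rho>0 r(2) order_tendstoD(2)[of \<rho> "\<rho> 0" "at 0" 1] by (simp add: isCont_def eventually_nhds_conv_at)
  have u_eq: "u (of_real r + t *\<^sub>R \<i>) = profile u (\<rho> t)" if "\<rho> t < 1" for t
  proof -
    have "norm (complex_of_real r + t *\<^sub>R \<i>) = \<rho> t"
      by (simp add: \<rho>_def norm_complex_def)
    then show ?thesis
      using that \<rho>_pos[of t] by (intro radialD[OF rad]) auto
  qed
  \<comment> \<open>The formula is proved for all \<open>t\<close> near 0, not just at 0, because it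
    is differentiated once more.\<close>
  have Dy: "dir_deriv \<i> u (of_real r + t *\<^sub>R \<i>) = p1 (\<rho> t) / \<rho> t * t" if t: "\<rho> t < 1" for t
  proof -
    have "((\<lambda>s. profile u (\<rho> s)) has_real_derivative p1 (\<rho> t) * (t / \<rho> t)) (at t)"
      using p[of "\<rho> t"] t \<rho>_pos[of t] by (intro DERIV_chain2[OF _ \<rho>']) auto
    then have D: "((\<lambda>s. profile u (\<rho> (s + t))) has_real_derivative p1 (\<rho> t) * (t / \<rho> t)) (at 0)"
      using DERIV_shift[of "\<lambda>s. profile u (\<rho> s)" "p1 (\<rho> t) * (t / \<rho> t)" 0 t] by simp
    have "isCont (\<lambda>s. \<rho> (s + t)) 0"
      using DERIV_shift[of \<rho> "t / \<rho> t" 0 t] \<rho>'[of t] by (auto intro: DERIV_isCont)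
    then have ev_t: "\<forall>\<^sub>F s in nhds 0. \<rho> (s + t) < 1"
      using t by (auto simp: isCont_def eventually_nhds_conv_at order_tendstoD(2))
    have "((\<lambda>s. u (of_real r + t *\<^sub>R \<i> + s *\<^sub>R \<i>)) has_real_derivative p1 (\<rho> t) * (t / \<rho> t)) (at 0)"
    proof (rule DERIV_cong_ev[THEN iffD1, OF refl _ refl D])
      show "\<forall>\<^sub>F s in nhds 0. profile u (\<rho> (s + t)) = u (of_real r + t *\<^sub>R \<i> + s *\<^sub>R \<i>)"
        using ev_t
      proof eventually_elim
        case (elim s)
        then show ?case
          using u_eq[of "s + t"] by (simp add: scaleR_add_left add_ac)
      qed
    qed
    then show ?thesis
      unfolding dir_deriv_def by (simp add: DERIV_imp_deriv)
  qed
  have "((\<lambda>t. p1 (\<rho> t) / \<rho> t * t) has_real_derivative p1 r / r) (at 0)"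
    using \<rho>_pos[of 0] r \<rho>0
    by (auto intro!: derivative_eq_intros DERIV_chain2[OF p1 \<rho>'] \<rho>')
  then have "((\<lambda>t. dir_deriv \<i> u (of_real r + t *\<^sub>R \<i>)) has_real_derivative p1 r / r) (at 0)"
    by (rule DERIV_cong_ev[THEN iffD1, OF refl _ refl, rotated]) 
       (use ev in eventually_elim, simp add: Dy)
  then have "dir_deriv \<i> (dir_deriv \<i> u) (of_real r) = p1 r / r"
    unfolding dir_deriv_def[of \<i> "dir_deriv \<i> u"] by (simp add: DERIV_imp_deriv)
  then show ?thesis
    by (simp add: laplacian_def Basis_complex_def p1_def)
qed

text \<open>The witnesses hidden in \<open>class_W\<close> are fixed once and for all, so every
  constant obtained below is chosen before \<open>\<mu>\<close> and cannot depend on it.\<close>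

locale large_weight =
  fixes \<omega> \<tau> \<phi> :: "complex \<Rightarrow> real" and c1 c2 A B :: real
  assumes weight: "weight \<omega>"
    and decreasing: "radially_decreasing \<omega>"
    and radial_\<phi>: "radial \<phi>"
    and C2_\<phi>: "C2_on disk \<phi>"
    and \<omega>_eq: "\<And>z. z \<in> disk \<Longrightarrow> \<omega> z = exp (- 2 * \<phi> z)"
    and laplacian_pos: "\<And>z. z \<in> disk \<Longrightarrow> laplacian \<phi> z > 0"
    and A_pos: "A > 0" and B_pos: "B > 0"
    and laplacian_ge: "\<And>z. z \<in> disk \<Longrightarrow> A * \<tau> z \<le> laplacian \<phi> z powr (- 1 / 2)"
    and laplacian_le: "\<And>z. z \<in> disk \<Longrightarrow> laplacian \<phi> z powr (- 1 / 2) \<le> B * \<tau> z"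
    and \<tau>_pos: "\<And>z. z \<in> disk \<Longrightarrow> \<tau> z > 0"
    and \<tau>_decreasing: "radially_decreasing \<tau>"
    and \<tau>_lim: "(profile \<tau> \<longlongrightarrow> 0) (at_left 1)"
    and class_L: "class_L \<tau> c1 c2"
begin

abbreviation "m \<equiv> m_const c1 c2"

lemma \<omega>_pos: "z \<in> disk \<Longrightarrow> \<omega> z > 0"
  using weight by (simp add: weight_def)

lemma \<omega>_mono: "\<lbrakk>z \<in> disk; w \<in> disk; norm z \<le> norm w\<rbrakk> \<Longrightarrow> \<omega> w \<le> \<omega> z"
  using decreasing by (simp add: radially_decreasing_def)

lemma \<tau>_mono: "\<lbrakk>z \<in> disk; w \<in> disk; norm z \<le> norm w\<rbrakk> \<Longrightarrow> \<tau> w \<le> \<tau> z"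
  using \<tau>_decreasing by (simp add: radially_decreasing_def)

lemma radial_\<tau>: "z \<in> disk \<Longrightarrow> \<tau> z = \<tau> (of_real (norm z))"
  using \<tau>_decreasing unfolding radially_decreasing_def by (auto intro: radialD)

lemma radial_\<omega>: "z \<in> disk \<Longrightarrow> \<omega> z = \<omega> (of_real (norm z))"
  using decreasing unfolding radially_decreasing_def by (auto intro: radialD)

lemma \<phi>_radial: "z \<in> disk \<Longrightarrow> \<phi> z = \<phi> (of_real (norm z))"
  using radial_\<phi> by (auto intro: radialD)

lemma \<tau>_le: "z \<in> disk \<Longrightarrow> \<tau> z \<le> c1 * (1 - norm z)"
  using class_L by (simp add: class_L_def)

lemma \<tau>_Lipschitz: "\<lbrakk>z \<in> disk; w \<in> disk\<rbrakk> \<Longrightarrow> \<bar>\<tau> z - \<tau> w\<bar> \<le> c2 * norm (z - w)"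
  using class_L by (simp add: class_L_def)

lemma c1_pos: "c1 > 0"
  using \<tau>_le[of 0] \<tau>_pos[of 0] by simp

text \<open>Otherwise condition (B) makes \<open>\<tau>\<close> constant, against its limit 0 at the
  boundary and its positivity at 0.\<close>

lemma c2_pos: "c2 > 0"
proof (rule ccontr)
  assume c2: "\<not> c2 > 0"
  have const: "\<tau> z = \<tau> 0" if "z \<in> disk" for z
  proof -
    have "c2 * norm (z - 0) \<le> 0" using c2 by (simp add: mult_nonpos_nonneg)
    then show ?thesis using \<tau>_Lipschitz[OF that, of 0] by simp
  qed
  have "\<forall>\<^sub>F r in at_left 1. profile \<tau> r = \<tau> 0"
    using eventually_at_left_real[of 0 1, OF zero_less_one]
    by (rule eventually_mono) (rule const, simp)
  then have "((\<lambda>r::real. \<tau> 0) \<longlongrightarrow> 0) (at_left 1)"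
    by (rule iffD1[OF tendsto_cong \<tau>_lim])
  then have "\<tau> 0 = 0" by (simp add: tendsto_const_iff)
  then show False using \<tau>_pos[of 0] by simp
qed

lemma m_pos: "m > 0"
  using c1_pos c2_pos by (simp add: m_const_def)

lemma m_le: "m \<le> 1 / 4" "m * c1 \<le> 1 / 4" "m * c2 \<le> 1 / 4"
proof -
  have m: "m \<le> 1 / 4 * inverse c1" "m \<le> 1 / 4 * inverse c2" "m \<le> 1 / 4"
    unfolding m_const_def by (auto simp: min_def)
  then show "m \<le> 1 / 4" by blast
  show "m * c1 \<le> 1 / 4" "m * c2 \<le> 1 / 4"
    using mult_right_mono[OF m(1), of c1] mult_right_mono[OF m(2), of c2] c1_pos c2_pos by auto
qed

lemma m\<tau>_le: "z \<in> disk \<Longrightarrow> m * \<tau> z \<le> (1 - norm z) / 4"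
proof -
  assume z: "z \<in> disk"
  have "m * \<tau> z \<le> m * (c1 * (1 - norm z))"
    using m_pos \<tau>_le[OF z] by (intro mult_left_mono) auto
  also have "\<dots> \<le> (1 - norm z) / 4"
    using mult_right_mono[OF m_le(2), of "1 - norm z"] z by (simp add: mult_ac)
  finally show ?thesis .
qed

text \<open>Condition (A) bounds the radius by a quarter of the distance from \<open>a\<close> to
  the circle, and condition (B) bounds the variation of \<open>\<tau>\<close> by a quarter of
  \<open>\<tau> a\<close>. This is what the factor 1/4 in \<open>m_const\<close> provides.\<close>

lemma near:
  assumes a: "a \<in> disk" and z: "norm (z - a) \<le> m * \<tau> a"
  shows "z \<in> disk" "norm z \<le> norm a + (1 - norm a) / 4" "\<bar>\<tau> z - \<tau> a\<bar> \<le> \<tau> a / 4"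
proof -
  have "norm z \<le> norm a + norm (z - a)"
    by (metis add.commute diff_add_cancel norm_triangle_ineq)
  then show 1: "norm z \<le> norm a + (1 - norm a) / 4"
    using m\<tau>_le[OF a] z by linarith
  moreover have "norm a < 1" using a by simp
  ultimately have "norm z < 1" by argo
  then show zd: "z \<in> disk" by simp
  have "\<bar>\<tau> z - \<tau> a\<bar> \<le> c2 * norm (z - a)" by (rule \<tau>_Lipschitz[OF zd a])
  also have "\<dots> \<le> c2 * (m * \<tau> a)" using c2_pos z by simp
  also have "\<dots> \<le> \<tau> a / 4"
    using mult_right_mono[OF m_le(3), of "\<tau> a"] \<tau>_pos[OF a] by (simp add: mult_ac)
  finally show "\<bar>\<tau> z - \<tau> a\<bar> \<le> \<tau> a / 4" .
qed

lemma ball_subset: "\<lbrakk>a \<in> disk; \<rho> \<le> m * \<tau> a\<rbrakk> \<Longrightarrow> ball a \<rho> \<subseteq> disk"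
  using near(1)[of a] by (force simp: dist_norm norm_minus_commute)

lemma continuous_\<omega>: "continuous_on disk \<omega>"
proof -
  have "continuous_on disk \<phi>" using C2_\<phi> by (simp add: C2_on_def C1_on_def)
  then have "continuous_on disk (\<lambda>z. exp (- 2 * \<phi> z))" by (intro continuous_intros)
  then show ?thesis
    using continuous_on_cong[of disk disk \<omega> "\<lambda>z. exp (- 2 * \<phi> z)"] \<omega>_eq by blast
qed

lemma continuous_\<tau>: "continuous_on disk \<tau>"
proof -
  have "c2-lipschitz_on disk \<tau>"
    using c2_pos \<tau>_Lipschitz by (intro lipschitz_onI) (auto simp: dist_norm)
  then show ?thesis by (rule lipschitz_on_continuous_on)
qed

section \<open>Calculus of the radial profile\<close>

definition "p r = \<phi> (complex_of_real r)"
text \<open>The derivative of \<open>p\<close> with respect to \<open>ln r\<close>. Powers of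
  \<open>z\<close> have log-modulus linear in \<open>ln r\<close>, which makes \<open>ln r\<close>
  the right variable for comparing the weight with holomorphic functions.\<close>

definition "q r = r * dir_deriv 1 \<phi> (complex_of_real r)"
definition "q' r = r * laplacian \<phi> (complex_of_real r)"

lemma has_derivative_p: "\<lbrakk>0 < r; r < 1\<rbrakk> \<Longrightarrow> (p has_real_derivative q r / r) (at r)"
  using profile_has_real_derivative[of \<phi> r] C2_\<phi> unfolding p_def[abs_def] q_def by (simp add: C2_on_def)

lemma has_derivative_q:
  assumes "0 < r" "r < 1"
  shows "(q has_real_derivative q' r) (at r)"
proof -
  have "C1_on disk (dir_deriv 1 \<phi>)" using C2_\<phi> by (auto simp: C2_on_def Basis_complex_def)
  then have "((\<lambda>r. dir_deriv 1 \<phi> (complex_of_real r)) has_real_derivative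
      dir_deriv 1 (dir_deriv 1 \<phi>) (of_real r)) (at r)"
    using assms by (intro profile_has_real_derivative) auto
  moreover have "q' r = r * dir_deriv 1 (dir_deriv 1 \<phi>) (of_real r) + dir_deriv 1 \<phi> (of_real r)"
    using assms laplacian_radial[OF C2_\<phi> radial_\<phi> assms] by (simp add: q'_def field_simps)
  ultimately show ?thesis
    unfolding q_def[abs_def] by (auto intro!: derivative_eq_intros)
qed

lemma p_mono:
  assumes "0 \<le> r" "r \<le> s" "s < 1" shows "p r \<le> p s"
proof -
  have "\<omega> (of_real s) \<le> \<omega> (of_real r)" using assms by (intro \<omega>_mono) auto
  then show ?thesis using assms by (simp add: \<omega>_eq p_def)
qed

lemma q_nonneg:
  assumes "0 < r" "r < 1" shows "q r \<ge> 0"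
proof -
  have "q r / r \<ge> 0"
  proof (rule mono_on_imp_deriv_nonneg)
    show "mono_on {0<..<1} p" by (auto intro!: mono_onI p_mono)
    show "(p has_real_derivative q r / r) (at r)" using assms by (rule has_derivative_p)
    show "r \<in> interior {0<..<1}" using assms by (simp add: interior_open)
  qed
  then show ?thesis using assms by (simp add: zero_le_divide_iff)
qed

lemma laplacian_bounds:
  assumes z: "z \<in> disk"
  shows "1 / (B\<^sup>2 * (\<tau> z)\<^sup>2) \<le> laplacian \<phi> z" "laplacian \<phi> z \<le> 1 / (A\<^sup>2 * (\<tau> z)\<^sup>2)"
proof -
  define y where "y = laplacian \<phi> z powr (- 1 / 2)"
  have y: "y > 0" using laplacian_pos[OF z] by (simp add: y_def)
  have "y\<^sup>2 = y powr 2" using y by simp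
  also have "\<dots> = laplacian \<phi> z powr (-1)" unfolding y_def by (simp add: powr_powr)
  finally have lap: "laplacian \<phi> z = 1 / y\<^sup>2"
    using laplacian_pos[OF z] by (simp add: powr_minus divide_inverse)
  have pos: "0 < A * \<tau> z"
    using A_pos \<tau>_pos[OF z] by simp
  have Ay: "A * \<tau> z \<le> y" and yB: "y \<le> B * \<tau> z"
    using laplacian_ge[OF z] laplacian_le[OF z] unfolding y_def .
  show "1 / (B\<^sup>2 * (\<tau> z)\<^sup>2) \<le> laplacian \<phi> z"
    unfolding lap power_mult_distrib[symmetric] using y yB by (intro frac_le power_mono) auto
  show "laplacian \<phi> z \<le> 1 / (A\<^sup>2 * (\<tau> z)\<^sup>2)"
    unfolding lap power_mult_distrib[symmetric]
    by (rule frac_le) (use pos Ay in \<open>auto intro: power_mono zero_less_power\<close>)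
qed

lemma q'_bounds:
  assumes "0 < r" "r < 1"
  shows "r / (B\<^sup>2 * (profile \<tau> r)\<^sup>2) \<le> q' r" "q' r \<le> 1 / (A\<^sup>2 * (profile \<tau> r)\<^sup>2)"
proof -
  have d: "complex_of_real r \<in> disk" using assms by simp
  show "r / (B\<^sup>2 * (profile \<tau> r)\<^sup>2) \<le> q' r"
    using mult_left_mono[OF laplacian_bounds(1)[OF d], of r] assms by (simp add: q'_def)
  have "q' r \<le> 1 * laplacian \<phi> (of_real r)"
    unfolding q'_def using assms laplacian_pos[OF d] by (intro mult_right_mono) auto
  then show "q' r \<le> 1 / (A\<^sup>2 * (profile \<tau> r)\<^sup>2)"
    using laplacian_bounds(2)[OF d] by simp
qed

text \<open>The lower bound 1/4 keeps \<open>1 / s\<close> at most 4 when slopes in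
  \<open>ln s\<close> are converted to slopes in \<open>s\<close>.\<close>

lemma near_real:
  assumes "1 / 2 \<le> r" "r < 1" "\<bar>s - r\<bar> \<le> m * profile \<tau> r"
  shows "1 / 4 \<le> s" "s < 1" "3 / 4 * profile \<tau> r \<le> profile \<tau> s" "profile \<tau> s \<le> 5 / 4 * profile \<tau> r"
proof -
  have d: "complex_of_real r \<in> disk" using assms by simp
  have n: "norm (complex_of_real s - of_real r) \<le> m * \<tau> (of_real r)"
    using assms by (metis norm_of_real of_real_diff)
  show "1 / 4 \<le> s" "s < 1"
    using m\<tau>_le[OF d] assms by (auto simp: abs_le_iff)
  show "3 / 4 * profile \<tau> r \<le> profile \<tau> s" "profile \<tau> s \<le> 5 / 4 * profile \<tau> r"
    using near(3)[OF d n] unfolding abs_le_iff by linarith+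
qed

text \<open>Second-order Taylor expansion of \<open>\<phi>\<close> in the variable \<open>ln r\<close>.\<close>

lemma p_expansion:
  assumes r: "1 / 2 \<le> r" "r < 1" and s: "\<bar>s - r\<bar> \<le> m * profile \<tau> r"
  shows "\<bar>p s - p r - q r * ln (s / r)\<bar> \<le> 1 / A\<^sup>2"
proof -
  define t0 where "t0 = profile \<tau> r"
  have t0: "t0 > 0" using r by (simp add: t0_def \<tau>_pos)
  define S where "S = {r - m * t0..r + m * t0}"
  have S: "1 / 4 \<le> x" "x < 1" "3 / 4 * t0 \<le> profile \<tau> x" if "x \<in> S" for x
    using near_real[OF r, of x] that by (auto simp: S_def t0_def)
  have rS: "r \<in> S" "s \<in> S" using s m_pos t0 by (auto simp: S_def abs_le_iff t0_def)
  \<comment> \<open>On \<open>S\<close> one has \<open>\<tau> \<ge> 3/4 * t0\<close>, and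
    \<open>(4/3)^2 = 16/9\<close> is rounded up to 2.\<close>
  define K where "K = 2 / (A\<^sup>2 * t0\<^sup>2)"
  have q'K: "\<bar>q' x\<bar> \<le> K" if "x \<in> S" for x
  proof -
    have "0 \<le> q' x"
      using S[OF that] laplacian_pos[of "of_real x"] by (simp add: q'_def)
    moreover have "q' x \<le> 1 / (A\<^sup>2 * (profile \<tau> x)\<^sup>2)"
      using S[OF that] by (intro q'_bounds) auto
    moreover have "1 / (A\<^sup>2 * (profile \<tau> x)\<^sup>2) \<le> 1 / (A\<^sup>2 * (3 / 4 * t0)\<^sup>2)"
    proof (rule frac_le)
      show "0 < A\<^sup>2 * (3 / 4 * t0)\<^sup>2" using t0 A_pos by simp
      have "(3 / 4 * t0)\<^sup>2 \<le> (profile \<tau> x)\<^sup>2"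
        by (rule power_mono) (use S[OF that] t0 in auto)
      then show "A\<^sup>2 * (3 / 4 * t0)\<^sup>2 \<le> A\<^sup>2 * (profile \<tau> x)\<^sup>2"
        by (rule mult_left_mono) simp
    qed auto
    moreover have "1 / (A\<^sup>2 * (3 / 4 * t0)\<^sup>2) \<le> K"
      using t0 A_pos by (simp add: K_def power2_eq_square field_simps)
    ultimately show ?thesis by linarith
  qed
  have qK: "\<bar>q x - q r\<bar> \<le> K * (m * t0)" if "x \<in> S" for x
  proof -
    have "\<bar>q x - q r\<bar> \<le> K * \<bar>x - r\<bar>"
      unfolding S_def
    proof (rule real_mean_value_bound[of "r - m * t0" "r + m * t0" q q'])
      fix y assume "y \<in> {r - m * t0..r + m * t0}"
      then have y: "y \<in> S" by (simp add: S_def)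
      show "(q has_real_derivative q' y) (at y)"
        using S(1)[OF y] S(2)[OF y] by (intro has_derivative_q) auto
      show "\<bar>q' y\<bar> \<le> K" by (rule q'K[OF y])
    qed (use that rS in \<open>simp_all add: S_def\<close>)
    also have "\<dots> \<le> K * (m * t0)"
      using that A_pos by (intro mult_left_mono) (auto simp: S_def K_def)
    finally show ?thesis .
  qed
  \<comment> \<open>The Taylor remainder. It vanishes at \<open>r\<close> and its derivative is
    \<open>(q x - q r) / x\<close>, where \<open>1 / x\<close> is at most 4 on
    \<open>S\<close>.\<close>
  define F where "F x = p x - p r - q r * (ln x - ln r)" for x
  have "\<bar>F s - F r\<bar> \<le> 4 * (K * (m * t0)) * \<bar>s - r\<bar>"
  proof (rule real_mean_value_bound[of "r - m * t0" "r + m * t0" F "\<lambda>x. (q x - q r) / x"])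
    fix x assume "x \<in> {r - m * t0..r + m * t0}"
    then have x: "x \<in> S" by (simp add: S_def)
    then have x0: "0 < x" "x < 1" "1 / 4 \<le> x" using S[OF x] by auto
    show "(F has_real_derivative (q x - q r) / x) (at x)"
    proof -
      have "(F has_real_derivative q x / x - 0 - q r * (1 / x - 0)) (at x)"
        unfolding F_def
        by (intro DERIV_diff DERIV_cmult DERIV_const has_derivative_p DERIV_ln_divide x0)
      then show ?thesis by (simp add: diff_divide_distrib)
    qed
    have "\<bar>(q x - q r) / x\<bar> = \<bar>q x - q r\<bar> / x" using x0 by simp
    also have "\<dots> \<le> (K * (m * t0)) / (1 / 4)"
      by (rule frac_le) (use x0 qK[OF x] in auto)
    finally show "\<bar>(q x - q r) / x\<bar> \<le> 4 * (K * (m * t0))" by simp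
  qed (use rS in \<open>simp_all add: S_def\<close>)
  also have "\<dots> \<le> 4 * (K * (m * t0)) * (m * t0)"
    using s A_pos m_pos t0 by (intro mult_left_mono) (auto simp: t0_def K_def)
  \<comment> \<open>Here \<open>t0\<close> cancels: two integrations over a length
    \<open>m * t0\<close> compensate the second derivative of order \<open>1 / t0^2\<close>, so the
    bound is uniform up to the boundary.\<close>
  also have "\<dots> = 8 * m\<^sup>2 / A\<^sup>2"
    using t0 by (simp add: K_def power2_eq_square)
  also have "\<dots> \<le> 8 * (1 / 4)\<^sup>2 / A\<^sup>2"
    using m_le(1) m_pos by (intro divide_right_mono mult_left_mono power_mono) auto
  also have "\<dots> \<le> 1 / A\<^sup>2" by (intro divide_right_mono) (auto simp: power2_eq_square)
  finally show ?thesis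
    using S(1)[OF rS(2)] r by (simp add: F_def ln_div)
qed

end

section \<open>Local comparison with holomorphic functions\<close>

text \<open>The inequality for nonnegative integrals, applied to \<open>|f| * sqrt w\<close> and
  \<open>|g| * sqrt w\<close>, also yields integrability. The measure is arbitrary because both the
  inner product over \<open>dA\<close> and the form over \<open>\<mu>\<close> need it.\<close>

lemma Cauchy_Schwarz_weighted:
  fixes f g :: "'a \<Rightarrow> complex" and w :: "'a \<Rightarrow> real"
  assumes [measurable]: "f \<in> borel_measurable M" "g \<in> borel_measurable M" "w \<in> borel_measurable M"
    and w: "\<And>x. x \<in> space M \<Longrightarrow> w x \<ge> 0"
    and u: "integrable M (\<lambda>x. (norm (f x))\<^sup>2 * w x)" and v: "integrable M (\<lambda>x. (norm (g x))\<^sup>2 * w x)"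
  shows "integrable M (\<lambda>x. f x * cnj (g x) * complex_of_real (w x))"
    and "norm (LINT x|M. f x * cnj (g x) * complex_of_real (w x))
      \<le> sqrt (LINT x|M. (norm (f x))\<^sup>2 * w x) * sqrt (LINT x|M. (norm (g x))\<^sup>2 * w x)"
proof -
  define U where "U = (LINT x|M. (norm (f x))\<^sup>2 * w x)"
  define V where "V = (LINT x|M. (norm (g x))\<^sup>2 * w x)"
  have [measurable]: "(\<lambda>x. cnj (g x)) \<in> borel_measurable M"
    "(\<lambda>x. complex_of_real (w x)) \<in> borel_measurable M"
    by (rule measurable_compose[OF assms(2)] measurable_compose[OF assms(3)],
        intro borel_measurable_continuous_onI continuous_intros)+
  define N where "N = (\<integral>\<^sup>+x. ennreal (norm (f x * cnj (g x) * complex_of_real (w x))) \<partial>M)"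
  have UV: "U \<ge> 0" "V \<ge> 0"
    unfolding U_def V_def by (auto intro!: integral_nonneg_AE AE_I2 simp: w)
  have sq: "(\<integral>\<^sup>+x. (ennreal (norm (h x) * sqrt (w x)))\<^sup>2 \<partial>M) = ennreal (LINT x|M. (norm (h x))\<^sup>2 * w x)"
    if "integrable M (\<lambda>x. (norm (h x))\<^sup>2 * w x)" for h :: "'a \<Rightarrow> complex"
  proof -
    have "(\<integral>\<^sup>+x. (ennreal (norm (h x) * sqrt (w x)))\<^sup>2 \<partial>M) = (\<integral>\<^sup>+x. ennreal ((norm (h x))\<^sup>2 * w x) \<partial>M)"
      by (rule nn_integral_cong) (auto simp: w ennreal_power power_mult_distrib)
    also have "\<dots> = ennreal (LINT x|M. (norm (h x))\<^sup>2 * w x)"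
      by (rule nn_integral_eq_integral[OF that]) (auto simp: w)
    finally show ?thesis .
  qed
  have "N = (\<integral>\<^sup>+x. ennreal (norm (f x) * sqrt (w x)) * ennreal (norm (g x) * sqrt (w x)) \<partial>M)"
    unfolding N_def
  proof (rule nn_integral_cong)
    fix x assume x: "x \<in> space M"
    then have "w x = sqrt (w x) * sqrt (w x)" using w by simp
    then have "norm (f x * cnj (g x) * complex_of_real (w x)) = (norm (f x) * sqrt (w x)) * (norm (g x) * sqrt (w x))"
      using w[OF x] by (simp add: norm_mult)
    then show "ennreal (norm (f x * cnj (g x) * complex_of_real (w x)))
        = ennreal (norm (f x) * sqrt (w x)) * ennreal (norm (g x) * sqrt (w x))"
      using w[OF x] by (simp add: ennreal_mult)
  qed
  also have "\<dots>\<^sup>2 \<le> ennreal U * ennreal V"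
    unfolding U_def V_def sq[OF u, symmetric] sq[OF v, symmetric]
    by (rule Cauchy_Schwarz_nn_integral) measurable
  finally have N: "N\<^sup>2 \<le> ennreal (U * V)" using UV by (simp add: ennreal_mult)
  have "N < \<infinity>"
  proof (rule ccontr)
    assume "\<not> N < \<infinity>"
    then have "N = top" by (simp add: less_top[symmetric])
    with N show False by (simp add: power2_eq_square top_unique)
  qed
  then show int: "integrable M (\<lambda>x. f x * cnj (g x) * complex_of_real (w x))"
    unfolding N_def by (intro integrableI_bounded) measurable
  have "ennreal (norm (LINT x|M. f x * cnj (g x) * complex_of_real (w x))) \<le> N"
    unfolding N_def by (rule integral_norm_bound_ennreal[OF int])
  then have "(ennreal (norm (LINT x|M. f x * cnj (g x) * complex_of_real (w x))))\<^sup>2 \<le> N\<^sup>2"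
    by (rule power_mono) simp
  also note N
  finally have "(norm (LINT x|M. f x * cnj (g x) * complex_of_real (w x)))\<^sup>2 \<le> U * V"
    using UV by (simp add: ennreal_power)
  then have "norm (LINT x|M. f x * cnj (g x) * complex_of_real (w x)) \<le> sqrt (U * V)"
    by (rule real_le_rsqrt)
  then show "norm (LINT x|M. f x * cnj (g x) * complex_of_real (w x))
      \<le> sqrt (LINT x|M. (norm (f x))\<^sup>2 * w x) * sqrt (LINT x|M. (norm (g x))\<^sup>2 * w x)"
    by (simp add: U_def V_def real_sqrt_mult)
qed

context large_weight begin

text \<open>On the disk of radius \<open>m \<tau>(a)\<close> around \<open>a\<close> the weight is comparable to the squared modulus
  of a holomorphic function, namely of a power of \<open>z / a\<close>, by the expansion of \<open>\<phi>\<close> in \<open>ln |z|\<close>.\<close>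

lemma local_frame:
  "\<exists>C\<ge>1. \<forall>a\<in>disk. \<exists>E. E holomorphic_on ball a (m * \<tau> a) \<and> E a = 1 \<and>
     (\<forall>z\<in>ball a (m * \<tau> a). \<omega> z \<le> C * ((norm (E z))\<^sup>2 * \<omega> a) \<and> (norm (E z))\<^sup>2 * \<omega> a \<le> C * \<omega> z)"
proof -
  \<comment> \<open>For \<open>|a| < 1/2\<close> the disk around \<open>a\<close> lies in
    \<open>|z| \<le> 5/8\<close>, hence inside radius 3/4, where the weight stays between
    \<open>\<omega> R\<close> and \<open>\<omega> 0\<close>.\<close>
  define R :: complex where "R = of_real (3 / 4)"
  have R: "R \<in> disk" "norm R = 3 / 4" by (auto simp: R_def)
  define C where "C = max (exp (2 / A\<^sup>2)) (\<omega> 0 / \<omega> R)"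
  have C1: "C \<ge> exp (2 / A\<^sup>2)" by (simp add: C_def)
  have C2: "\<omega> 0 \<le> C * \<omega> R"
  proof -
    have "\<omega> 0 = \<omega> 0 / \<omega> R * \<omega> R" using \<omega>_pos[OF R(1)] by simp
    also have "\<dots> \<le> C * \<omega> R" using \<omega>_pos[OF R(1)] by (intro mult_right_mono) (auto simp: C_def)
    finally show ?thesis .
  qed
  have C3: "C \<ge> 1" using C1 one_le_exp_iff[of "2 / A\<^sup>2"] by (meson divide_nonneg_nonneg order_trans zero_le_numeral zero_le_power2)
  show ?thesis
  proof (intro exI[of _ C] conjI ballI C3)
    fix a assume a: "a \<in> disk"
    have nr: "z \<in> disk" "norm z \<le> norm a + (1 - norm a) / 4" "norm (z - a) < m * \<tau> a"
      if "z \<in> ball a (m * \<tau> a)" for z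
      using near(1,2)[OF a, of z] that by (auto simp: dist_norm norm_minus_commute)
    show "\<exists>E. E holomorphic_on ball a (m * \<tau> a) \<and> E a = 1 \<and>
      (\<forall>z\<in>ball a (m * \<tau> a). \<omega> z \<le> C * ((norm (E z))\<^sup>2 * \<omega> a) \<and> (norm (E z))\<^sup>2 * \<omega> a \<le> C * \<omega> z)"
    \<comment> \<open>A power of \<open>z / a\<close> is useless if the disk may contain the origin;
      there the weight is comparable to a constant and \<open>E = 1\<close> serves.\<close>
    proof (cases "norm a < 1 / 2")
      case True
      have cmp: "\<omega> z \<le> C * \<omega> w" if "z \<in> disk" "norm w \<le> 3 / 4" for z w
      proof -
        have "\<omega> z \<le> \<omega> 0" using that by (intro \<omega>_mono) auto
        also note C2
        also have "C * \<omega> R \<le> C * \<omega> w" using that C3 R by (intro mult_left_mono \<omega>_mono) auto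
        finally show ?thesis .
      qed
      have "norm z \<le> 3 / 4" if "z \<in> ball a (m * \<tau> a)" for z
        using nr(2)[OF that] True by argo
      then show ?thesis
        using True a by (intro exI[of _ "\<lambda>_. 1"]) (auto intro!: cmp simp: nr(1)[unfolded mem_ball_0])
    next
      case False
      define r where "r = norm a"
      have r: "1 / 2 \<le> r" "r < 1" using False a by (auto simp: r_def)
      have a0: "a \<noteq> 0" using r by (auto simp: r_def)
      \<comment> \<open>The power \<open>(z / a) ^ (- q r)\<close> with a real exponent, so that
        \<open>|E|^2 * \<omega> a\<close> is \<open>exp (-2 * ...)\<close> of the first-order
        expansion of \<open>p\<close> in \<open>ln s\<close>. The principal logarithm applies
        because \<open>z / a\<close> is within distance 1 of 1.\<close>
      define E where "E z = exp (- of_real (q r) * Ln (z / a))" for z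
      have za: "Re (z / a) > 0" if "z \<in> ball a (m * \<tau> a)" for z
      proof -
        have "norm (z - a) < (1 - norm a) / 4" using nr(3)[OF that] m\<tau>_le[OF a] by linarith
        also have "\<dots> \<le> norm a" using r by (simp add: r_def)
        finally have "norm (z / a - 1) < 1"
          using a0 by (simp add: norm_divide divide_simps flip: diff_divide_distrib)
        then show ?thesis using abs_Re_le_cmod[of "z / a - 1"] by simp
      qed
      have "E holomorphic_on ball a (m * \<tau> a)"
        unfolding E_def using za a0 by (intro holomorphic_intros) (auto simp: complex_nonpos_Reals_iff, fastforce)
      moreover have "E a = 1" using a0 by (simp add: E_def)
      moreover have "\<omega> z \<le> C * ((norm (E z))\<^sup>2 * \<omega> a) \<and> (norm (E z))\<^sup>2 * \<omega> a \<le> C * \<omega> z"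
        if z: "z \<in> ball a (m * \<tau> a)" for z
      proof -
        define s where "s = norm z"
        have z0: "z \<noteq> 0" using za[OF z] by auto
        have "\<bar>s - r\<bar> \<le> norm (z - a)" unfolding s_def r_def by (rule norm_triangle_ineq3)
        also have "\<dots> \<le> m * profile \<tau> r" using nr(3)[OF z] radial_\<tau>[OF a] by (simp add: r_def)
        finally have ex: "\<bar>p s - p r - q r * ln (s / r)\<bar> \<le> 1 / A\<^sup>2" by (rule p_expansion[OF r])
        have "norm (E z) = exp (- q r * ln (s / r))"
          using z0 a0 by (simp add: E_def s_def r_def norm_divide)
        then have "(norm (E z))\<^sup>2 = exp (- 2 * q r * ln (s / r))"
          by (simp add: power2_eq_square flip: exp_add)
        moreover have "\<omega> a = exp (- 2 * p r)" "\<omega> z = exp (- 2 * p s)"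
          using \<omega>_eq[OF a] \<omega>_eq[OF nr(1)[OF z]] \<phi>_radial[OF a] \<phi>_radial[OF nr(1)[OF z]]
          by (auto simp: p_def s_def r_def)
        moreover have "exp (- 2 * p s) \<le> exp (2 / A\<^sup>2) * (exp (- 2 * q r * ln (s / r)) * exp (- 2 * p r))"
          "exp (- 2 * q r * ln (s / r)) * exp (- 2 * p r) \<le> exp (2 / A\<^sup>2) * exp (- 2 * p s)"
          unfolding exp_add[symmetric] exp_le_cancel_iff using ex[unfolded abs_le_iff] by (auto simp: algebra_simps)
        moreover have "exp (2 / A\<^sup>2) * X \<le> C * X" if "X > 0" for X
          using that C1 by simp
        ultimately show ?thesis
          by (metis (no_types, lifting) exp_gt_zero mult_pos_pos order_trans)
      qed
      ultimately show ?thesis by blast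
    qed
  qed
qed

text \<open>The unweighted inequality is applied to \<open>f * E\<close> with the local frame
  \<open>E\<close>: on the disk \<open>|E|^2 * \<omega> a \<le> C * \<omega>\<close>, while
  \<open>E a = 1\<close> leaves the value at the centre unchanged. The factor 4 is that of
  \<open>norm_squared_le_mean\<close>.\<close>

lemma sub_mean_value:
  "\<exists>C>0. \<forall>a\<in>disk. \<forall>\<rho>. \<forall>f. 0 < \<rho> \<and> \<rho> \<le> m * \<tau> a \<and> f holomorphic_on disk \<longrightarrow>
     ennreal ((norm (f a))\<^sup>2 * \<omega> a * \<rho>\<^sup>2)
       \<le> ennreal C * (\<integral>\<^sup>+z. ennreal ((norm (f z))\<^sup>2 * \<omega> z) * indicator (ball a \<rho>) z \<partial>dA)"
proof -
  obtain C where C: "C \<ge> 1" and frame: "\<And>a. a \<in> disk \<Longrightarrow> \<exists>E. E holomorphic_on ball a (m * \<tau> a) \<and> E a = 1 \<and>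
     (\<forall>z\<in>ball a (m * \<tau> a). \<omega> z \<le> C * ((norm (E z))\<^sup>2 * \<omega> a) \<and> (norm (E z))\<^sup>2 * \<omega> a \<le> C * \<omega> z)"
    using local_frame by blast
  show ?thesis
  proof (intro exI[of _ "4 * C"] conjI ballI allI impI)
    show "4 * C > 0" using C by simp
    fix a f and \<rho> :: real assume a: "a \<in> disk" and asm: "0 < \<rho> \<and> \<rho> \<le> m * \<tau> a \<and> f holomorphic_on disk"
    then have \<rho>: "0 < \<rho>" "\<rho> \<le> m * \<tau> a" and f: "f holomorphic_on disk" by auto
    obtain E where E: "E holomorphic_on ball a (m * \<tau> a)" "E a = 1"
      "\<And>z. z \<in> ball a (m * \<tau> a) \<Longrightarrow> (norm (E z))\<^sup>2 * \<omega> a \<le> C * \<omega> z"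
      using frame[OF a] by blast
    have sub: "ball a \<rho> \<subseteq> disk" "ball a \<rho> \<subseteq> ball a (m * \<tau> a)"
      using ball_subset[OF a \<rho>(2)] \<rho>(2) by auto
    have contf: "continuous_on disk f" by (rule holomorphic_on_imp_continuous_on[OF f])
    have [measurable]: "(\<lambda>z. ennreal ((norm (f z))\<^sup>2 * \<omega> z) * indicator (ball a \<rho>) z) \<in> borel_measurable dA"
    proof -
      have "(\<lambda>z. (norm (f z))\<^sup>2 * \<omega> z) \<in> borel_measurable dA"
        by (intro continuous_on_borel_measurable_dA continuous_intros contf continuous_\<omega>)
      moreover have "ball a \<rho> \<in> sets dA" using sub by (simp add: sets_dA_iff)
      ultimately show ?thesis by measurable
    qed
    have wa: "\<omega> a > 0" by (rule \<omega>_pos[OF a])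
    have "ennreal ((norm (f a))\<^sup>2 * \<omega> a * \<rho>\<^sup>2) = ennreal (4 * \<omega> a) * ennreal ((norm (f a * E a))\<^sup>2 * \<rho>\<^sup>2 / 4)"
      using wa by (simp add: E ennreal_mult'[symmetric] mult_ac)
    also have "\<dots> \<le> ennreal (4 * \<omega> a) * (\<integral>\<^sup>+z. ennreal ((norm (f z * E z))\<^sup>2) * indicator (ball a \<rho>) z \<partial>dA)"
      using f E sub \<rho>
      by (intro mult_left_mono norm_squared_le_mean holomorphic_on_mult) (auto intro: holomorphic_on_subset)
    also have "\<dots> = (\<integral>\<^sup>+z. ennreal (4 * \<omega> a) * (ennreal ((norm (f z * E z))\<^sup>2) * indicator (ball a \<rho>) z) \<partial>dA)"
    proof (rule nn_integral_cmult[symmetric])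
      have cont: "continuous_on (ball a \<rho>) (\<lambda>z. (norm (f z * E z))\<^sup>2)"
        using f E sub by (intro continuous_intros holomorphic_on_imp_continuous_on) (auto intro: holomorphic_on_subset)
      have "(\<lambda>z. indicator (ball a \<rho>) z *\<^sub>R (norm (f z * E z))\<^sup>2) \<in> borel_measurable borel"
        by (rule borel_measurable_continuous_on_indicator[OF _ cont]) simp
      then have "(\<lambda>z. ennreal (indicator (ball a \<rho>) z *\<^sub>R (norm (f z * E z))\<^sup>2)) \<in> borel_measurable dA"
        by (simp add: borel_measurable_dA measurable_restrict_space1)
      also have "(\<lambda>z. ennreal (indicator (ball a \<rho>) z *\<^sub>R (norm (f z * E z))\<^sup>2))
          = (\<lambda>z. ennreal ((norm (f z * E z))\<^sup>2) * indicator (ball a \<rho>) z)"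
        by (auto simp: indicator_def fun_eq_iff)
      finally show "(\<lambda>z. ennreal ((norm (f z * E z))\<^sup>2) * indicator (ball a \<rho>) z) \<in> borel_measurable dA" .
    qed
    also have "\<dots> \<le> (\<integral>\<^sup>+z. ennreal (4 * C) * (ennreal ((norm (f z))\<^sup>2 * \<omega> z) * indicator (ball a \<rho>) z) \<partial>dA)"
    proof (rule nn_integral_mono)
      fix z
      have "4 * \<omega> a * (norm (f z * E z))\<^sup>2 \<le> 4 * C * ((norm (f z))\<^sup>2 * \<omega> z)" if "z \<in> ball a \<rho>"
      proof -
        have "z \<in> ball a (m * \<tau> a)" using that sub by auto
        from mult_left_mono[OF E(3)[OF this], of "4 * (norm (f z))\<^sup>2"] show ?thesis
          by (simp add: norm_mult power_mult_distrib mult_ac)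
      qed
      then show "ennreal (4 * \<omega> a) * (ennreal ((norm (f z * E z))\<^sup>2) * indicator (ball a \<rho>) z)
          \<le> ennreal (4 * C) * (ennreal ((norm (f z))\<^sup>2 * \<omega> z) * indicator (ball a \<rho>) z)"
        using wa C by (auto simp: indicator_def ennreal_mult'[symmetric] intro!: ennreal_leI)
    qed
    also have "\<dots> = ennreal (4 * C) * (\<integral>\<^sup>+z. ennreal ((norm (f z))\<^sup>2 * \<omega> z) * indicator (ball a \<rho>) z \<partial>dA)"
      by (rule nn_integral_cmult) measurable
    finally show "ennreal ((norm (f a))\<^sup>2 * \<omega> a * \<rho>\<^sup>2)
      \<le> ennreal (4 * C) * (\<integral>\<^sup>+z. ennreal ((norm (f z))\<^sup>2 * \<omega> z) * indicator (ball a \<rho>) z \<partial>dA)" .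
  qed
qed

section \<open>The Hilbert space and its kernel\<close>

lemma A2_holomorphic: "f \<in> A2 \<omega> \<Longrightarrow> f holomorphic_on disk"
  by (simp add: A2_def)

lemma A2_continuous: "f \<in> A2 \<omega> \<Longrightarrow> continuous_on disk f"
  by (simp add: A2_def holomorphic_on_imp_continuous_on)

lemma A2_integrable: "f \<in> A2 \<omega> \<Longrightarrow> integrable dA (\<lambda>z. (norm (f z))\<^sup>2 * \<omega> z)"
  by (simp add: A2_def)

lemma \<omega>_nonneg: "z \<in> disk \<Longrightarrow> \<omega> z \<ge> 0"
  using \<omega>_pos[of z] by simp

lemma \<omega>_measurable[measurable]: "\<omega> \<in> borel_measurable dA"
  by (rule continuous_on_borel_measurable_dA[OF continuous_\<omega>])

lemma A2_measurable: "f \<in> A2 \<omega> \<Longrightarrow> f \<in> borel_measurable dA"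
  by (rule continuous_on_borel_measurable_dA[OF A2_continuous])

lemma norm_squared_measurable:
  "continuous_on disk f \<Longrightarrow> (\<lambda>z. (norm (f z))\<^sup>2 * \<omega> z) \<in> borel_measurable dA"
  by (intro continuous_on_borel_measurable_dA continuous_intros continuous_\<omega>)

lemma A2_norm_nonneg [simp]: "A2_norm \<omega> f \<ge> 0"
  unfolding A2_norm_def
  by (rule real_sqrt_ge_zero) (auto intro!: integral_nonneg_AE AE_I2 simp: \<omega>_nonneg)

lemma A2_norm_squared: "(A2_norm \<omega> f)\<^sup>2 = (LINT z|dA. (norm (f z))\<^sup>2 * \<omega> z)"
  unfolding A2_norm_def
  by (rule real_sqrt_pow2) (auto intro!: integral_nonneg_AE AE_I2 simp: \<omega>_nonneg)

lemma nn_integral_A2: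
  assumes "f \<in> A2 \<omega>"
  shows "(\<integral>\<^sup>+z. ennreal ((norm (f z))\<^sup>2 * \<omega> z) \<partial>dA) = ennreal ((A2_norm \<omega> f)\<^sup>2)"
  unfolding A2_norm_squared
  by (rule nn_integral_eq_integral[OF A2_integrable[OF assms]]) (auto simp: \<omega>_nonneg)

lemma A2I:
  assumes f: "f holomorphic_on disk" and b: "b \<ge> 0"
    and le: "(\<integral>\<^sup>+z. ennreal ((norm (f z))\<^sup>2 * \<omega> z) \<partial>dA) \<le> ennreal (b\<^sup>2)"
  shows "f \<in> A2 \<omega>" "A2_norm \<omega> f \<le> b"
proof -
  have m: "(\<lambda>z. (norm (f z))\<^sup>2 * \<omega> z) \<in> borel_measurable dA"
    by (rule norm_squared_measurable[OF holomorphic_on_imp_continuous_on[OF f]])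
  have "integrable dA (\<lambda>z. (norm (f z))\<^sup>2 * \<omega> z)"
    by (rule integrableI_nonneg[OF m])
      (auto intro!: AE_I2 simp: \<omega>_nonneg intro: le_less_trans[OF le])
  with f show A: "f \<in> A2 \<omega>" by (simp add: A2_def)
  have "(A2_norm \<omega> f)\<^sup>2 \<le> b\<^sup>2" using le unfolding nn_integral_A2[OF A] by simp
  then show "A2_norm \<omega> f \<le> b" using b by (rule power2_le_imp_le)
qed

text \<open>Needed because a Toeplitz image is identified with a Riesz representative on the disk
  only.\<close>

lemma A2_cong: "f \<in> A2 \<omega> \<Longrightarrow> (\<And>z. z \<in> disk \<Longrightarrow> f z = g z) \<Longrightarrow> g \<in> A2 \<omega>"
  unfolding A2_def by (auto cong: holomorphic_cong Bochner_Integration.integrable_cong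
    elim!: holomorphic_transform Bochner_Integration.integrable_cong[THEN iffD1, rotated -1])

lemma A2_inner_integrable:
  assumes "f \<in> A2 \<omega>" "g \<in> A2 \<omega>"
  shows "integrable dA (\<lambda>z. f z * cnj (g z) * complex_of_real (\<omega> z))"
  using assms by (intro Cauchy_Schwarz_weighted) (auto simp: A2_measurable A2_integrable \<omega>_nonneg)

lemma A2_Cauchy_Schwarz:
  assumes "f \<in> A2 \<omega>" "g \<in> A2 \<omega>"
  shows "norm (A2_inner \<omega> f g) \<le> A2_norm \<omega> f * A2_norm \<omega> g"
  unfolding A2_inner_def A2_norm_def
  using assms by (intro Cauchy_Schwarz_weighted) (auto simp: A2_measurable A2_integrable \<omega>_nonneg)

lemma A2_add:
  assumes f: "f \<in> A2 \<omega>" and g: "g \<in> A2 \<omega>"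
  shows "(\<lambda>z. f z + g z) \<in> A2 \<omega>"
proof -
  have "integrable dA (\<lambda>z. (norm (f z + g z))\<^sup>2 * \<omega> z)"
  proof (rule Bochner_Integration.integrable_bound)
    show "integrable dA (\<lambda>z. 2 * ((norm (f z))\<^sup>2 * \<omega> z) + 2 * ((norm (g z))\<^sup>2 * \<omega> z))"
      using A2_integrable[OF f] A2_integrable[OF g] by simp
    show "(\<lambda>z. (norm (f z + g z))\<^sup>2 * \<omega> z) \<in> borel_measurable dA"
      by (intro norm_squared_measurable continuous_intros A2_continuous f g)
    show "AE z in dA. norm ((norm (f z + g z))\<^sup>2 * \<omega> z)
        \<le> norm (2 * ((norm (f z))\<^sup>2 * \<omega> z) + 2 * ((norm (g z))\<^sup>2 * \<omega> z))"
    proof (rule AE_I2)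
      fix z assume "z \<in> space dA"
      then have w: "\<omega> z \<ge> 0" by (simp add: \<omega>_nonneg)
      have "(norm (f z + g z))\<^sup>2 \<le> (norm (f z) + norm (g z))\<^sup>2"
        by (intro power_mono norm_triangle_ineq) simp
      also have "\<dots> \<le> 2 * (norm (f z))\<^sup>2 + 2 * (norm (g z))\<^sup>2"
        using zero_le_power2[of "norm (f z) - norm (g z)"] by (simp add: power2_eq_square algebra_simps)
      finally have "(norm (f z + g z))\<^sup>2 * \<omega> z \<le> (2 * (norm (f z))\<^sup>2 + 2 * (norm (g z))\<^sup>2) * \<omega> z"
        by (rule mult_right_mono[OF _ w])
      then show "norm ((norm (f z + g z))\<^sup>2 * \<omega> z)
        \<le> norm (2 * ((norm (f z))\<^sup>2 * \<omega> z) + 2 * ((norm (g z))\<^sup>2 * \<omega> z))"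
        using w by (simp add: algebra_simps abs_of_nonneg)
    qed
  qed
  then show ?thesis
    using f g by (simp add: A2_def holomorphic_on_add)
qed

lemma A2_scale:
  assumes f: "f \<in> A2 \<omega>"
  shows "(\<lambda>z. c * f z) \<in> A2 \<omega>"
proof -
  have "integrable dA (\<lambda>z. (norm c)\<^sup>2 * ((norm (f z))\<^sup>2 * \<omega> z))"
    using A2_integrable[OF f] by simp
  then show ?thesis
    using f by (simp add: A2_def norm_mult power_mult_distrib mult.assoc holomorphic_on_mult)
qed

lemma A2_norm_scale: "A2_norm \<omega> (\<lambda>z. c * f z) = norm c * A2_norm \<omega> f"
proof -
  have "A2_norm \<omega> (\<lambda>z. c * f z) = sqrt ((norm c)\<^sup>2 * (LINT z|dA. (norm (f z))\<^sup>2 * \<omega> z))"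
    unfolding A2_norm_def by (simp add: norm_mult power_mult_distrib mult.assoc)
  then show ?thesis by (simp add: real_sqrt_mult A2_norm_def)
qed

lemma A2_diff:
  assumes "f \<in> A2 \<omega>" "g \<in> A2 \<omega>"
  shows "(\<lambda>z. f z - g z) \<in> A2 \<omega>"
  using A2_add[OF assms(1) A2_scale[OF assms(2), of "-1"]] by simp

lemma A2_zero: "(\<lambda>_. 0) \<in> A2 \<omega>"
  by (simp add: A2_def)

lemma A2_sum:
  assumes "\<And>i. i \<in> I \<Longrightarrow> f i \<in> A2 \<omega>"
  shows "(\<lambda>z. \<Sum>i\<in>I. f i z) \<in> A2 \<omega>"
  using assms by (induction I rule: infinite_finite_induct) (auto simp: A2_zero A2_add)

lemma A2_inner_add_left:
  assumes "f \<in> A2 \<omega>" "g \<in> A2 \<omega>" "h \<in> A2 \<omega>"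
  shows "A2_inner \<omega> (\<lambda>z. f z + g z) h = A2_inner \<omega> f h + A2_inner \<omega> g h"
  unfolding A2_inner_def
  by (simp add: distrib_right A2_inner_integrable assms)

lemma A2_inner_scale_left: "A2_inner \<omega> (\<lambda>z. c * f z) h = c * A2_inner \<omega> f h"
  unfolding A2_inner_def by (simp add: mult.assoc)

lemma A2_inner_commute: "A2_inner \<omega> g f = cnj (A2_inner \<omega> f g)"
proof -
  have "cnj (A2_inner \<omega> f g) = (LINT z|dA. cnj (f z * cnj (g z) * complex_of_real (\<omega> z)))"
    unfolding A2_inner_def by (rule Bochner_Integration.integral_cnj[symmetric])
  then show ?thesis unfolding A2_inner_def by (simp add: mult.commute)
qed

lemma A2_inner_self: "A2_inner \<omega> f f = of_real ((A2_norm \<omega> f)\<^sup>2)"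
  unfolding A2_inner_def A2_norm_squared
  by (subst integral_complex_of_real[symmetric])
     (simp add: complex_norm_square[symmetric])

lemma A2_norm_add_squared:
  assumes f: "f \<in> A2 \<omega>" and g: "g \<in> A2 \<omega>"
  shows "(A2_norm \<omega> (\<lambda>z. f z + g z))\<^sup>2 = (A2_norm \<omega> f)\<^sup>2 + 2 * Re (A2_inner \<omega> f g) + (A2_norm \<omega> g)\<^sup>2"
proof -
  have fg: "(\<lambda>z. f z + g z) \<in> A2 \<omega>" by (rule A2_add[OF f g])
  have "complex_of_real ((A2_norm \<omega> (\<lambda>z. f z + g z))\<^sup>2)
      = A2_inner \<omega> f (\<lambda>z. f z + g z) + A2_inner \<omega> g (\<lambda>z. f z + g z)"
    by (simp only: A2_inner_self[symmetric] A2_inner_add_left[OF f g fg])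
  also have "\<dots> = cnj (A2_inner \<omega> f f + A2_inner \<omega> g f) + cnj (A2_inner \<omega> f g + A2_inner \<omega> g g)"
    by (simp only: A2_inner_commute[of _ "\<lambda>z. f z + g z"] A2_inner_add_left f g)
  finally have "(A2_norm \<omega> (\<lambda>z. f z + g z))\<^sup>2
      = Re (cnj (A2_inner \<omega> f f + A2_inner \<omega> g f) + cnj (A2_inner \<omega> f g + A2_inner \<omega> g g))"
    by (metis Re_complex_of_real)
  then show ?thesis
    by (simp add: A2_inner_self A2_inner_commute[of g f])
qed

lemma A2_norm_triangle:
  assumes f: "f \<in> A2 \<omega>" and g: "g \<in> A2 \<omega>"
  shows "A2_norm \<omega> (\<lambda>z. f z + g z) \<le> A2_norm \<omega> f + A2_norm \<omega> g"
proof (rule power2_le_imp_le)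
  have "Re (A2_inner \<omega> f g) \<le> A2_norm \<omega> f * A2_norm \<omega> g"
    using A2_Cauchy_Schwarz[OF f g] complex_Re_le_cmod order_trans by blast
  then show "(A2_norm \<omega> (\<lambda>z. f z + g z))\<^sup>2 \<le> (A2_norm \<omega> f + A2_norm \<omega> g)\<^sup>2"
    unfolding A2_norm_add_squared[OF f g] by (simp add: power2_sum)
qed simp

section \<open>Point evaluations, normal families and completeness\<close>

text \<open>This is \<open>sub_mean_value\<close> at the largest radius \<open>m * \<tau> z\<close>,
  with the integral enlarged to the whole disk. It is the upper counterpart of
  \<open>kernel_norm_lower\<close>.\<close>

lemma point_evaluation:
  "\<exists>C>0. \<forall>z\<in>disk. \<forall>f\<in>A2 \<omega>. (norm (f z))\<^sup>2 * \<omega> z * (\<tau> z)\<^sup>2 \<le> C * (A2_norm \<omega> f)\<^sup>2"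
proof -
  obtain C where C: "C > 0" and smv: "\<And>a \<rho> f. \<lbrakk>a \<in> disk; 0 < \<rho>; \<rho> \<le> m * \<tau> a; f holomorphic_on disk\<rbrakk> \<Longrightarrow>
     ennreal ((norm (f a))\<^sup>2 * \<omega> a * \<rho>\<^sup>2)
       \<le> ennreal C * (\<integral>\<^sup>+z. ennreal ((norm (f z))\<^sup>2 * \<omega> z) * indicator (ball a \<rho>) z \<partial>dA)"
    using sub_mean_value by blast
  show ?thesis
  proof (intro exI[of _ "C / m\<^sup>2"] conjI ballI)
    show "C / m\<^sup>2 > 0" using C m_pos by simp
    fix z f assume z: "z \<in> disk" and f: "f \<in> A2 \<omega>"
    have "ennreal ((norm (f z))\<^sup>2 * \<omega> z * (m * \<tau> z)\<^sup>2)
       \<le> ennreal C * (\<integral>\<^sup>+x. ennreal ((norm (f x))\<^sup>2 * \<omega> x) * indicator (ball z (m * \<tau> z)) x \<partial>dA)"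
      using m_pos \<tau>_pos[OF z] by (intro smv z A2_holomorphic[OF f]) auto
    also have "\<dots> \<le> ennreal C * (\<integral>\<^sup>+x. ennreal ((norm (f x))\<^sup>2 * \<omega> x) \<partial>dA)"
      by (intro mult_left_mono nn_integral_mono) (auto simp: indicator_def)
    also have "\<dots> = ennreal (C * (A2_norm \<omega> f)\<^sup>2)"
      unfolding nn_integral_A2[OF f] using C by (intro ennreal_mult'[symmetric]) simp
    finally have "(norm (f z))\<^sup>2 * \<omega> z * (m * \<tau> z)\<^sup>2 \<le> C * (A2_norm \<omega> f)\<^sup>2"
      using C by (subst (asm) ennreal_le_iff) auto
    then show "(norm (f z))\<^sup>2 * \<omega> z * (\<tau> z)\<^sup>2 \<le> C / m\<^sup>2 * (A2_norm \<omega> f)\<^sup>2"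
      using m_pos by (simp add: power_mult_distrib field_simps)
  qed
qed

text \<open>The continuous function \<open>\<omega> * \<tau>^2\<close> has a positive minimum on
  \<open>K\<close>.\<close>

lemma point_evaluation_compact:
  assumes K: "compact K" "K \<subseteq> disk"
  shows "\<exists>D\<ge>0. \<forall>z\<in>K. \<forall>f\<in>A2 \<omega>. norm (f z) \<le> D * A2_norm \<omega> f"
proof (cases "K = {}")
  case False
  obtain C where C: "C > 0" and pe: "\<And>z f. z \<in> disk \<Longrightarrow> f \<in> A2 \<omega> \<Longrightarrow>
      (norm (f z))\<^sup>2 * \<omega> z * (\<tau> z)\<^sup>2 \<le> C * (A2_norm \<omega> f)\<^sup>2"
    using point_evaluation by blast
  have "continuous_on K (\<lambda>z. \<omega> z * (\<tau> z)\<^sup>2)"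
    using K by (intro continuous_intros continuous_on_subset[OF continuous_\<omega>] continuous_on_subset[OF continuous_\<tau>]) auto
  from continuous_attains_inf[OF K(1) False this]
  obtain x where x: "x \<in> K" and min: "\<And>y. y \<in> K \<Longrightarrow> \<omega> x * (\<tau> x)\<^sup>2 \<le> \<omega> y * (\<tau> y)\<^sup>2"
    by blast
  define e where "e = \<omega> x * (\<tau> x)\<^sup>2"
  have e: "e > 0" using x K \<omega>_pos[of x] \<tau>_pos[of x] by (auto simp: e_def)
  show ?thesis
  proof (intro exI[of _ "sqrt (C / e)"] conjI ballI)
    show "sqrt (C / e) \<ge> 0" using C e by simp
    fix z f assume z: "z \<in> K" and f: "f \<in> A2 \<omega>"
    have "(norm (f z))\<^sup>2 * e \<le> (norm (f z))\<^sup>2 * (\<omega> z * (\<tau> z)\<^sup>2)"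
      using min[OF z] by (intro mult_left_mono) (auto simp: e_def)
    also have "\<dots> \<le> C * (A2_norm \<omega> f)\<^sup>2" using pe[OF _ f, of z] z K by (auto simp: mult.assoc)
    finally have "(norm (f z))\<^sup>2 \<le> C / e * (A2_norm \<omega> f)\<^sup>2" using e by (simp add: field_simps)
    then have "norm (f z) \<le> sqrt (C / e * (A2_norm \<omega> f)\<^sup>2)" by (rule real_le_rsqrt)
    then show "norm (f z) \<le> sqrt (C / e) * A2_norm \<omega> f"
      by (simp only: real_sqrt_mult real_sqrt_abs abs_of_nonneg[OF A2_norm_nonneg])
  qed
qed auto

text \<open>Fatou's lemma for \<open>|F n|^2 * \<omega>\<close>; it plays the part of weak lower
  semicontinuity of the norm.\<close>

lemma A2_Fatou:
  assumes F: "\<And>n. F n \<in> A2 \<omega>" and h: "h holomorphic_on disk"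
    and lim: "\<And>z. z \<in> disk \<Longrightarrow> (\<lambda>n. F n z) \<longlonglongrightarrow> h z"
    and b: "\<And>n. A2_norm \<omega> (F n) \<le> b"
  shows "h \<in> A2 \<omega>" "A2_norm \<omega> h \<le> b"
proof -
  have b0: "b \<ge> 0" using b[of 0] A2_norm_nonneg[of "F 0"] by linarith
  have "(\<integral>\<^sup>+z. ennreal ((norm (h z))\<^sup>2 * \<omega> z) \<partial>dA)
      = (\<integral>\<^sup>+z. liminf (\<lambda>n. ennreal ((norm (F n z))\<^sup>2 * \<omega> z)) \<partial>dA)"
  proof (rule nn_integral_cong)
    fix z assume "z \<in> space dA"
    then have "(\<lambda>n. ennreal ((norm (F n z))\<^sup>2 * \<omega> z)) \<longlonglongrightarrow> ennreal ((norm (h z))\<^sup>2 * \<omega> z)"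
      by (intro tendsto_intros lim) simp
    then show "ennreal ((norm (h z))\<^sup>2 * \<omega> z) = liminf (\<lambda>n. ennreal ((norm (F n z))\<^sup>2 * \<omega> z))"
      by (simp add: lim_imp_Liminf)
  qed
  also have "\<dots> \<le> liminf (\<lambda>n. \<integral>\<^sup>+z. ennreal ((norm (F n z))\<^sup>2 * \<omega> z) \<partial>dA)"
    by (intro nn_integral_liminf measurable_compose[OF norm_squared_measurable[OF A2_continuous[OF F]]]) simp
  also have "\<dots> \<le> liminf (\<lambda>n. ennreal (b\<^sup>2))"
    by (intro Liminf_mono) (auto intro!: always_eventually power_mono b simp: nn_integral_A2[OF F])
  finally have "(\<integral>\<^sup>+z. ennreal ((norm (h z))\<^sup>2 * \<omega> z) \<partial>dA) \<le> ennreal (b\<^sup>2)"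
    by (simp add: Liminf_const)
  from A2I[OF h b0 this] show "h \<in> A2 \<omega>" "A2_norm \<omega> h \<le> b" by auto
qed

text \<open>Norm-bounded sets are uniformly bounded on compact sets by point evaluation, hence
  normal, and \<open>A2_Fatou\<close> keeps the limit in the same ball. This substitutes for weak
  compactness, both for completeness and for compact operators.\<close>

lemma A2_Montel:
  assumes F: "\<And>n. F n \<in> A2 \<omega>" and b: "\<And>n. A2_norm \<omega> (F n) \<le> b"
  obtains h and r :: "nat \<Rightarrow> nat" where "h \<in> A2 \<omega>" "A2_norm \<omega> h \<le> b" "strict_mono r"
    "\<And>z. z \<in> disk \<Longrightarrow> (\<lambda>n. F (r n) z) \<longlonglongrightarrow> h z"
    "\<And>K. \<lbrakk>compact K; K \<subseteq> disk\<rbrakk> \<Longrightarrow> uniform_limit K (F \<circ> r) h sequentially"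
proof -
  define H where "H = {f \<in> A2 \<omega>. A2_norm \<omega> f \<le> b}"
  have bdd: "\<exists>b'. \<forall>f\<in>H. \<forall>z\<in>K. norm (f z) \<le> b'" if K: "compact K" "K \<subseteq> disk" for K
  proof -
    obtain D where D: "D \<ge> 0" "\<And>z f. z \<in> K \<Longrightarrow> f \<in> A2 \<omega> \<Longrightarrow> norm (f z) \<le> D * A2_norm \<omega> f"
      using point_evaluation_compact[OF K] by blast
    have "norm (f z) \<le> D * b" if "f \<in> H" "z \<in> K" for f z
    proof -
      have "norm (f z) \<le> D * A2_norm \<omega> f" using D(2) that by (simp add: H_def)
      also have "\<dots> \<le> D * b" using D(1) that by (intro mult_left_mono) (auto simp: H_def)
      finally show ?thesis .
    qed
    then show ?thesis by blast
  qed
  have HF: "range F \<subseteq> H" using F b by (auto simp: H_def)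
  obtain h r where h: "h holomorphic_on disk" "strict_mono (r :: nat \<Rightarrow> nat)"
      "\<And>x. x \<in> disk \<Longrightarrow> (\<lambda>n. F (r n) x) \<longlonglongrightarrow> h x"
      "\<And>K. \<lbrakk>compact K; K \<subseteq> disk\<rbrakk> \<Longrightarrow> uniform_limit K (F \<circ> r) h sequentially"
    using Montel[OF open_ball _ bdd HF] A2_holomorphic unfolding H_def by blast
  show ?thesis
    using A2_Fatou[of "\<lambda>n. F (r n)" h b] F b h by (intro that[of h r]) auto
qed

lemma A2_complete:
  assumes F: "\<And>n. F n \<in> A2 \<omega>"
    and Cauchy: "\<And>e. e > 0 \<Longrightarrow> \<exists>N. \<forall>n\<ge>N. \<forall>k\<ge>N. A2_norm \<omega> (\<lambda>z. F n z - F k z) \<le> e"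
  obtains h where "h \<in> A2 \<omega>" "(\<lambda>n. A2_norm \<omega> (\<lambda>z. F n z - h z)) \<longlonglongrightarrow> 0"
proof -
  obtain N where N: "\<And>n k. n \<ge> N \<Longrightarrow> k \<ge> N \<Longrightarrow> A2_norm \<omega> (\<lambda>z. F n z - F k z) \<le> 1"
    using Cauchy[of 1] by auto
  \<comment> \<open>Shifting by \<open>N\<close> gives a sequence bounded from its first term on, as
    \<open>A2_Montel\<close> requires.\<close>
  define G where "G n = F (n + N)" for n
  have G: "G n \<in> A2 \<omega>" for n by (simp add: G_def F)
  have GB: "A2_norm \<omega> (G n) \<le> 1 + A2_norm \<omega> (F N)" for n
  proof -
    have "A2_norm \<omega> (\<lambda>z. (F (n + N) z - F N z) + F N z)
        \<le> A2_norm \<omega> (\<lambda>z. F (n + N) z - F N z) + A2_norm \<omega> (F N)"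
      by (intro A2_norm_triangle A2_diff F)
    also have "\<dots> \<le> 1 + A2_norm \<omega> (F N)" by (intro add_right_mono N) auto
    finally show ?thesis by (simp add: G_def)
  qed
  obtain h r where h: "h \<in> A2 \<omega>" "strict_mono (r :: nat \<Rightarrow> nat)"
    "\<And>z. z \<in> disk \<Longrightarrow> (\<lambda>n. G (r n) z) \<longlonglongrightarrow> h z"
    by (rule A2_Montel[of G, OF G GB]) (rule that)
  have "(\<lambda>n. A2_norm \<omega> (\<lambda>z. F n z - h z)) \<longlonglongrightarrow> 0"
  proof (rule LIMSEQ_I)
    fix e :: real assume e: "e > 0"
    obtain M where M: "\<And>n k. n \<ge> M \<Longrightarrow> k \<ge> M \<Longrightarrow> A2_norm \<omega> (\<lambda>z. F n z - F k z) \<le> e / 2"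
      using Cauchy[of "e / 2"] e by auto
    \<comment> \<open>Fatou is applied in the second index: \<open>F n - F k\<close> is small for
      all large \<open>k\<close>, and the limit along the subsequence preserves the bound.\<close>
    have le: "A2_norm \<omega> (\<lambda>z. F n z - h z) \<le> e / 2" if n: "n \<ge> M" for n
    proof (rule A2_Fatou(2)[of "\<lambda>k z. F n z - G (r (k + M)) z"])
      show "(\<lambda>z. F n z - G (r (k + M)) z) \<in> A2 \<omega>" for k by (intro A2_diff F G)
      show "(\<lambda>z. F n z - h z) holomorphic_on disk"
        by (intro holomorphic_intros A2_holomorphic F h)
      show "(\<lambda>k. F n z - G (r (k + M)) z) \<longlonglongrightarrow> F n z - h z" if "z \<in> disk" for z
        by (intro tendsto_intros LIMSEQ_ignore_initial_segment[of "\<lambda>k. G (r k) z"] h that)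
      show "A2_norm \<omega> (\<lambda>z. F n z - G (r (k + M)) z) \<le> e / 2" for k
        unfolding G_def using seq_suble[OF h(2), of "k + M"] by (intro M n) auto
    qed
    have "norm (A2_norm \<omega> (\<lambda>z. F n z - h z) - 0) < e" if "n \<ge> M" for n
      using le[OF that] e by simp
    then show "\<exists>no. \<forall>n\<ge>no. norm (A2_norm \<omega> (\<lambda>z. F n z - h z) - 0) < e"
      by blast
  qed
  then show ?thesis using h(1) that by blast
qed

text \<open>Riesz representation: the functional is represented by the minimiser of
  \<open>\<parallel>g\<parallel>\<^sup>2 - 2 Re (L g)\<close>.\<close>

lemma A2_Riesz:
  assumes add: "\<And>f g. f \<in> A2 \<omega> \<Longrightarrow> g \<in> A2 \<omega> \<Longrightarrow> L (\<lambda>z. f z + g z) = L f + L g"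
    and scale: "\<And>c f. f \<in> A2 \<omega> \<Longrightarrow> L (\<lambda>z. c * f z) = c * (L f :: complex)"
    and bound: "\<And>f. f \<in> A2 \<omega> \<Longrightarrow> norm (L f) \<le> K * A2_norm \<omega> f"
  obtains h where "h \<in> A2 \<omega>" "\<And>f. f \<in> A2 \<omega> \<Longrightarrow> L f = A2_inner \<omega> f h"
proof -
  \<comment> \<open>If \<open>h\<close> represents \<open>L\<close>, then \<open>J g\<close> is the
    squared distance from \<open>g\<close> to \<open>h\<close> minus the squared norm of
    \<open>h\<close>, so \<open>h\<close> has to be the minimiser.\<close>
  define J where "J g = (A2_norm \<omega> g)\<^sup>2 - 2 * Re (L g)" for g
  have J_ge: "J g \<ge> - K\<^sup>2" if "g \<in> A2 \<omega>" for g
  proof -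
    have "Re (L g) \<le> K * A2_norm \<omega> g"
      using bound[OF that] complex_Re_le_cmod order_trans by blast
    then show ?thesis
      using zero_le_power2[of "A2_norm \<omega> g - K"] unfolding J_def
      by (simp add: power2_diff mult.commute)
  qed
  have bdd: "bdd_below (J ` A2 \<omega>)" using J_ge by (auto intro!: bdd_belowI)
  define I where "I = Inf (J ` A2 \<omega>)"
  have I_le: "I \<le> J g" if "g \<in> A2 \<omega>" for g
    unfolding I_def using bdd that by (intro cInf_lower) auto
  have "\<exists>g\<in>A2 \<omega>. J g < I + inverse (real (Suc n))" for n
    using cInf_lessD[of "J ` A2 \<omega>" "I + inverse (real (Suc n))"] A2_zero
    unfolding I_def by (metis (no_types, lifting) empty_iff image_iff inverse_positive_iff_positive
        less_add_same_cancel1 of_nat_0_less_iff zero_less_Suc)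
  then obtain g where g: "\<And>n. g n \<in> A2 \<omega>" "\<And>n. J (g n) < I + inverse (real (Suc n))"
    by metis
  have J_add: "J (\<lambda>z. u z + of_real t * v z)
      = J u + 2 * t * (Re (A2_inner \<omega> v u) - Re (L v)) + t\<^sup>2 * (A2_norm \<omega> v)\<^sup>2"
    if "u \<in> A2 \<omega>" "v \<in> A2 \<omega>" for u v and t :: real
    using A2_norm_add_squared[OF that(1) A2_scale[OF that(2), of "of_real t"]] that
    by (simp add: J_def add A2_scale scale A2_norm_scale power_mult_distrib A2_inner_scale_left
         A2_inner_commute[of u "\<lambda>z. of_real t * v z"] algebra_simps)
  \<comment> \<open>\<open>J\<close> is quadratic along the segment from \<open>g k\<close> to
    \<open>g n\<close>, so \<open>J (g n) + J (g k)\<close> minus twice its midpoint value is half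
    the squared distance; the midpoint value is at least \<open>I\<close>.\<close>
  have close: "(A2_norm \<omega> (\<lambda>z. g n z - g k z))\<^sup>2 \<le> 2 * (inverse (real (Suc n)) + inverse (real (Suc k)))" for n k
  proof -
    define v where "v z = g n z - g k z" for z
    have v: "v \<in> A2 \<omega>" unfolding v_def by (intro A2_diff g)
    have eq: "g n = (\<lambda>z. g k z + of_real 1 * v z)" by (simp add: v_def fun_eq_iff)
    have mid: "(\<lambda>z. g k z + of_real (1 / 2) * v z) \<in> A2 \<omega>" by (intro A2_add A2_scale g v)
    have "J (g n) = J (g k) + 2 * 1 * (Re (A2_inner \<omega> v (g k)) - Re (L v)) + 1\<^sup>2 * (A2_norm \<omega> v)\<^sup>2"
      by (subst eq, rule J_add[OF g(1) v])
    moreover have "I \<le> J (g k) + 2 * (1 / 2) * (Re (A2_inner \<omega> v (g k)) - Re (L v)) + (1 / 2)\<^sup>2 * (A2_norm \<omega> v)\<^sup>2"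
      using I_le[OF mid] unfolding J_add[OF g(1) v] .
    ultimately have "(A2_norm \<omega> v)\<^sup>2 \<le> 2 * (inverse (real (Suc n)) + inverse (real (Suc k)))"
      using g(2)[of n] g(2)[of k] by (simp add: power2_eq_square) 
    then show ?thesis by (simp add: v_def[abs_def])
  qed
  have "\<exists>N. \<forall>n\<ge>N. \<forall>k\<ge>N. A2_norm \<omega> (\<lambda>z. g n z - g k z) \<le> e" if e: "e > 0" for e
  proof -
    obtain N where N: "inverse (real (Suc N)) < e\<^sup>2 / 4"
      using reals_Archimedean[of "e\<^sup>2 / 4"] e by auto
    have "A2_norm \<omega> (\<lambda>z. g n z - g k z) \<le> e" if "n \<ge> N" "k \<ge> N" for n k
    proof (rule power2_le_imp_le)
      have "inverse (real (Suc n)) \<le> inverse (real (Suc N))" "inverse (real (Suc k)) \<le> inverse (real (Suc N))"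
        using that by (auto intro!: le_imp_inverse_le)
      moreover have "a \<le> e\<^sup>2" if "a \<le> 2 * (x + y)" "x \<le> u" "y \<le> u" "u < e\<^sup>2 / 4" for a x y u :: real
        using that by argo
      ultimately show "(A2_norm \<omega> (\<lambda>z. g n z - g k z))\<^sup>2 \<le> e\<^sup>2" using close[of n k] N by blast
    qed (use e in simp)
    then show ?thesis by blast
  qed
  then obtain h where h: "h \<in> A2 \<omega>" "(\<lambda>n. A2_norm \<omega> (\<lambda>z. g n z - h z)) \<longlonglongrightarrow> 0"
    using A2_complete[of g] g(1) by blast
  \<comment> \<open>The first variation at the minimum. It is taken along the minimising sequence,
    so continuity of \<open>L\<close> or \<open>J\<close> at \<open>h\<close> does not have to be
    established.\<close>
  have Re_eq: "Re (L f) = Re (A2_inner \<omega> f h)" if f: "f \<in> A2 \<omega>" for f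
  proof -
    have "(\<lambda>n. Re (A2_inner \<omega> f (g n))) \<longlonglongrightarrow> Re (A2_inner \<omega> f h)"
    proof (rule LIM_zero_cancel, rule Lim_null_comparison)
      show "(\<lambda>n. A2_norm \<omega> f * A2_norm \<omega> (\<lambda>z. g n z - h z)) \<longlonglongrightarrow> 0"
        using tendsto_mult_left[OF h(2), of "A2_norm \<omega> f"] by simp
      have "norm (Re (A2_inner \<omega> f (g n)) - Re (A2_inner \<omega> f h)) \<le> A2_norm \<omega> f * A2_norm \<omega> (\<lambda>z. g n z - h z)" for n
      proof -
        have d: "(\<lambda>z. g n z - h z) \<in> A2 \<omega>" by (intro A2_diff g h)
        have "A2_inner \<omega> (g n) f = A2_inner \<omega> (\<lambda>z. g n z - h z) f + A2_inner \<omega> h f"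
          using A2_inner_add_left[OF d h(1) f] by simp
        then have "Re (A2_inner \<omega> f (g n)) - Re (A2_inner \<omega> f h) = Re (A2_inner \<omega> (\<lambda>z. g n z - h z) f)"
          by (simp add: A2_inner_commute[of f])
        then show ?thesis
          using A2_Cauchy_Schwarz[OF d f] abs_Re_le_cmod[of "A2_inner \<omega> (\<lambda>z. g n z - h z) f"]
          by (simp add: mult.commute)
      qed
      then show "\<forall>\<^sub>F n in sequentially. norm (Re (A2_inner \<omega> f (g n)) - Re (A2_inner \<omega> f h))
          \<le> A2_norm \<omega> f * A2_norm \<omega> (\<lambda>z. g n z - h z)" by simp
    qed
    note lim = this
    define d where "d = Re (A2_inner \<omega> f h) - Re (L f)"
    define b where "b = (A2_norm \<omega> f)\<^sup>2"
    have quad: "0 \<le> 2 * t * d + t\<^sup>2 * b" for t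
    proof (rule LIMSEQ_le_const)
      show "(\<lambda>n. 2 * t * (Re (A2_inner \<omega> f (g n)) - Re (L f)) + t\<^sup>2 * b + inverse (real (Suc n))) \<longlonglongrightarrow> 2 * t * d + t\<^sup>2 * b"
        using tendsto_add[OF tendsto_add[OF tendsto_mult_left[OF tendsto_diff[OF lim tendsto_const], of "2 * t"] tendsto_const] LIMSEQ_inverse_real_of_nat]
        by (simp add: d_def)
      have "0 \<le> 2 * t * (Re (A2_inner \<omega> f (g n)) - Re (L f)) + t\<^sup>2 * b + inverse (real (Suc n))" for n
        using I_le[OF A2_add[OF g(1) A2_scale[OF f]], of n "of_real t"] g(2)[of n]
        unfolding J_add[OF g(1) f] by (simp add: b_def)
      then show "\<exists>N. \<forall>n\<ge>N. 0 \<le> 2 * t * (Re (A2_inner \<omega> f (g n)) - Re (L f)) + t\<^sup>2 * b + inverse (real (Suc n))"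
        by blast
    qed
    have "d = 0"
    proof (rule ccontr)
      assume "d \<noteq> 0"
      \<comment> \<open>A negative value of \<open>2 * t * d + t^2 * b\<close> is wanted;
        \<open>b + 1\<close> in place of \<open>b\<close> also covers \<open>b = 0\<close>.\<close>
      define t where "t = - d / (b + 1)"
      have b: "b + 1 > 0" by (simp add: b_def add_nonneg_pos)
      have "2 * t * d + t\<^sup>2 * b = t * (2 * d + t * b)" by (simp add: power2_eq_square algebra_simps)
      also have "2 * d + t * b = d * (b + 2) / (b + 1)" using b by (simp add: t_def field_simps)
      also have "t * (d * (b + 2) / (b + 1)) = - (d\<^sup>2 * ((b + 2) / (b + 1)\<^sup>2))"
        by (simp add: t_def power2_eq_square)
      finally have "2 * t * d + t\<^sup>2 * b = - (d\<^sup>2 * ((b + 2) / (b + 1)\<^sup>2))" .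
      moreover have "d\<^sup>2 * ((b + 2) / (b + 1)\<^sup>2) > 0"
        using \<open>d \<noteq> 0\<close> b by (intro mult_pos_pos divide_pos_pos) auto
      ultimately show False using quad[of t] by linarith
    qed
    then show ?thesis by (simp add: d_def)
  qed
  \<comment> \<open>The imaginary parts follow by applying the real identity to
    \<open>\<i> * f\<close>.\<close>
  have "L f = A2_inner \<omega> f h" if f: "f \<in> A2 \<omega>" for f
  proof (rule complex_eqI)
    show "Re (L f) = Re (A2_inner \<omega> f h)" by (rule Re_eq[OF f])
    have "Re (L (\<lambda>z. \<i> * f z)) = Re (A2_inner \<omega> (\<lambda>z. \<i> * f z) h)" by (rule Re_eq[OF A2_scale[OF f]])
    then show "Im (L f) = Im (A2_inner \<omega> f h)" by (simp add: scale[OF f] A2_inner_scale_left)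
  qed
  then show ?thesis using h(1) that by blast
qed

text \<open>The Riesz theorem for evaluation at \<open>z\<close> supplies a witness for the
  \<open>SOME\<close> in the definition.\<close>

lemma kernel:
  assumes z: "z \<in> disk"
  shows "kernel \<omega> z \<in> A2 \<omega>" and "f \<in> A2 \<omega> \<Longrightarrow> f z = A2_inner \<omega> f (kernel \<omega> z)"
proof -
  have "\<exists>D\<ge>0. \<forall>x\<in>{z}. \<forall>f\<in>A2 \<omega>. norm (f x) \<le> D * A2_norm \<omega> f"
    using z by (intro point_evaluation_compact) auto
  then obtain D where D: "\<forall>f\<in>A2 \<omega>. norm (f z) \<le> D * A2_norm \<omega> f"
    by blast
  have "\<exists>k. k \<in> A2 \<omega> \<and> (\<forall>f\<in>A2 \<omega>. f z = A2_inner \<omega> f k)"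
  proof (rule A2_Riesz[of "\<lambda>f. f z" D])
    fix h assume "h \<in> A2 \<omega>" "\<And>f. f \<in> A2 \<omega> \<Longrightarrow> f z = A2_inner \<omega> f h"
    then show ?thesis by blast
  next
    fix f assume "f \<in> A2 \<omega>"
    then show "norm (f z) \<le> D * A2_norm \<omega> f" using D by blast
  qed (rule refl)+
  then have "kernel \<omega> z \<in> A2 \<omega> \<and> (\<forall>f\<in>A2 \<omega>. f z = A2_inner \<omega> f (kernel \<omega> z))"
    unfolding kernel_def by (rule someI_ex)
  then show "kernel \<omega> z \<in> A2 \<omega>" and "f \<in> A2 \<omega> \<Longrightarrow> f z = A2_inner \<omega> f (kernel \<omega> z)"
    by auto
qed

lemma kernel_diag: "z \<in> disk \<Longrightarrow> kernel \<omega> z z = of_real ((A2_norm \<omega> (kernel \<omega> z))\<^sup>2)"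
  using kernel(2)[OF _ kernel(1)] by (simp add: A2_inner_self)

lemma kernel_extremal:
  assumes "z \<in> disk" "f \<in> A2 \<omega>"
  shows "norm (f z) \<le> A2_norm \<omega> f * A2_norm \<omega> (kernel \<omega> z)"
  using kernel[OF assms(1)] A2_Cauchy_Schwarz[OF assms(2)] assms(2) by metis

end

section \<open>The norm of the kernel from below\<close>

lemma deriv_le_imp_diff_le:
  fixes f :: "real \<Rightarrow> real"
  assumes "a \<le> b" "\<And>x. \<lbrakk>a \<le> x; x \<le> b\<rbrakk> \<Longrightarrow> (f has_real_derivative f' x) (at x)"
    and "\<And>x. \<lbrakk>a \<le> x; x \<le> b\<rbrakk> \<Longrightarrow> f' x \<le> K"
  shows "f b - f a \<le> K * (b - a)"
proof (cases "a = b")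
  case False
  with assms(1) have ab: "a < b" by simp
  obtain x where x: "x > a" "x < b" "f b - f a = (b - a) * f' x"
    using MVT2[OF ab, of f f'] assms(2) by blast
  have "(b - a) * f' x \<le> (b - a) * K" using x assms(3)[of x] by (intro mult_left_mono) auto
  then show ?thesis using x by (simp add: mult.commute)
qed simp

lemma emeasure_dA_annulus:
  assumes h: "h > 0" and x: "0 \<le> x" "x \<le> 1"
  shows "emeasure dA {z \<in> disk. \<bar>norm z - x\<bar> < h} \<le> ennreal (4 * h)"
proof -
  define u where "u = max 0 (x - h)"
  define v where "v = min 1 (x + h)"
  have uv: "0 \<le> u" "u \<le> v" "v \<le> 1" "v - u \<le> 2 * h" using h x by (auto simp: u_def v_def)
  have s: "ball 0 v \<in> sets dA" "ball 0 u \<in> sets dA"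
    using uv by (auto simp: sets_dA_iff intro!: subset_ball)
  have "{z \<in> disk. \<bar>norm z - x\<bar> < h} \<subseteq> ball 0 v - ball 0 u"
    by (auto simp: u_def v_def abs_less_iff max_def split: if_splits)
  then have "emeasure dA {z \<in> disk. \<bar>norm z - x\<bar> < h} \<le> emeasure dA (ball 0 v - ball 0 u)"
    using s by (intro emeasure_mono) auto
  also have "\<dots> = emeasure dA (ball 0 v) - emeasure dA (ball 0 u)"
    using s uv by (intro emeasure_Diff) (auto simp: emeasure_dA_ball intro!: subset_ball)
  also have "\<dots> = ennreal (v\<^sup>2 - u\<^sup>2)"
    using uv by (simp add: emeasure_dA_ball ennreal_minus)
  also have "v\<^sup>2 - u\<^sup>2 \<le> 4 * h"
  proof -
    have "v\<^sup>2 - u\<^sup>2 = (v - u) * (v + u)" by (simp add: power2_eq_square algebra_simps)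
    also have "\<dots> \<le> (2 * h) * 2" using uv h by (intro mult_mono) auto
    finally show ?thesis by simp
  qed
  finally show ?thesis by (simp add: ennreal_leI)
qed

text \<open>The integral is cut at multiples of \<open>t\<close>: up to distance
  \<open>(k + 1) * t\<close> from the circle of radius \<open>x\<close> the area is at most
  \<open>4 * (k + 1) * t\<close>, while the integrand at distance \<open>k * t\<close> or more is at
  most \<open>e ^ k\<close>. The sum of \<open>(k + 1) * e ^ k\<close> is
  \<open>1 / (1 - e)^2\<close>.\<close>

lemma nn_integral_radial_exp:
  assumes l: "l > 0"
  shows "\<exists>C>0. \<forall>t>0. \<forall>x. 0 \<le> x \<and> x \<le> 1 \<longrightarrow>
    (\<integral>\<^sup>+z. ennreal (exp (- l * (\<bar>norm z - x\<bar> / t))) \<partial>dA) \<le> ennreal (C * t)"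
proof -
  define e where "e = exp (- l)"
  have e: "0 < e" "e < 1" using l by (auto simp: e_def)
  define C where "C = 4 / (1 - e)\<^sup>2"
  have sums: "(\<lambda>k. 4 * (real (Suc k) * e ^ k)) sums C"
    using sums_mult[OF geometric_deriv_sums[of e], of 4] e by (simp add: C_def)
  show ?thesis
  proof (intro exI[of _ C] conjI allI impI)
    show "C > 0" using e by (simp add: C_def)
    fix t x :: real assume t: "t > 0" and x: "0 \<le> x \<and> x \<le> 1"
    \<comment> \<open>These annuli are nested rather than disjoint shells; the overlap only enlarges
      the majorising sum.\<close>
    define S where "S k = {z \<in> disk. \<bar>norm z - x\<bar> < real (Suc k) * t}" for k
    have S: "S k \<in> sets dA" for k
      unfolding sets_dA_iff S_def by (auto intro!: borel_open open_Collect_conj open_Collect_less continuous_intros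
        simp: open_ball[of 0 1, unfolded ball_def])
    have le_suminf: "f k \<le> (\<Sum>k. f k)" for f :: "nat \<Rightarrow> ennreal" and k
      using sum_le_suminf[of f "{k}"] by simp
    have "(\<integral>\<^sup>+z. ennreal (exp (- l * (\<bar>norm z - x\<bar> / t))) \<partial>dA)
        \<le> (\<integral>\<^sup>+z. (\<Sum>k. ennreal (e ^ k) * indicator (S k) z) \<partial>dA)"
    proof (rule nn_integral_mono)
      fix z assume z: "z \<in> space dA"
      define y where "y = \<bar>norm z - x\<bar> / t"
      have y: "y \<ge> 0" using t by (simp add: y_def)
      define k where "k = nat \<lfloor>y\<rfloor>"
      have k: "real k \<le> y" "y < real (Suc k)"
        using y unfolding k_def by (simp, linarith)
      have "z \<in> S k" using z k t by (simp add: S_def y_def field_simps)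
      have "exp (- l * y) \<le> exp (- l * real k)" using k l by simp
      also have "\<dots> = e ^ k" by (simp add: e_def exp_of_nat_mult[symmetric] mult.commute)
      finally have "ennreal (exp (- l * y)) \<le> ennreal (e ^ k) * indicator (S k) z"
        using \<open>z \<in> S k\<close> by (simp add: ennreal_leI)
      also have "\<dots> \<le> (\<Sum>k. ennreal (e ^ k) * indicator (S k) z)"
        by (rule le_suminf)
      finally show "ennreal (exp (- l * (\<bar>norm z - x\<bar> / t))) \<le> (\<Sum>k. ennreal (e ^ k) * indicator (S k) z)"
        by (simp add: y_def)
    qed
    also have "\<dots> = (\<Sum>k. \<integral>\<^sup>+z. ennreal (e ^ k) * indicator (S k) z \<partial>dA)"
      using S by (intro nn_integral_suminf) auto
    also have "\<dots> = (\<Sum>k. ennreal (e ^ k) * emeasure dA (S k))"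
      using S by (simp add: nn_integral_cmult_indicator)
    also have "\<dots> \<le> (\<Sum>k. ennreal (4 * (real (Suc k) * e ^ k) * t))"
    proof (rule suminf_le)
      fix k
      have "emeasure dA (S k) \<le> ennreal (4 * (real (Suc k) * t))"
        unfolding S_def using t x by (intro emeasure_dA_annulus) auto
      then have "ennreal (e ^ k) * emeasure dA (S k) \<le> ennreal (e ^ k) * ennreal (4 * (real (Suc k) * t))"
        by (rule mult_left_mono) simp
      also have "\<dots> = ennreal (4 * (real (Suc k) * e ^ k) * t)"
        using e by (subst ennreal_mult'[symmetric]) (auto simp: mult_ac)
      finally show "ennreal (e ^ k) * emeasure dA (S k) \<le> ennreal (4 * (real (Suc k) * e ^ k) * t)" .
    qed auto
    also have "\<dots> = ennreal (C * t)"
      using sums_mult2[OF sums, of t] e t by (intro suminf_ennreal_eq) auto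
    finally show "(\<integral>\<^sup>+z. ennreal (exp (- l * (\<bar>norm z - x\<bar> / t))) \<partial>dA) \<le> ennreal (C * t)" .
  qed
qed

context large_weight begin

section \<open>Monomials: orthogonality and norm estimates\<close>

lemma monomial_A2: "(\<lambda>z. z ^ n) \<in> A2 \<omega>"
proof -
  have "integrable dA (\<lambda>z. (norm (z ^ n))\<^sup>2 * \<omega> z)"
  proof (rule Bochner_Integration.integrable_bound)
    show "integrable dA \<omega>" using weight by (simp add: weight_def)
    show "(\<lambda>z. (norm (z ^ n))\<^sup>2 * \<omega> z) \<in> borel_measurable dA"
      by (intro norm_squared_measurable continuous_intros)
    show "AE z in dA. norm ((norm (z ^ n))\<^sup>2 * \<omega> z) \<le> norm (\<omega> z)"
    proof (rule AE_I2)
      fix z assume "z \<in> space dA"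
      then have "(norm (z ^ n))\<^sup>2 \<le> 1" by (simp add: norm_power power_le_one)
      then show "norm ((norm (z ^ n))\<^sup>2 * \<omega> z) \<le> norm (\<omega> z)"
        by (simp add: abs_mult mult_left_le_one_le)
    qed
  qed
  then show ?thesis by (auto simp: A2_def intro!: holomorphic_intros)
qed

text \<open>Rotation by \<open>c\<close> preserves \<open>dA\<close> and the radial weight and
  multiplies the integrand by \<open>c ^ n * cnj c ^ k\<close>, so it suffices that this factor
  differs from 1.\<close>

lemma monomial_orthogonal:
  assumes "n \<noteq> k"
  shows "A2_inner \<omega> (\<lambda>z. z ^ n) (\<lambda>z. z ^ k) = 0"
proof -
  \<comment> \<open>Since \<open>X > |n - k|\<close>, the angle
    \<open>\<theta> = (n - k) * pi / (2 * X)\<close> is nonzero and smaller than \<open>pi\<close>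
    in modulus, hence not a multiple of a full turn.\<close>
  define X where "X = real n + real k + 1"
  have X: "X \<ge> 1" by (simp add: X_def)
  define a where "a = pi / (2 * X)"
  define c where "c = cis a"
  have a0: "a > 0" using X by (simp add: a_def)
  have "a * 1 \<le> a * X" using a0 X by (intro mult_left_mono) auto
  also have "\<dots> = pi / 2" using X by (simp add: a_def)
  finally have a: "0 < a" "a < pi" using a0 pi_gt_zero by auto
  have nc: "norm c = 1" by (simp add: c_def)
  have "sin a > 0" using a by (rule sin_gt_zero)
  then have c1: "c \<noteq> -1" by (auto simp: c_def complex_eq_iff)
  define \<theta> where "\<theta> = (real n - real k) * a"
  have "\<bar>\<theta>\<bar> < pi"
  proof -
    have "\<bar>\<theta>\<bar> = \<bar>real n - real k\<bar> * a" using a by (simp add: \<theta>_def abs_mult)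
    also have "\<dots> \<le> X * a" using a by (intro mult_right_mono) (auto simp: X_def)
    also have "\<dots> = pi / 2" using X by (simp add: a_def)
    finally show ?thesis using pi_gt_zero by linarith
  qed
  moreover have "\<theta> \<noteq> 0" using assms a by (simp add: \<theta>_def)
  ultimately have "sin \<theta> \<noteq> 0"
    using sin_gt_zero[of \<theta>] sin_gt_zero[of "- \<theta>"] by (cases "\<theta> > 0") auto
  then have ne: "cis \<theta> \<noteq> 1" by (auto simp: complex_eq_iff)
  have cc: "c ^ n * cnj c ^ k = cis \<theta>"
    unfolding c_def cis_cnj Complex.DeMoivre cis_mult by (simp add: \<theta>_def algebra_simps)
  define I where "I = A2_inner \<omega> (\<lambda>z. z ^ n) (\<lambda>z. z ^ k)"
  have m: "(*) c \<in> measurable dA dA"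
    unfolding measurable_cong_sets[OF sets_dA sets_dA]
    by (rule measurable_restrict_space3) (auto simp: norm_mult nc)
  have "I = (LINT z|distr dA dA ((*) c). z ^ n * cnj (z ^ k) * complex_of_real (\<omega> z))"
    by (simp add: I_def A2_inner_def distr_dA_rotate[OF nc c1])
  also have "\<dots> = (LINT z|dA. (c * z) ^ n * cnj ((c * z) ^ k) * complex_of_real (\<omega> (c * z)))"
    by (intro integral_distr m continuous_on_borel_measurable_dA continuous_intros continuous_\<omega>)
  also have "\<dots> = (LINT z|dA. cis \<theta> * (z ^ n * cnj (z ^ k) * complex_of_real (\<omega> z)))"
  proof (rule Bochner_Integration.integral_cong)
    fix z assume "z \<in> space dA"
    then have "\<omega> (c * z) = \<omega> z"
      using decreasing by (intro radialD[of \<omega>]) (auto simp: radially_decreasing_def norm_mult nc)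
    then show "(c * z) ^ n * cnj ((c * z) ^ k) * complex_of_real (\<omega> (c * z))
        = cis \<theta> * (z ^ n * cnj (z ^ k) * complex_of_real (\<omega> z))"
      unfolding cc[symmetric] by (simp add: power_mult_distrib mult_ac)
  qed simp
  also have "\<dots> = cis \<theta> * I" unfolding I_def A2_inner_def by (rule integral_mult_right_zero)
  finally have "(1 - cis \<theta>) * I = 0" by (simp add: left_diff_distrib)
  then show ?thesis using ne by (simp add: I_def)
qed

lemma q_mono:
  assumes "0 < a" "a \<le> b" "b < 1" shows "q a \<le> q b"
proof -
  have "- q b - (- q a) \<le> 0 * (b - a)"
  proof (rule deriv_le_imp_diff_le[where f' = "\<lambda>x. - q' x"])
    fix x assume x: "a \<le> x" "x \<le> b"
    show "((\<lambda>x. - q x) has_real_derivative - q' x) (at x)"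
      using x assms by (intro DERIV_minus has_derivative_q) auto
    show "- q' x \<le> 0" using x assms laplacian_pos[of "of_real x"] by (simp add: q'_def)
  qed (use assms in simp)
  then show ?thesis by simp
qed

text \<open>\<open>q' x \<ge> x / (B^2 * \<tau>^2)\<close> with \<open>x \<ge> 1/4\<close> and
  \<open>\<tau>\<close> at most 5/4 of its value at \<open>r\<close>; finally
  \<open>(1/4) / (5/4)^2 = 4/25\<close> exceeds 1/8.\<close>

lemma q_increment:
  assumes r: "1 / 2 \<le> r" "r < 1" and ab: "r - m * profile \<tau> r \<le> a" "a \<le> b" "b \<le> r + m * profile \<tau> r"
  shows "(b - a) / (8 * B\<^sup>2 * (profile \<tau> r)\<^sup>2) \<le> q b - q a"
proof -
  define K where "K = 1 / (8 * B\<^sup>2 * (profile \<tau> r)\<^sup>2)"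
  have T: "profile \<tau> r > 0" using r by (intro \<tau>_pos) simp
  have "- q b - (- q a) \<le> (- K) * (b - a)"
  proof (rule deriv_le_imp_diff_le[where f' = "\<lambda>x. - q' x"])
    fix x assume x: "a \<le> x" "x \<le> b"
    have "\<bar>x - r\<bar> \<le> m * profile \<tau> r" using x ab by (auto simp: abs_le_iff)
    note nr = near_real[OF r this]
    show "((\<lambda>x. - q x) has_real_derivative - q' x) (at x)"
      using nr by (intro DERIV_minus has_derivative_q) auto
    have d: "complex_of_real x \<in> disk" using nr by simp
    have "K \<le> x / (B\<^sup>2 * (profile \<tau> x)\<^sup>2)"
    proof -
      have "K \<le> (1 / 4) / (B\<^sup>2 * (5 / 4 * profile \<tau> r)\<^sup>2)"
        using T B_pos by (simp add: K_def power_mult_distrib field_simps)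
      also have "\<dots> \<le> x / (B\<^sup>2 * (profile \<tau> x)\<^sup>2)"
      proof (rule frac_le)
        show "0 < B\<^sup>2 * (profile \<tau> x)\<^sup>2" using B_pos \<tau>_pos[OF d] by simp
        have "(profile \<tau> x)\<^sup>2 \<le> (5 / 4 * profile \<tau> r)\<^sup>2"
          by (rule power_mono) (use nr \<tau>_pos[OF d] in auto)
        then show "B\<^sup>2 * (profile \<tau> x)\<^sup>2 \<le> B\<^sup>2 * (5 / 4 * profile \<tau> r)\<^sup>2"
          by (rule mult_left_mono) simp
      qed (use nr in auto)
      finally show ?thesis .
    qed
    also have "\<dots> \<le> q' x" using nr by (intro q'_bounds) auto
    finally show "- q' x \<le> - K" by simp
  qed (use ab in simp)
  then show ?thesis by (simp add: K_def)
qed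

text \<open>The function \<open>n ln s - p s\<close> has derivative \<open>(n - q s) / s\<close>; if \<open>n\<close> is slightly larger than
  \<open>q r\<close>, the growth of \<open>q\<close> makes it decay linearly, on the scale \<open>\<tau> r\<close>, away from \<open>r\<close>.\<close>

lemma exponent_decay:
  assumes r: "1 / 2 \<le> r" "r < 1" and s: "0 < s" "s < 1"
    and \<kappa>: "\<kappa> = m / (8 * B\<^sup>2)"
    and n: "q r \<le> n" "n \<le> q r + \<kappa> / 2 / profile \<tau> r"
  shows "n * ln s - p s \<le> n * ln r - p r + 2 * \<kappa> * m - \<kappa> / 2 * (\<bar>s - r\<bar> / profile \<tau> r)"
proof -
  define T where "T = profile \<tau> r"
  have T: "T > 0" using r unfolding T_def by (intro \<tau>_pos) simp
  define G where "G x = n * ln x - p x" for x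
  have \<kappa>0: "\<kappa> > 0" using m_pos B_pos by (simp add: \<kappa>)
  define h where "h = m * T"
  have h: "h > 0" using m_pos T by (simp add: h_def)
  have rh: "1 / 4 \<le> r - h" "r + h < 1"
    using near_real(1)[OF r, of "r - h"] near_real(2)[OF r, of "r + h"] h by (auto simp: h_def T_def)
  \<comment> \<open>\<open>\<kappa>\<close> is chosen to be this increment over
    \<open>h = m * T\<close>. As \<open>n\<close> exceeds \<open>q r\<close> by at most half of it,
    \<open>n - q\<close> is at most \<open>- \<kappa> / (2 * T)\<close> beyond \<open>r + h\<close>
    and at least \<open>\<kappa> / T\<close> before \<open>r - h\<close>.\<close>
  have inc: "\<kappa> / T \<le> q (r + h) - q r" "\<kappa> / T \<le> q r - q (r - h)"
  proof -
    have "h / (8 * B\<^sup>2 * T\<^sup>2) = \<kappa> / T"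
      using T by (simp add: h_def \<kappa> power2_eq_square)
    then show "\<kappa> / T \<le> q (r + h) - q r" "\<kappa> / T \<le> q r - q (r - h)"
      using q_increment[OF r, of r "r + h"] q_increment[OF r, of "r - h" r] h
      by (auto simp: h_def T_def)
  qed
  have G': "(G has_real_derivative (n - q x) / x) (at x)" if "0 < x" "x < 1" for x
  proof -
    have "(G has_real_derivative n * (1 / x) - q x / x) (at x)"
      unfolding G_def by (intro DERIV_diff DERIV_cmult has_derivative_p DERIV_ln_divide that)
    then show ?thesis by (simp add: diff_divide_distrib)
  qed
  \<comment> \<open>Between \<open>r\<close> and \<open>r + h\<close> the function may still rise,
    because \<open>n\<close> can exceed \<open>q\<close>. Dividing the excess by
    \<open>y \<ge> 1/2\<close> at most doubles it.\<close>
  have right: "G x - G r \<le> \<kappa> * m" if x: "r \<le> x" "x \<le> r + h" for x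
  proof -
    have "G x - G r \<le> \<kappa> / T * (x - r)"
    proof (rule deriv_le_imp_diff_le[where f' = "\<lambda>x. (n - q x) / x"])
      fix y assume y: "r \<le> y" "y \<le> x"
      show "(G has_real_derivative (n - q y) / y) (at y)" using y x r rh by (intro G') auto
      have "n - q y \<le> \<kappa> / 2 / T" using n q_mono[of r y] y x r rh by (simp add: T_def)
      then have "(n - q y) / y \<le> (\<kappa> / 2 / T) / y" using y r by (intro divide_right_mono) auto
      also have "\<dots> \<le> (\<kappa> / 2 / T) / (1 / 2)"
        using y r \<kappa>0 T by (intro divide_left_mono) auto
      finally show "(n - q y) / y \<le> \<kappa> / T" by simp
    qed (use x in simp)
    also have "\<dots> \<le> \<kappa> / T * h" using x \<kappa>0 T by (intro mult_left_mono) auto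
    also have "\<dots> = \<kappa> * m" using T by (simp add: h_def)
    finally show ?thesis .
  qed
  have left: "G x \<le> G y" if "0 < x" "x \<le> y" "y \<le> r" for x y
  proof -
    have "- G y - (- G x) \<le> 0 * (y - x)"
    proof (rule deriv_le_imp_diff_le[where f' = "\<lambda>x. - ((n - q x) / x)"])
      fix t assume t: "x \<le> t" "t \<le> y"
      show "((\<lambda>x. - G x) has_real_derivative - ((n - q t) / t)) (at t)"
        using t that r by (intro DERIV_minus G') auto
      show "- ((n - q t) / t) \<le> 0" using n q_mono[of t r] t that r by simp
    qed (use that in simp)
    then show ?thesis by simp
  qed
  have hT: "h / T = m" using T by (simp add: h_def)
  \<comment> \<open>The slack \<open>2 * \<kappa> * m\<close> absorbs the rise of at most
    \<open>\<kappa> * m\<close> next to \<open>r\<close> and the error from measuring distances from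
    \<open>r\<close> instead of from \<open>r + h\<close> or \<open>r - h\<close>.\<close>
  have "G s \<le> G r + 2 * \<kappa> * m - \<kappa> / 2 * (\<bar>s - r\<bar> / T)"
  proof -
    consider "\<bar>s - r\<bar> \<le> h" | "s > r + h" | "s < r - h" using h by (auto simp: abs_le_iff) linarith
    then show ?thesis
    proof cases
      case 1
      have "G s - G r \<le> \<kappa> * m"
      proof (cases "r \<le> s")
        case True then show ?thesis using 1 by (intro right) auto
      next
        case False
        then have "G s \<le> G r" using s by (intro left) auto
        moreover have "\<kappa> * m \<ge> 0" using \<kappa>0 m_pos by simp
        ultimately show ?thesis by linarith
      qed
      moreover have "\<kappa> / 2 * (\<bar>s - r\<bar> / T) \<le> \<kappa> / 2 * m"
        using 1 T \<kappa>0 hT by (intro mult_left_mono) (auto simp: field_simps)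
      moreover have "\<kappa> * m \<ge> 0" using \<kappa>0 m_pos by simp
      ultimately show ?thesis by argo
    next
      case 2
      have "G s - G (r + h) \<le> (- (\<kappa> / 2 / T)) * (s - (r + h))"
      proof (rule deriv_le_imp_diff_le[where f' = "\<lambda>x. (n - q x) / x"])
        fix y assume y: "r + h \<le> y" "y \<le> s"
        have y01: "0 < y" "y < 1" using y s r h by auto
        show "(G has_real_derivative (n - q y) / y) (at y)" using y01 by (rule G')
        have "q (r + h) \<le> q y" using y y01 r h by (intro q_mono) auto
        then have le: "n - q y \<le> - (\<kappa> / 2 / T)" using n(2) inc(1) unfolding T_def[symmetric] by (simp add: field_simps)
        \<comment> \<open>Since \<open>y < 1\<close>, dividing the negative quantity
          \<open>n - q y\<close> by \<open>y\<close> only makes it more negative.\<close>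
        have "- (\<kappa> / 2 / T) * 1 \<le> - (\<kappa> / 2 / T) * y"
          by (rule mult_left_mono_neg) (use y01 \<kappa>0 T in auto)
        then have "n - q y \<le> - (\<kappa> / 2 / T) * y" using le by linarith
        then show "(n - q y) / y \<le> - (\<kappa> / 2 / T)" using y01(1) by (subst pos_divide_le_eq)
      qed (use 2 in simp)
      also have "\<dots> = - (\<kappa> / 2 * (\<bar>s - r\<bar> / T)) + \<kappa> / 2 * (h / T)"
      proof -
        have "\<bar>s - r\<bar> = s - r" using 2 h by simp
        then show ?thesis using T by (simp add: field_simps)
      qed
      finally have "G s - G (r + h) \<le> - (\<kappa> / 2 * (\<bar>s - r\<bar> / T)) + \<kappa> / 2 * m" unfolding hT .
      moreover have "G (r + h) - G r \<le> \<kappa> * m" using h by (intro right) auto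
      moreover have "\<kappa> * m \<ge> 0" using \<kappa>0 m_pos by simp
      ultimately show ?thesis by argo
    next
      case 3
      have "- G (r - h) - (- G s) \<le> (- (\<kappa> / T)) * (r - h - s)"
      proof (rule deriv_le_imp_diff_le[where f' = "\<lambda>x. - ((n - q x) / x)"])
        fix y assume y: "s \<le> y" "y \<le> r - h"
        have y01: "0 < y" "y < 1" using y s r h by auto
        show "((\<lambda>x. - G x) has_real_derivative - ((n - q y) / y)) (at y)"
          using y01 by (intro DERIV_minus G') auto
        have "q y \<le> q (r - h)" using y y01 rh r h by (intro q_mono) auto
        then have le: "\<kappa> / T \<le> n - q y" using n(1) inc(2) by linarith
        have "\<kappa> / T * y \<le> \<kappa> / T * 1"
          by (rule mult_left_mono) (use y01 \<kappa>0 T in auto)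
        then have "\<kappa> / T * y \<le> n - q y" using le by linarith
        then have "\<kappa> / T \<le> (n - q y) / y" using y01(1) by (subst pos_le_divide_eq)
        then show "- ((n - q y) / y) \<le> - (\<kappa> / T)" by simp
      qed (use 3 in simp)
      also have "\<dots> = - (\<kappa> * (\<bar>s - r\<bar> / T)) + \<kappa> * (h / T)"
      proof -
        have "\<bar>s - r\<bar> = r - s" using 3 h by simp
        then show ?thesis using T by (simp add: field_simps)
      qed
      finally have "G s - G (r - h) \<le> - (\<kappa> * (\<bar>s - r\<bar> / T)) + \<kappa> * m" unfolding hT by simp
      moreover have "G (r - h) \<le> G r" using rh h by (intro left) auto
      moreover have "\<kappa> * (\<bar>s - r\<bar> / T) \<ge> 0" using \<kappa>0 T by simp
      moreover have "\<kappa> * m \<ge> 0" using \<kappa>0 m_pos by simp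
      ultimately show ?thesis by argo
    qed
  qed
  then show ?thesis by (simp add: G_def T_def)
qed

text \<open>Laplace's method: \<open>exponent_decay\<close> shows that
  \<open>|z ^ n|^2 * \<omega>\<close> is at most a constant times its value at radius
  \<open>r\<close>, with exponential decay at scale \<open>\<tau> r\<close>. Integrating the decay
  produces the factor \<open>\<tau> r\<close>.\<close>

lemma monomial_norm:
  "\<exists>C>0. \<exists>e>0. \<forall>r n. 1 / 2 \<le> r \<and> r < 1 \<and> n > 0 \<and> q r \<le> real n \<and> real n \<le> q r + e / profile \<tau> r \<longrightarrow>
     (A2_norm \<omega> (\<lambda>z. z ^ n))\<^sup>2 \<le> C * profile \<tau> r * (r\<^sup>2) ^ n * profile \<omega> r"
proof -
  define \<kappa> where "\<kappa> = m / (8 * B\<^sup>2)"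
  have \<kappa>0: "\<kappa> > 0" using m_pos B_pos by (simp add: \<kappa>_def)
  obtain C where C: "C > 0" and nn: "\<And>t x. t > 0 \<Longrightarrow> 0 \<le> x \<Longrightarrow> x \<le> 1 \<Longrightarrow>
    (\<integral>\<^sup>+z. ennreal (exp (- \<kappa> * (\<bar>norm z - x\<bar> / t))) \<partial>dA) \<le> ennreal (C * t)"
    using nn_integral_radial_exp[OF \<kappa>0] by blast
  \<comment> \<open>Squaring the modulus doubles both the slack \<open>2 * \<kappa> * m\<close> and
    the rate \<open>\<kappa> / 2\<close> of \<open>exponent_decay\<close>.\<close>
  define D where "D = exp (4 * \<kappa> * m)"
  show ?thesis
  proof (rule exI[of _ "D * C"], intro conjI, simp add: D_def C, rule exI[of _ "\<kappa> / 2"], intro conjI allI impI)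
    show "\<kappa> / 2 > 0" using \<kappa>0 by simp
    fix r n assume "1 / 2 \<le> r \<and> r < 1 \<and> n > 0 \<and> q r \<le> real n \<and> real n \<le> q r + \<kappa> / 2 / profile \<tau> r"
    then have r: "1 / 2 \<le> r" "r < 1" and n0: "n > 0" and n: "q r \<le> real n" "real n \<le> q r + \<kappa> / 2 / profile \<tau> r"
      by auto
    define T where "T = profile \<tau> r"
    have T: "T > 0" using r unfolding T_def by (intro \<tau>_pos) simp
    define W where "W = D * ((r\<^sup>2) ^ n * profile \<omega> r)"
    have W: "W \<ge> 0" using r \<omega>_pos[of "of_real r"] by (auto simp: W_def D_def)
    have exp_eq: "(s\<^sup>2) ^ n * profile \<omega> s = exp (2 * (real n * ln s - p s))" if "0 < s" "s < 1" for s
    proof -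
      have "(s\<^sup>2) ^ n = exp (ln s) ^ (2 * n)" using that by (simp add: power_mult)
      also have "\<dots> = exp (real (2 * n) * ln s)" by (rule exp_of_nat_mult[symmetric])
      finally show ?thesis using that by (simp add: \<omega>_eq p_def algebra_simps flip: exp_add)
    qed
    have pt: "(norm (z ^ n))\<^sup>2 * \<omega> z \<le> W * exp (- \<kappa> * (\<bar>norm z - r\<bar> / T))" if z: "z \<in> disk" for z
    \<comment> \<open>Here \<open>n > 0\<close> enters: the estimate in \<open>ln s\<close> says
      nothing at the origin, where the monomial vanishes.\<close>
    proof (cases "z = 0")
      case True then show ?thesis using n0 W by (simp add: zero_power)
    next
      case False
      define s where "s = norm z"
      have s: "0 < s" "s < 1" using False z by (auto simp: s_def)
      have "(norm (z ^ n))\<^sup>2 * \<omega> z = (s\<^sup>2) ^ n * profile \<omega> s"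
        using radial_\<omega>[OF z] by (simp add: s_def norm_power mult.commute flip: power_mult)
      also have "\<dots> = exp (2 * (real n * ln s - p s))" by (rule exp_eq[OF s])
      also have "\<dots> \<le> exp (2 * (real n * ln r - p r + 2 * \<kappa> * m - \<kappa> / 2 * (\<bar>s - r\<bar> / profile \<tau> r)))"
        using exponent_decay[OF r s \<kappa>_def n] by simp
      also have "\<dots> = exp (4 * \<kappa> * m) * exp (2 * (real n * ln r - p r)) * exp (- \<kappa> * (\<bar>s - r\<bar> / T))"
        by (simp add: T_def algebra_simps flip: exp_add)
      also have "\<dots> = W * exp (- \<kappa> * (\<bar>s - r\<bar> / T))"
        using exp_eq[of r] r by (simp add: W_def D_def)
      finally show ?thesis by (simp add: s_def)
    qed
    have "ennreal ((A2_norm \<omega> (\<lambda>z. z ^ n))\<^sup>2) = (\<integral>\<^sup>+z. ennreal ((norm (z ^ n))\<^sup>2 * \<omega> z) \<partial>dA)"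
      by (rule nn_integral_A2[OF monomial_A2, symmetric])
    also have "\<dots> \<le> (\<integral>\<^sup>+z. ennreal W * ennreal (exp (- \<kappa> * (\<bar>norm z - r\<bar> / T))) \<partial>dA)"
      using pt W by (intro nn_integral_mono) (simp add: ennreal_leI flip: ennreal_mult')
    also have "\<dots> = ennreal W * (\<integral>\<^sup>+z. ennreal (exp (- \<kappa> * (\<bar>norm z - r\<bar> / T))) \<partial>dA)"
    proof (rule nn_integral_cmult)
      have "(\<lambda>z. exp (- \<kappa> * (\<bar>norm z - r\<bar> / T))) \<in> borel_measurable dA"
        using T by (intro continuous_on_borel_measurable_dA continuous_intros) auto
      then show "(\<lambda>z. ennreal (exp (- \<kappa> * (\<bar>norm z - r\<bar> / T)))) \<in> borel_measurable dA" by simp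
    qed
    also have "\<dots> \<le> ennreal W * ennreal (C * T)" using r T by (intro mult_left_mono nn) auto
    also have "\<dots> = ennreal (W * (C * T))" using W by (rule ennreal_mult'[symmetric])
    finally have "(A2_norm \<omega> (\<lambda>z. z ^ n))\<^sup>2 \<le> W * (C * T)"
      using W C T by (subst (asm) ennreal_le_iff) auto
    then show "(A2_norm \<omega> (\<lambda>z. z ^ n))\<^sup>2 \<le> D * C * profile \<tau> r * (r\<^sup>2) ^ n * profile \<omega> r"
      by (simp add: W_def T_def mult_ac)
  qed
qed

lemma A2_inner_sum_left:
  assumes "\<And>i. i \<in> I \<Longrightarrow> f i \<in> A2 \<omega>" "h \<in> A2 \<omega>"
  shows "A2_inner \<omega> (\<lambda>z. \<Sum>i\<in>I. f i z) h = (\<Sum>i\<in>I. A2_inner \<omega> (f i) h)"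
  using assms
proof (induction I rule: infinite_finite_induct)
  case (insert i I)
  have "A2_inner \<omega> (\<lambda>z. f i z + (\<Sum>i\<in>I. f i z)) h = A2_inner \<omega> (f i) h + A2_inner \<omega> (\<lambda>z. \<Sum>i\<in>I. f i z) h"
    using insert.prems by (intro A2_inner_add_left A2_sum) auto
  then show ?case using insert by simp
qed (auto simp: A2_inner_def)

text \<open>Evaluation at 1/2 is bounded by the norm and is nonzero on every monomial; evaluation at
  0 would only detect \<open>n = 0\<close>.\<close>

lemma monomial_norm_pos: "A2_norm \<omega> (\<lambda>z. z ^ n) > 0"
proof -
  have "norm ((1 / 2 :: complex) ^ n) \<le> A2_norm \<omega> (\<lambda>z. z ^ n) * A2_norm \<omega> (kernel \<omega> (1 / 2))"
    using kernel_extremal[OF _ monomial_A2, of "1 / 2" n] by simp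
  moreover have "norm ((1 / 2 :: complex) ^ n) > 0" by simp
  ultimately have "A2_norm \<omega> (\<lambda>z. z ^ n) \<noteq> 0" by (metis mult_zero_left not_le)
  then show ?thesis using A2_norm_nonneg[of "\<lambda>z. z ^ n"] by linarith
qed

text \<open>Bessel's inequality. \<open>f\<close> is the reproducing kernel at \<open>z\<close> of
  the span of the chosen monomials, so \<open>f z\<close> and the squared norm of \<open>f\<close>
  both equal the sum \<open>S\<close>; \<open>kernel_extremal\<close> then gives
  \<open>S \<le> sqrt S\<close> times the norm of the kernel.\<close>

lemma kernel_norm_ge_sum:
  assumes z: "z \<in> disk" and I: "finite I"
  shows "(\<Sum>n\<in>I. ((norm z)\<^sup>2) ^ n / (A2_norm \<omega> (\<lambda>z. z ^ n))\<^sup>2) \<le> (A2_norm \<omega> (kernel \<omega> z))\<^sup>2"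
proof -
  define M where "M n = (A2_norm \<omega> (\<lambda>z. z ^ n))\<^sup>2" for n
  have M: "M n > 0" for n using monomial_norm_pos[of n] by (simp add: M_def)
  define a where "a n = cnj z ^ n / of_real (M n)" for n
  define f where "f x = (\<Sum>n\<in>I. a n * x ^ n)" for x
  define S where "S = (\<Sum>n\<in>I. ((norm z)\<^sup>2) ^ n / M n)"
  have S: "S \<ge> 0" using M by (auto simp: S_def intro!: sum_nonneg divide_nonneg_pos)
  have aA: "(\<lambda>x. a n * x ^ n) \<in> A2 \<omega>" for n by (rule A2_scale[OF monomial_A2])
  have fA: "f \<in> A2 \<omega>" unfolding f_def[abs_def] by (rule A2_sum) (rule aA)
  have az: "a n * z ^ n = of_real (((norm z)\<^sup>2) ^ n / M n)" for n
  proof -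
    have "cnj z * z = of_real ((norm z)\<^sup>2)"
      using complex_norm_square[of z] by (simp add: mult.commute)
    then have "cnj z ^ n * z ^ n = of_real (((norm z)\<^sup>2) ^ n)"
      unfolding power_mult_distrib[symmetric] of_real_power by simp
    then show ?thesis by (simp add: a_def)
  qed
  have fz: "f z = of_real S" by (simp add: f_def S_def az)
  have e: "A2_inner \<omega> f (\<lambda>x. x ^ k) = a k * of_real (M k)" if "k \<in> I" for k
  proof -
    have "A2_inner \<omega> f (\<lambda>x. x ^ k) = (\<Sum>n\<in>I. a n * A2_inner \<omega> (\<lambda>x. x ^ n) (\<lambda>x. x ^ k))"
      unfolding f_def[abs_def] by (subst A2_inner_sum_left[OF aA monomial_A2]) (simp add: A2_inner_scale_left)
    also have "\<dots> = (\<Sum>n\<in>I. if n = k then a k * of_real (M k) else 0)"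
      by (rule sum.cong) (auto simp: monomial_orthogonal A2_inner_self M_def)
    also have "\<dots> = a k * of_real (M k)" using that I by simp
    finally show ?thesis .
  qed
  have "A2_inner \<omega> (\<lambda>x. \<Sum>k\<in>I. a k * x ^ k) f = (\<Sum>k\<in>I. a k * A2_inner \<omega> (\<lambda>x. x ^ k) f)"
    by (subst A2_inner_sum_left[OF aA fA]) (simp add: A2_inner_scale_left)
  then have "of_real ((A2_norm \<omega> f)\<^sup>2) = (\<Sum>k\<in>I. a k * A2_inner \<omega> (\<lambda>x. x ^ k) f)"
    unfolding A2_inner_self[symmetric] f_def[abs_def, symmetric] .
  also have "\<dots> = (\<Sum>k\<in>I. of_real (((norm z)\<^sup>2) ^ k / M k))"
  proof (rule sum.cong[OF refl])
    fix k assume k: "k \<in> I"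
    have "cnj (a k) * of_real (M k) = z ^ k" using M[of k] by (simp add: a_def)
    then show "a k * A2_inner \<omega> (\<lambda>x. x ^ k) f = of_real (((norm z)\<^sup>2) ^ k / M k)"
      using az[of k] by (simp add: A2_inner_commute[of "\<lambda>x. x ^ k" f] e[OF k])
  qed
  also have "\<dots> = of_real S" by (simp add: S_def)
  finally have fn: "(A2_norm \<omega> f)\<^sup>2 = S" using of_real_eq_iff by blast
  have "S \<le> A2_norm \<omega> f * A2_norm \<omega> (kernel \<omega> z)"
    using kernel_extremal[OF z fA] S by (simp add: fz)
  then have "S * S \<le> (A2_norm \<omega> f * A2_norm \<omega> (kernel \<omega> z)) * (A2_norm \<omega> f * A2_norm \<omega> (kernel \<omega> z))"
    using S by (intro mult_mono) auto
  also have "\<dots> = S * (A2_norm \<omega> (kernel \<omega> z))\<^sup>2" using fn by (simp add: power2_eq_square mult_ac)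
  finally have "S \<le> (A2_norm \<omega> (kernel \<omega> z))\<^sup>2"
    using S by (cases "S = 0") auto
  then show ?thesis by (simp add: S_def M_def)
qed

lemma kernel_norm_lower:
  "\<exists>c>0. \<forall>z\<in>disk. c \<le> (A2_norm \<omega> (kernel \<omega> z))\<^sup>2 * \<omega> z * (\<tau> z)\<^sup>2"
proof -
  obtain C e where C: "C > 0" and e: "e > 0" and mono: "\<And>r n. \<lbrakk>1 / 2 \<le> r; r < 1; n > 0; q r \<le> real n;
     real n \<le> q r + e / profile \<tau> r\<rbrakk> \<Longrightarrow>
     (A2_norm \<omega> (\<lambda>z. z ^ n))\<^sup>2 \<le> C * profile \<tau> r * (r\<^sup>2) ^ n * profile \<omega> r"
    using monomial_norm by blast
  have "\<forall>\<^sub>F r in at_left 1. profile \<tau> r < e" using order_tendstoD(2)[OF \<tau>_lim e] .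
  then obtain b where b: "b < 1" "\<And>r. b < r \<Longrightarrow> r < 1 \<Longrightarrow> profile \<tau> r < e"
    unfolding eventually_at_left[OF zero_less_one] by blast
  \<comment> \<open>Beyond \<open>R\<close> one has \<open>\<tau> < e\<close>, so at least one
    exponent fits into an interval of length \<open>e / \<tau>\<close>. Up to \<open>R\<close> the
    constant function alone gives the bound, as \<open>\<omega>\<close> and \<open>\<tau>\<close>
    are bounded below there.\<close>
  define R where "R = (max (1 / 2) b + 1) / 2"
  have R: "1 / 2 \<le> R" "R < 1" "b < R" using b(1) by (auto simp: R_def max_def)
  define M where "M = (A2_norm \<omega> (\<lambda>z. z ^ 0))\<^sup>2"
  have M: "M > 0" using monomial_norm_pos[of 0] unfolding M_def by (rule zero_less_power)
  define c0 where "c0 = profile \<omega> R * (profile \<tau> R)\<^sup>2 / M"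
  have Rd: "complex_of_real R \<in> disk" using R by simp
  have c0: "c0 > 0" using \<omega>_pos[OF Rd] \<tau>_pos[OF Rd] M by (simp add: c0_def)
  show ?thesis
  proof (intro exI[of _ "min c0 (e / (2 * C))"] conjI ballI)
    show "min c0 (e / (2 * C)) > 0" using c0 e C by simp
    fix z assume z: "z \<in> disk"
    define r where "r = norm z"
    define N2 where "N2 = (A2_norm \<omega> (kernel \<omega> z))\<^sup>2"
    define T where "T = \<tau> z"
    have T: "T > 0" "T = profile \<tau> r" using \<tau>_pos[OF z] radial_\<tau>[OF z] by (auto simp: T_def r_def)
    have w: "\<omega> z > 0" "\<omega> z = profile \<omega> r" using \<omega>_pos[OF z] radial_\<omega>[OF z] by (auto simp: r_def)
    have "min c0 (e / (2 * C)) \<le> N2 * \<omega> z * T\<^sup>2"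
    proof (cases "r \<le> R")
      case True
      have "1 / M \<le> N2" using kernel_norm_ge_sum[OF z, of "{0}"] by (simp add: N2_def M_def)
      moreover have "profile \<omega> R * (profile \<tau> R)\<^sup>2 \<le> \<omega> z * T\<^sup>2"
        unfolding T_def using True R z Rd \<omega>_pos[OF z] \<tau>_pos[OF Rd]
        by (intro mult_mono power_mono \<omega>_mono \<tau>_mono) (auto simp: r_def)
      ultimately have "1 / M * (profile \<omega> R * (profile \<tau> R)\<^sup>2) \<le> N2 * (\<omega> z * T\<^sup>2)"
        by (rule mult_mono) (use \<omega>_pos[OF Rd] in \<open>auto simp: N2_def\<close>)
      then show ?thesis by (simp add: c0_def mult.assoc)
    next
      case False
      have r: "1 / 2 \<le> r" "r < 1" "b < r" using False R z by (auto simp: r_def)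
      have Te: "T < e" using b(2)[of r] r T by simp
      \<comment> \<open>The exponents from \<open>k\<close> to \<open>k + N - 1\<close> each
        contribute at least \<open>1 / (C * T * \<omega> z)\<close>. As
        \<open>e / T \<ge> 1\<close>, rounding down keeps at least half of it, so the total is at
        least \<open>e / (2 * C * \<omega> z * T^2)\<close>.\<close>
      define N where "N = nat \<lfloor>e / T\<rfloor>"
      have eT: "e / T \<ge> 1" using Te T by simp
      have N: "real N \<le> e / T" "e / (2 * T) \<le> real N"
      proof -
        have "real N = of_int \<lfloor>e / T\<rfloor>" using eT by (simp add: N_def)
        moreover have "of_int \<lfloor>e / T\<rfloor> \<le> e / T" "e / T < of_int \<lfloor>e / T\<rfloor> + 1" by linarith+
        moreover have "of_int \<lfloor>e / T\<rfloor> \<ge> (1::real)" using eT by simp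
        moreover have "e / (2 * T) = e / T / 2" by simp
        ultimately show "real N \<le> e / T" "e / (2 * T) \<le> real N" by argo+
      qed
      \<comment> \<open>Positive, as \<open>monomial_norm\<close> requires, and above
        \<open>q r\<close> by at most 1. The half-open range gives this 1 back:
        \<open>n \<le> k + N - 1 \<le> q r + e / T\<close>.\<close>
      define k where "k = nat \<lfloor>q r\<rfloor> + 1"
      have q0: "q r \<ge> 0" using r by (intro q_nonneg) auto
      have k: "q r \<le> real k" "real k \<le> q r + 1" "k > 0"
      proof -
        have "real k = of_int \<lfloor>q r\<rfloor> + 1" using q0 by (simp add: k_def)
        moreover have "of_int \<lfloor>q r\<rfloor> \<le> q r" "q r < of_int \<lfloor>q r\<rfloor> + 1" by linarith+
        ultimately show "q r \<le> real k" "real k \<le> q r + 1" by argo+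
        show "k > 0" by (simp add: k_def)
      qed
      have term_ge: "1 / (C * T * \<omega> z) \<le> (r\<^sup>2) ^ n / (A2_norm \<omega> (\<lambda>z. z ^ n))\<^sup>2" if n: "n \<in> {k..<k + N}" for n
      proof -
        have "real n + 1 \<le> real k + real N" using n by simp
        then have "(A2_norm \<omega> (\<lambda>z. z ^ n))\<^sup>2 \<le> C * profile \<tau> r * (r\<^sup>2) ^ n * profile \<omega> r"
          using n k N T by (intro mono r) auto
        then have "(A2_norm \<omega> (\<lambda>z. z ^ n))\<^sup>2 \<le> (C * T * \<omega> z) * (r\<^sup>2) ^ n" by (simp add: T w mult_ac)
        then show ?thesis
          using C T(1) w(1) monomial_norm_pos[of n] by (simp add: field_simps)
      qed
      have "e / (2 * T) * (1 / (C * T * \<omega> z)) \<le> real N * (1 / (C * T * \<omega> z))"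
        using N C T(1) w(1) by (intro mult_right_mono) auto
      also have "\<dots> = (\<Sum>n\<in>{k..<k + N}. 1 / (C * T * \<omega> z))" by simp
      also have "\<dots> \<le> (\<Sum>n\<in>{k..<k + N}. (r\<^sup>2) ^ n / (A2_norm \<omega> (\<lambda>z. z ^ n))\<^sup>2)"
        by (rule sum_mono) (rule term_ge)
      also have "\<dots> \<le> N2" unfolding N2_def r_def by (rule kernel_norm_ge_sum[OF z]) simp
      finally have "e / (2 * T) * (1 / (C * T * \<omega> z)) * (\<omega> z * T\<^sup>2) \<le> N2 * (\<omega> z * T\<^sup>2)"
        using T(1) w(1) by (intro mult_right_mono) auto
      then have "e / (2 * C) \<le> N2 * \<omega> z * T\<^sup>2"
        using T(1) w(1) C by (simp add: power2_eq_square mult.assoc)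
      then show ?thesis by simp
    qed
    then show "min c0 (e / (2 * C)) \<le> (A2_norm \<omega> (kernel \<omega> z))\<^sup>2 * \<omega> z * (\<tau> z)\<^sup>2"
      by (simp add: N2_def T_def)
  qed
qed

end

section \<open>Kernel near the diagonal and Carleson embedding\<close>

lemma finite_borel_disk_space: "finite_borel_disk \<mu> \<Longrightarrow> space \<mu> = disk"
  unfolding finite_borel_disk_def by (metis Int_UNIV_right sets_eq_imp_space_eq space_borel space_restrict_space)

lemma finite_borel_disk_sets:
  assumes "finite_borel_disk \<mu>" shows "X \<in> sets \<mu> \<longleftrightarrow> X \<in> sets borel \<and> X \<subseteq> disk"
  using assms sets_dA_iff[of X] unfolding sets_dA by (simp add: finite_borel_disk_def)

lemma finite_borel_disk_measurable:
  fixes f :: "complex \<Rightarrow> 'a::topological_space"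
  assumes "finite_borel_disk \<mu>" "continuous_on disk f"
  shows "f \<in> borel_measurable \<mu>"
proof -
  have "sets \<mu> = sets (restrict_space borel disk)"
    using assms(1) by (simp add: finite_borel_disk_def)
  then show ?thesis
    using borel_measurable_continuous_on_restrict[OF assms(2)] measurable_cong_sets[OF _ refl] by blast
qed

context large_weight begin

text \<open>Multiplying the kernel \<open>K\<^sub>z\<close> by the local frame gives a function bounded by a multiple of its
  value at \<open>z\<close>; Cauchy's estimate for the derivative keeps it away from 0 near \<open>z\<close>.\<close>

lemma kernel_near_diagonal:
  "\<exists>d>0. d \<le> m \<and> (\<exists>c>0. \<forall>z\<in>disk. \<forall>x. norm (x - z) < d * \<tau> z \<longrightarrow>
     c * (A2_norm \<omega> (kernel \<omega> z))\<^sup>2 \<le> (norm (kernel \<omega> z x))\<^sup>2 * \<omega> x * (\<tau> z)\<^sup>2)"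
proof -
  obtain C where C: "C \<ge> 1" and frame: "\<And>a. a \<in> disk \<Longrightarrow> \<exists>E. E holomorphic_on ball a (m * \<tau> a) \<and> E a = 1 \<and>
     (\<forall>z\<in>ball a (m * \<tau> a). \<omega> z \<le> C * ((norm (E z))\<^sup>2 * \<omega> a) \<and> (norm (E z))\<^sup>2 * \<omega> a \<le> C * \<omega> z)"
    using local_frame by blast
  obtain P where P: "P > 0" and pe: "\<And>z f. \<lbrakk>z \<in> disk; f \<in> A2 \<omega>\<rbrakk> \<Longrightarrow>
      (norm (f z))\<^sup>2 * \<omega> z * (\<tau> z)\<^sup>2 \<le> P * (A2_norm \<omega> f)\<^sup>2"
    using point_evaluation by blast
  obtain c0 where c0: "c0 > 0" and lower: "\<And>z. z \<in> disk \<Longrightarrow>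
      c0 \<le> (A2_norm \<omega> (kernel \<omega> z))\<^sup>2 * \<omega> z * (\<tau> z)\<^sup>2"
    using kernel_norm_lower by blast
  \<comment> \<open>The ratio between the supremum bound for \<open>g = K_z * E\<close> and its
    central value \<open>N\<close>: point evaluation bounds \<open>|g|^2\<close> by
    \<open>2 * C * P * N / (\<omega> z * T^2)\<close>, and \<open>kernel_norm_lower\<close> replaces
    \<open>1 / (\<omega> z * T^2)\<close> by \<open>N / c0\<close>.\<close>
  define H where "H = sqrt (2 * C * P / c0)"
  have H: "H > 0" using C P c0 by (simp add: H_def)
  \<comment> \<open>With \<open>|g'| \<le> 4 * H * N / \<rho>\<close> on the half disk, the second
    entry limits the variation of \<open>g\<close> to \<open>N / 2\<close>; the first keeps
    \<open>x\<close> in the half disk.\<close>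
  define d where "d = min (m / 2) (m / (8 * H))"
  have d: "d > 0" "d \<le> m" "4 * H * d / m \<le> 1 / 2" "d \<le> m / 2"
  proof -
    show "d > 0" "d \<le> m / 2" "d \<le> m" using m_pos H by (auto simp: d_def min_def)
    have "d \<le> m / (8 * H)" by (simp add: d_def)
    then show "4 * H * d / m \<le> 1 / 2" using m_pos H by (simp add: field_simps)
  qed
  show ?thesis
  proof (rule exI[of _ d], intro conjI d, rule exI[of _ "c0 / (4 * C)"], intro conjI ballI allI impI)
    show "c0 / (4 * C) > 0" using c0 C by simp
    fix z x assume z: "z \<in> disk" and x: "norm (x - z) < d * \<tau> z"
    define T where "T = \<tau> z"
    have T: "T > 0" using \<tau>_pos[OF z] by (simp add: T_def)
    have w: "\<omega> z > 0" by (rule \<omega>_pos[OF z])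
    define N where "N = (A2_norm \<omega> (kernel \<omega> z))\<^sup>2"
    have lowerN: "c0 \<le> N * \<omega> z * T\<^sup>2" using lower[OF z] by (simp add: N_def T_def)
    have N: "N > 0"
    proof -
      have "N \<noteq> 0" using lowerN c0 by auto
      moreover have "N \<ge> 0" by (simp add: N_def)
      ultimately show ?thesis by simp
    qed
    define \<rho> where "\<rho> = m * T"
    have \<rho>: "\<rho> > 0" using m_pos T by (simp add: \<rho>_def)
    obtain E where E: "E holomorphic_on ball z \<rho>" "E z = 1"
      "\<And>y. y \<in> ball z \<rho> \<Longrightarrow> (norm (E y))\<^sup>2 * \<omega> z \<le> C * \<omega> y"
      using frame[OF z] unfolding \<rho>_def T_def by blast
    define g where "g y = kernel \<omega> z y * E y" for y
    have sub: "ball z \<rho> \<subseteq> disk" using ball_subset[OF z] by (simp add: \<rho>_def T_def)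
    have g: "g holomorphic_on ball z \<rho>"
      unfolding g_def
      by (intro holomorphic_on_mult E holomorphic_on_subset[OF A2_holomorphic[OF kernel(1)[OF z]] sub])
    have gz: "g z = of_real N" using kernel_diag[OF z] by (simp add: g_def E N_def)
    have g_le: "(norm (g y))\<^sup>2 * \<omega> z \<le> C * ((norm (kernel \<omega> z y))\<^sup>2 * \<omega> y)" if y: "y \<in> ball z \<rho>" for y
      using mult_left_mono[OF E(3)[OF y], of "(norm (kernel \<omega> z y))\<^sup>2"]
      by (simp add: g_def norm_mult power_mult_distrib mult_ac)
    have g_bound: "norm (g y) \<le> H * N" if y: "y \<in> ball z \<rho>" for y
    proof -
      have yd: "y \<in> disk" using y sub by blast
      have "norm (y - z) \<le> m * \<tau> z" using y by (simp add: \<rho>_def T_def dist_norm norm_minus_commute)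
      from near(3)[OF z this] have "3 / 4 * T \<le> \<tau> y" unfolding T_def abs_le_iff by linarith
      then have "(3 / 4 * T)\<^sup>2 \<le> (\<tau> y)\<^sup>2" using T by (intro power_mono) auto
      moreover have "T\<^sup>2 \<le> 2 * (3 / 4 * T)\<^sup>2" by (simp add: power2_eq_square)
      ultimately have T2: "T\<^sup>2 \<le> 2 * (\<tau> y)\<^sup>2" by linarith
      have "(norm (g y))\<^sup>2 * \<omega> z * T\<^sup>2 \<le> C * ((norm (kernel \<omega> z y))\<^sup>2 * \<omega> y) * (2 * (\<tau> y)\<^sup>2)"
        by (rule mult_mono) (use g_le[OF y] T2 w C \<omega>_pos[OF yd] in \<open>auto simp: mult.assoc\<close>)
      also have "\<dots> = 2 * C * ((norm (kernel \<omega> z y))\<^sup>2 * \<omega> y * (\<tau> y)\<^sup>2)" by simp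
      also have "\<dots> \<le> 2 * C * (P * N)"
        using pe[OF yd kernel(1)[OF z]] C by (intro mult_left_mono) (auto simp: N_def)
      finally have 1: "(norm (g y))\<^sup>2 * (\<omega> z * T\<^sup>2) \<le> 2 * C * P * N" by (simp add: mult_ac)
      have "(norm (g y))\<^sup>2 * c0 \<le> (norm (g y))\<^sup>2 * (N * \<omega> z * T\<^sup>2)"
        using lowerN by (intro mult_left_mono) auto
      also have "\<dots> = N * ((norm (g y))\<^sup>2 * (\<omega> z * T\<^sup>2))" by (simp add: mult_ac)
      also have "\<dots> \<le> N * (2 * C * P * N)" using 1 N by (intro mult_left_mono) auto
      finally have "(norm (g y))\<^sup>2 \<le> 2 * C * P / c0 * N\<^sup>2"
        using c0 by (simp add: field_simps power2_eq_square)
      then have "norm (g y) \<le> sqrt (2 * C * P / c0 * N\<^sup>2)" by (rule real_le_rsqrt)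
      also have "\<dots> = H * N" unfolding H_def real_sqrt_mult real_sqrt_abs using N by simp
      finally show ?thesis .
    qed
    \<comment> \<open>Around a point of the half disk a circle of radius \<open>\<rho> / 4\<close>
      still fits inside \<open>ball z \<rho>\<close>.\<close>
    have deriv_bound: "norm (deriv g y) \<le> 4 * (H * N) / \<rho>" if y: "y \<in> ball z (\<rho> / 2)" for y
    proof -
      have sub': "cball y (\<rho> / 4) \<subseteq> ball z \<rho>"
      proof
        fix u assume "u \<in> cball y (\<rho> / 4)"
        then have "dist z u < \<rho> / 2 + \<rho> / 4"
          using y dist_triangle[of z u y] by (simp add: dist_commute)
        then show "u \<in> ball z \<rho>" using \<rho> by simp
      qed
      have "norm ((deriv ^^ 1) g y) \<le> fact 1 * (H * N) / (\<rho> / 4) ^ 1"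
      proof (rule Cauchy_inequality)
        show "g holomorphic_on ball y (\<rho> / 4)"
          using holomorphic_on_subset[OF g] sub' ball_subset_cball by blast
        show "continuous_on (cball y (\<rho> / 4)) g"
          using holomorphic_on_imp_continuous_on[OF holomorphic_on_subset[OF g sub']] .
        show "norm (g u) \<le> H * N" if "norm (y - u) = \<rho> / 4" for u
          using that sub' by (intro g_bound) (auto simp: dist_norm subset_eq)
      qed (use \<rho> in simp)
      then show ?thesis by (simp add: mult_ac)
    qed
    have xz: "norm (x - z) < \<rho> / 2"
    proof -
      have "d * \<tau> z \<le> m / 2 * \<tau> z" using d(4) T by (intro mult_right_mono) (auto simp: T_def)
      then show ?thesis using x by (simp add: \<rho>_def T_def)
    qed
    have "norm (g x - g z) \<le> 4 * (H * N) / \<rho> * norm (x - z)"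
    proof (rule field_differentiable_bound[of "ball z (\<rho> / 2)" g "deriv g"])
      show "(g has_field_derivative deriv g y) (at y within ball z (\<rho> / 2))" if "y \<in> ball z (\<rho> / 2)" for y
      proof -
        have "y \<in> ball z \<rho>" using that \<rho> by simp
        then show ?thesis
          using holomorphic_derivI[OF g open_ball] by (blast intro: has_field_derivative_at_within)
      qed
    qed (use deriv_bound xz \<rho> in \<open>auto simp: dist_norm norm_minus_commute\<close>)
    also have "\<dots> \<le> 4 * (H * N) / \<rho> * (d * T)"
      using x H N \<rho> by (intro mult_left_mono) (auto simp: T_def)
    also have "\<dots> = (4 * H * d / m) * N" using T m_pos by (simp add: \<rho>_def)
    also have "\<dots> \<le> 1 / 2 * N" using d(3) N by (intro mult_right_mono) auto
    finally have "norm (g x - g z) \<le> N / 2" by simp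
    moreover have "N \<le> norm (g x) + norm (g x - g z)"
      using norm_triangle_ineq[of "g x" "g z - g x"] N by (simp add: gz norm_minus_commute)
    ultimately have gx: "N / 2 \<le> norm (g x)" by linarith
    have "x \<in> ball z \<rho>" using xz \<rho> by (simp add: dist_norm norm_minus_commute)
    from g_le[OF this] have 2: "(norm (g x))\<^sup>2 * \<omega> z \<le> C * ((norm (kernel \<omega> z x))\<^sup>2 * \<omega> x)" .
    have "c0 * N \<le> (N * \<omega> z * T\<^sup>2) * N" using lowerN N by (intro mult_right_mono) auto
    also have "\<dots> = 4 * ((N / 2)\<^sup>2 * \<omega> z) * T\<^sup>2" by (simp add: power2_eq_square)
    also have "\<dots> \<le> 4 * ((norm (g x))\<^sup>2 * \<omega> z) * T\<^sup>2"
      using gx N w by (intro mult_right_mono mult_left_mono power_mono) auto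
    also have "\<dots> \<le> 4 * (C * ((norm (kernel \<omega> z x))\<^sup>2 * \<omega> x)) * T\<^sup>2"
      using 2 by (intro mult_right_mono mult_left_mono) auto
    finally show "c0 / (4 * C) * (A2_norm \<omega> (kernel \<omega> z))\<^sup>2 \<le> (norm (kernel \<omega> z x))\<^sup>2 * \<omega> x * (\<tau> z)\<^sup>2"
      using C by (simp add: N_def T_def field_simps)
  qed
qed

lemma averaging_nonneg: "averaging \<tau> \<mu> \<delta> z \<ge> 0"
  by (simp add: averaging_def)

text \<open>The hypothesis on the averages is only imposed at the points whose disks meet \<open>S\<close>, so that
  the estimate also covers the part of \<open>\<mu>\<close> close to the boundary.\<close>

lemma Carleson_embedding:
  assumes \<delta>: "0 < \<delta>" "\<delta> \<le> m"
  shows "\<exists>C>0. \<forall>\<mu> S M f. finite_borel_disk \<mu> \<and> S \<in> sets \<mu> \<and> M \<ge> 0 \<and>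
     (\<forall>w\<in>disk. \<forall>z\<in>S. norm (z - w) < \<delta> * \<tau> w \<longrightarrow> averaging \<tau> \<mu> \<delta> w \<le> M) \<and> f \<in> A2 \<omega> \<longrightarrow>
     (\<integral>\<^sup>+z. ennreal ((norm (f z))\<^sup>2 * \<omega> z) * indicator S z \<partial>\<mu>) \<le> ennreal (C * M * (A2_norm \<omega> f)\<^sup>2)"
proof -
  obtain C where C: "C > 0" and smv: "\<And>a \<rho> f. \<lbrakk>a \<in> disk; 0 < \<rho>; \<rho> \<le> m * \<tau> a; f holomorphic_on disk\<rbrakk> \<Longrightarrow>
     ennreal ((norm (f a))\<^sup>2 * \<omega> a * \<rho>\<^sup>2)
       \<le> ennreal C * (\<integral>\<^sup>+z. ennreal ((norm (f z))\<^sup>2 * \<omega> z) * indicator (ball a \<rho>) z \<partial>dA)"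
    using sub_mean_value by blast
  \<comment> \<open>Halving leaves room to change the centre: \<open>|z - w| < e * \<tau> z\<close>
    implies \<open>|z - w| < \<delta> * \<tau> w\<close>, as
    \<open>\<tau> z \<le> 2 * \<tau> w\<close>.\<close>
  define e where "e = \<delta> / 2"
  have e: "0 < e" "e \<le> m" using \<delta> by (auto simp: e_def)
  \<comment> \<open>The 2 covers \<open>(5/4)^2\<close>, the cost of replacing
    \<open>\<tau> z\<close> by \<open>\<tau> w\<close>.\<close>
  define C2 where "C2 = 2 * C / e\<^sup>2"
  have C2: "C2 > 0" using C e by (simp add: C2_def)
  show ?thesis
  proof (intro exI[of _ C2] conjI C2 allI impI)
    fix \<mu> S M f
    assume asm: "finite_borel_disk \<mu> \<and> S \<in> sets \<mu> \<and> M \<ge> 0 \<and>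
     (\<forall>w\<in>disk. \<forall>z\<in>S. norm (z - w) < \<delta> * \<tau> w \<longrightarrow> averaging \<tau> \<mu> \<delta> w \<le> M) \<and> f \<in> A2 \<omega>"
    then have \<mu>: "finite_borel_disk \<mu>" and S[measurable]: "S \<in> sets \<mu>" and M: "M \<ge> 0" and f: "f \<in> A2 \<omega>"
      and avg: "\<And>w z. \<lbrakk>w \<in> disk; z \<in> S; norm (z - w) < \<delta> * \<tau> w\<rbrakk> \<Longrightarrow> averaging \<tau> \<mu> \<delta> w \<le> M"
      by auto
    interpret \<mu>: finite_measure \<mu> using \<mu> by (simp add: finite_borel_disk_def)
    interpret dA: finite_measure dA by (rule finite_measure_dA)
    interpret pair_sigma_finite dA \<mu> ..
    have sp: "space \<mu> = disk" by (rule finite_borel_disk_space[OF \<mu>])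
    define F where "F w = ennreal ((norm (f w))\<^sup>2 * \<omega> w)" for w
    have F[measurable]: "F \<in> borel_measurable dA"
      unfolding F_def using norm_squared_measurable[OF A2_continuous[OF f]] by simp
    have [measurable]: "\<tau> \<in> borel_measurable \<mu>" "(\<lambda>z. z) \<in> borel_measurable \<mu>" "(\<lambda>z. z) \<in> borel_measurable dA"
      by (auto intro!: finite_borel_disk_measurable[OF \<mu>] continuous_on_borel_measurable_dA
          continuous_\<tau> continuous_on_id)
    \<comment> \<open>The submean value inequality at \<open>z\<close> bounds \<open>F z\<close> by
      the integral of \<open>F\<close> against \<open>k _ z\<close>. After Fubini the remaining
      \<open>\<mu>\<close>-integral of \<open>k w\<close> is at most a multiple of the average at
      \<open>w\<close>.\<close>
    define k where "k w z = ennreal (C / (e * \<tau> z)\<^sup>2) * (indicator S z * indicator {p. norm (snd p - fst p) < e * \<tau> (snd p)} (w, z))"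
      for w z
    have k_meas: "(\<lambda>(w, z). F w * k w z) \<in> borel_measurable (dA \<Otimes>\<^sub>M \<mu>)"
    proof -
      have "(\<lambda>p. norm (snd p - fst p)) \<in> borel_measurable (dA \<Otimes>\<^sub>M \<mu>)"
        "(\<lambda>p. e * \<tau> (snd p)) \<in> borel_measurable (dA \<Otimes>\<^sub>M \<mu>)"
        by measurable
      then have "{p \<in> space (dA \<Otimes>\<^sub>M \<mu>). norm (snd p - fst p) < e * \<tau> (snd p)} \<in> sets (dA \<Otimes>\<^sub>M \<mu>)"
        by (rule borel_measurable_less)
      then have [measurable]: "(indicator {p. norm (snd p - fst p) < e * \<tau> (snd p)} :: _ \<Rightarrow> ennreal) \<in> borel_measurable (dA \<Otimes>\<^sub>M \<mu>)"
        by (subst borel_measurable_indicator_iff) (simp add: Int_def conj_commute)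
      have "(\<lambda>p. F (fst p) * (ennreal (C / (e * \<tau> (snd p))\<^sup>2) * (indicator S (snd p) *
          indicator {p. norm (snd p - fst p) < e * \<tau> (snd p)} p))) \<in> borel_measurable (dA \<Otimes>\<^sub>M \<mu>)"
        by measurable
      then show ?thesis by (simp add: k_def case_prod_beta)
    qed
    have "(\<integral>\<^sup>+z. F z * indicator S z \<partial>\<mu>) \<le> (\<integral>\<^sup>+z. \<integral>\<^sup>+w. F w * k w z \<partial>dA \<partial>\<mu>)"
    proof (rule nn_integral_mono)
      fix z assume "z \<in> space \<mu>"
      then have z: "z \<in> disk" by (simp add: sp)
      have T: "\<tau> z > 0" by (rule \<tau>_pos[OF z])
      have meas: "(\<lambda>w. F w * indicator (ball z (e * \<tau> z)) w) \<in> borel_measurable dA"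
        using ball_subset[OF z, of "e * \<tau> z"] e T
        by (intro borel_measurable_times_ennreal F borel_measurable_indicator) (auto simp: sets_dA_iff)
      show "F z * indicator S z \<le> (\<integral>\<^sup>+w. F w * k w z \<partial>dA)"
      proof (cases "z \<in> S")
        case True
        have "F z = ennreal (1 / (e * \<tau> z)\<^sup>2) * ennreal ((norm (f z))\<^sup>2 * \<omega> z * (e * \<tau> z)\<^sup>2)"
          using e T by (simp add: F_def flip: ennreal_mult')
        also have "\<dots> \<le> ennreal (1 / (e * \<tau> z)\<^sup>2) * (ennreal C * (\<integral>\<^sup>+w. F w * indicator (ball z (e * \<tau> z)) w \<partial>dA))"
          unfolding F_def using e T z f
          by (intro mult_left_mono smv) (auto simp: A2_holomorphic)
        also have "\<dots> = ennreal (C / (e * \<tau> z)\<^sup>2) * (\<integral>\<^sup>+w. F w * indicator (ball z (e * \<tau> z)) w \<partial>dA)"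
          using C e T by (simp add: mult.assoc[symmetric] flip: ennreal_mult')
        also have "\<dots> = (\<integral>\<^sup>+w. ennreal (C / (e * \<tau> z)\<^sup>2) * (F w * indicator (ball z (e * \<tau> z)) w) \<partial>dA)"
          by (rule nn_integral_cmult[OF meas, symmetric])
        also have "\<dots> = (\<integral>\<^sup>+w. F w * k w z \<partial>dA)"
          using True by (intro nn_integral_cong) (auto simp: k_def indicator_def dist_norm mult_ac)
        finally show ?thesis using True by simp
      qed simp
    qed
    also have "\<dots> = (\<integral>\<^sup>+w. \<integral>\<^sup>+z. F w * k w z \<partial>\<mu> \<partial>dA)"
      using Fubini'[OF k_meas] by simp
    also have "\<dots> \<le> (\<integral>\<^sup>+w. F w * ennreal (C2 * M) \<partial>dA)"
    proof (rule nn_integral_mono)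
      fix w assume "w \<in> space dA"
      then have w: "w \<in> disk" by simp
      have T: "\<tau> w > 0" by (rule \<tau>_pos[OF w])
      have bs: "ball w (\<delta> * \<tau> w) \<in> sets \<mu>"
        using ball_subset[OF w, of "\<delta> * \<tau> w"] \<delta> T by (auto simp: finite_borel_disk_sets[OF \<mu>])
      have [measurable]: "(\<lambda>z. k w z) \<in> borel_measurable \<mu>"
      proof -
        have "(\<lambda>z. norm (z - w)) \<in> borel_measurable \<mu>" "(\<lambda>z. e * \<tau> z) \<in> borel_measurable \<mu>"
          by measurable
        then have "{z \<in> space \<mu>. norm (z - w) < e * \<tau> z} \<in> sets \<mu>" by (rule borel_measurable_less)
        then have [measurable]: "(indicator {z. norm (z - w) < e * \<tau> z} :: _ \<Rightarrow> ennreal) \<in> borel_measurable \<mu>"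
          by (subst borel_measurable_indicator_iff) (simp add: Int_def conj_commute)
        have "(\<lambda>z. ennreal (C / (e * \<tau> z)\<^sup>2) * (indicator S z * indicator {z. norm (z - w) < e * \<tau> z} z)) \<in> borel_measurable \<mu>"
          by measurable
        then show ?thesis by (simp add: k_def indicator_def)
      qed
      have k_le: "k w z \<le> ennreal (C2 / (\<tau> w)\<^sup>2) * indicator (ball w (\<delta> * \<tau> w)) z \<and> norm (z - w) < \<delta> * \<tau> w"
        if z: "z \<in> disk" and "z \<in> S" "norm (z - w) < e * \<tau> z" for z
      proof -
        have Tz: "\<tau> z > 0" by (rule \<tau>_pos[OF z])
        have "norm (w - z) \<le> m * \<tau> z"
        proof -
          have "e * \<tau> z \<le> m * \<tau> z" using e Tz by (intro mult_right_mono) auto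
          then show ?thesis using that by (simp add: norm_minus_commute)
        qed
        from near(3)[OF z this] have n: "3 / 4 * \<tau> z \<le> \<tau> w" "\<tau> w \<le> 5 / 4 * \<tau> z"
          unfolding abs_le_iff by linarith+
        have "e * \<tau> z \<le> e * (2 * \<tau> w)" using n(1) e Tz T by (intro mult_left_mono) auto
        then have close: "norm (z - w) < \<delta> * \<tau> w" using that by (simp add: e_def)
        have "C / (e * \<tau> z)\<^sup>2 \<le> C2 / (\<tau> w)\<^sup>2"
        proof -
          have "(\<tau> w)\<^sup>2 \<le> (5 / 4 * \<tau> z)\<^sup>2" using n T by (intro power_mono) auto
          also have "\<dots> \<le> 2 * (\<tau> z)\<^sup>2" by (simp add: power2_eq_square)
          finally have "C * (\<tau> w)\<^sup>2 \<le> C * (2 * (\<tau> z)\<^sup>2)" using C by (intro mult_left_mono) auto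
          then show ?thesis using e T Tz by (simp add: C2_def field_simps power_mult_distrib)
        qed
        then have "k w z \<le> ennreal (C2 / (\<tau> w)\<^sup>2) * indicator (ball w (\<delta> * \<tau> w)) z"
          using that close by (simp add: k_def dist_norm norm_minus_commute ennreal_leI)
        with close show ?thesis by blast
      qed
      have "(\<integral>\<^sup>+z. k w z \<partial>\<mu>) \<le> ennreal (C2 * M)"
      \<comment> \<open>If no point of \<open>S\<close> is that close to \<open>w\<close>, nothing
        is assumed about the average at \<open>w\<close>, but then \<open>k w\<close>
        vanishes.\<close>
      proof (cases "\<exists>z\<in>S. z \<in> disk \<and> norm (z - w) < e * \<tau> z")
        case True
        then obtain y where "y \<in> S" "y \<in> disk" "norm (y - w) < e * \<tau> y" by blast
        then have M': "averaging \<tau> \<mu> \<delta> w \<le> M" using k_le[of y] w by (intro avg[of w y]) auto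
        have "(\<integral>\<^sup>+z. k w z \<partial>\<mu>) \<le> (\<integral>\<^sup>+z. ennreal (C2 / (\<tau> w)\<^sup>2) * indicator (ball w (\<delta> * \<tau> w)) z \<partial>\<mu>)"
        proof (rule nn_integral_mono)
          fix z assume "z \<in> space \<mu>"
          then have z: "z \<in> disk" by (simp add: sp)
          show "k w z \<le> ennreal (C2 / (\<tau> w)\<^sup>2) * indicator (ball w (\<delta> * \<tau> w)) z"
          proof (cases "z \<in> S \<and> norm (z - w) < e * \<tau> z")
            case True
            then show ?thesis using k_le[OF z] by blast
          next
            case False
            then show ?thesis by (auto simp: k_def)
          qed
        qed
        also have "\<dots> = ennreal (C2 / (\<tau> w)\<^sup>2) * emeasure \<mu> (ball w (\<delta> * \<tau> w))"
          using bs by (rule nn_integral_cmult_indicator)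
        also have "\<dots> = ennreal (C2 * averaging \<tau> \<mu> \<delta> w)"
          using C2 T by (simp add: \<mu>.emeasure_eq_measure averaging_def flip: ennreal_mult')
        also have "\<dots> \<le> ennreal (C2 * M)" using M' C2 by (intro ennreal_leI mult_left_mono) auto
        finally show ?thesis .
      next
        case False
        have "(\<integral>\<^sup>+z. k w z \<partial>\<mu>) = (\<integral>\<^sup>+z. 0 \<partial>\<mu>)"
          using False by (intro nn_integral_cong) (auto simp: k_def sp indicator_def)
        then show ?thesis by simp
      qed
      then have "F w * (\<integral>\<^sup>+z. k w z \<partial>\<mu>) \<le> F w * ennreal (C2 * M)" by (rule mult_left_mono) simp
      then show "(\<integral>\<^sup>+z. F w * k w z \<partial>\<mu>) \<le> F w * ennreal (C2 * M)"
        by (subst nn_integral_cmult) auto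
    qed
    also have "\<dots> = (\<integral>\<^sup>+w. F w \<partial>dA) * ennreal (C2 * M)" by (rule nn_integral_multc[OF F])
    also have "(\<integral>\<^sup>+w. F w \<partial>dA) = ennreal ((A2_norm \<omega> f)\<^sup>2)"
      unfolding F_def by (rule nn_integral_A2[OF f])
    also have "ennreal ((A2_norm \<omega> f)\<^sup>2) * ennreal (C2 * M) = ennreal (C2 * M) * ennreal ((A2_norm \<omega> f)\<^sup>2)"
      by (rule mult.commute)
    also have "\<dots> = ennreal (C2 * M * (A2_norm \<omega> f)\<^sup>2)"
      using C2 M by (subst ennreal_mult'[symmetric]) auto
    finally show "(\<integral>\<^sup>+z. ennreal ((norm (f z))\<^sup>2 * \<omega> z) * indicator S z \<partial>\<mu>) \<le> ennreal (C2 * M * (A2_norm \<omega> f)\<^sup>2)"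
      unfolding F_def .
  qed
qed

end

section \<open>Toeplitz operators\<close>

text \<open>Trades the limit of suprema in \<open>ennreal\<close> for real inequalities, the form in
  which both compactness arguments work.\<close>

lemma averaging_vanishes_iff:
  "((\<lambda>r. SUP z\<in>{z \<in> disk. norm z > r}. ennreal (averaging \<tau> \<mu> \<delta> z)) \<longlongrightarrow> 0) (at_left 1) \<longleftrightarrow>
   (\<forall>e>0. \<exists>r<1. \<forall>z\<in>disk. norm z > r \<longrightarrow> averaging \<tau> \<mu> \<delta> z \<le> e)"
  (is "(?f \<longlongrightarrow> 0) _ \<longleftrightarrow> ?R")
proof
  assume L: "(?f \<longlongrightarrow> 0) (at_left 1)"
  show ?R
  proof (intro allI impI)
    fix e :: real assume e: "e > 0"
    then have "\<forall>\<^sub>F r in at_left 1. ?f r < ennreal e" by (intro order_tendstoD(2)[OF L]) simp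
    then obtain b where b: "b < 1" "\<And>r. b < r \<Longrightarrow> r < 1 \<Longrightarrow> ?f r < ennreal e"
      unfolding eventually_at_left[OF zero_less_one] by blast
    define r where "r = (b + 1) / 2"
    have r: "b < r" "r < 1" using b(1) by (auto simp: r_def)
    have "averaging \<tau> \<mu> \<delta> z \<le> e" if "z \<in> disk" "norm z > r" for z
    proof -
      have "ennreal (averaging \<tau> \<mu> \<delta> z) \<le> ?f r" using that by (intro SUP_upper) auto
      also have "\<dots> \<le> ennreal e" using b(2)[OF r] by (rule less_imp_le)
      finally show ?thesis using e by (subst (asm) ennreal_le_iff) auto
    qed
    then show "\<exists>r<1. \<forall>z\<in>disk. norm z > r \<longrightarrow> averaging \<tau> \<mu> \<delta> z \<le> e" using r by blast
  qed
next
  assume R: ?R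
  show "(?f \<longlongrightarrow> 0) (at_left 1)"
  proof (rule order_tendstoI)
    fix a :: ennreal assume "0 < a"
    then obtain x where x: "0 < x" "x < a" using dense by blast
    then obtain e where e: "x = ennreal e" "e \<ge> 0" by (cases x) auto
    with x have "e > 0" by (simp add: ennreal_less_zero_iff)
    then obtain r where r: "r < 1" "\<And>z. z \<in> disk \<Longrightarrow> norm z > r \<Longrightarrow> averaging \<tau> \<mu> \<delta> z \<le> e"
      using R by blast
    have "?f s < a" if "r < s" for s
    proof -
      have "?f s \<le> ennreal e" using r(2) that by (intro SUP_least ennreal_leI) auto
      then show ?thesis using x e by auto
    qed
    then show "\<forall>\<^sub>F r in at_left 1. ?f r < a"
      unfolding eventually_at_left[OF zero_less_one] using r(1) by blast
  qed (auto simp: not_less)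
qed

lemma toeplitz_scale: "toeplitz \<omega> \<mu> (\<lambda>z. c * f z) z = c * toeplitz \<omega> \<mu> f z"
  unfolding toeplitz_def by (simp add: mult.assoc)

context large_weight begin

section \<open>Averages and boundedness\<close>

text \<open>By the Carleson embedding the form \<open>b\<close> is bounded, so \<open>b g f\<close>
  is represented by some \<open>h\<close>, and \<open>g = K_z\<close> identifies \<open>h\<close>
  with the Toeplitz integral. The bound by the \<open>\<mu>\<close>-integral of
  \<open>|f|^2 * \<omega>\<close> is kept for the compactness proof.\<close>

lemma averaging_bounded_imp_toeplitz:
  assumes \<delta>: "0 < \<delta>" "\<delta> \<le> m"
  shows "\<exists>C>0. \<forall>\<mu> M. finite_borel_disk \<mu> \<and> M \<ge> 0 \<and> (\<forall>w\<in>disk. averaging \<tau> \<mu> \<delta> w \<le> M) \<longrightarrow>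
    toeplitz_defined \<omega> \<mu> \<and> (\<forall>f\<in>A2 \<omega>. toeplitz \<omega> \<mu> f \<in> A2 \<omega> \<and>
      A2_norm \<omega> (toeplitz \<omega> \<mu> f) \<le> C * M * A2_norm \<omega> f \<and>
      (A2_norm \<omega> (toeplitz \<omega> \<mu> f))\<^sup>2 \<le> C * M * (LINT z|\<mu>. (norm (f z))\<^sup>2 * \<omega> z) \<and>
      integrable \<mu> (\<lambda>z. (norm (f z))\<^sup>2 * \<omega> z))"
proof -
  obtain C where C: "C > 0" and carl: "\<forall>\<mu> S M f. finite_borel_disk \<mu> \<and> S \<in> sets \<mu> \<and> M \<ge> 0 \<and>
     (\<forall>w\<in>disk. \<forall>z\<in>S. norm (z - w) < \<delta> * \<tau> w \<longrightarrow> averaging \<tau> \<mu> \<delta> w \<le> M) \<and> f \<in> A2 \<omega> \<longrightarrow>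
     (\<integral>\<^sup>+z. ennreal ((norm (f z))\<^sup>2 * \<omega> z) * indicator S z \<partial>\<mu>) \<le> ennreal (C * M * (A2_norm \<omega> f)\<^sup>2)"
    using Carleson_embedding[OF \<delta>] by (elim exE conjE) (rule that)
  show ?thesis
  proof (rule exI[of _ C], rule conjI[OF C], intro allI impI)
    fix \<mu> M assume asm: "finite_borel_disk \<mu> \<and> M \<ge> 0 \<and> (\<forall>w\<in>disk. averaging \<tau> \<mu> \<delta> w \<le> M)"
    then have \<mu>: "finite_borel_disk \<mu>" and M: "M \<ge> 0" and avg: "\<And>w. w \<in> disk \<Longrightarrow> averaging \<tau> \<mu> \<delta> w \<le> M"
      by auto
    have sp: "space \<mu> = disk" by (rule finite_borel_disk_space[OF \<mu>])
    have wm: "\<omega> \<in> borel_measurable \<mu>" by (rule finite_borel_disk_measurable[OF \<mu> continuous_\<omega>])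
    have fm: "f \<in> borel_measurable \<mu>" if "f \<in> A2 \<omega>" for f
      by (rule finite_borel_disk_measurable[OF \<mu> A2_continuous[OF that]])
    define U where "U f = (LINT z|\<mu>. (norm (f z))\<^sup>2 * \<omega> z)" for f :: "complex \<Rightarrow> complex"
    have nn_le: "(\<integral>\<^sup>+z. ennreal ((norm (f z))\<^sup>2 * \<omega> z) \<partial>\<mu>) \<le> ennreal (C * M * (A2_norm \<omega> f)\<^sup>2)"
      if f: "f \<in> A2 \<omega>" for f
    proof -
      have "(\<integral>\<^sup>+z. ennreal ((norm (f z))\<^sup>2 * \<omega> z) \<partial>\<mu>)
          = (\<integral>\<^sup>+z. ennreal ((norm (f z))\<^sup>2 * \<omega> z) * indicator disk z \<partial>\<mu>)"
        by (rule nn_integral_cong) (simp add: sp)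
      also have "\<dots> \<le> ennreal (C * M * (A2_norm \<omega> f)\<^sup>2)"
        using M avg f \<mu> by (intro carl[rule_format]) (auto simp: finite_borel_disk_sets[OF \<mu>])
      finally show ?thesis .
    qed
    have U_int: "integrable \<mu> (\<lambda>z. (norm (f z))\<^sup>2 * \<omega> z)" if f: "f \<in> A2 \<omega>" for f
    proof (rule integrableI_nonneg)
      show "(\<lambda>z. (norm (f z))\<^sup>2 * \<omega> z) \<in> borel_measurable \<mu>"
        by (intro finite_borel_disk_measurable[OF \<mu>] continuous_intros A2_continuous[OF f] continuous_\<omega>)
      show "(\<integral>\<^sup>+z. ennreal ((norm (f z))\<^sup>2 * \<omega> z) \<partial>\<mu>) < \<infinity>"
        by (rule le_less_trans[OF nn_le[OF f]]) simp
    qed (auto intro!: AE_I2 simp: sp \<omega>_nonneg)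
    have U_nonneg: "U f \<ge> 0" for f
      unfolding U_def by (auto intro!: integral_nonneg_AE AE_I2 simp: sp \<omega>_nonneg)
    have U_le: "U f \<le> C * M * (A2_norm \<omega> f)\<^sup>2" if f: "f \<in> A2 \<omega>" for f
    proof -
      have "ennreal (U f) = (\<integral>\<^sup>+z. ennreal ((norm (f z))\<^sup>2 * \<omega> z) \<partial>\<mu>)"
        unfolding U_def by (rule nn_integral_eq_integral[OF U_int[OF f], symmetric]) (auto simp: sp \<omega>_nonneg)
      also note nn_le[OF f]
      finally show ?thesis using C M by (subst (asm) ennreal_le_iff) auto
    qed
    \<comment> \<open>A bound for the embedding into \<open>L^2\<close> of
      \<open>\<omega> * \<mu>\<close>. The factor \<open>C * M\<close> arises as
      \<open>k * k\<close>, one \<open>k\<close> for each argument of \<open>b\<close>.\<close>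
    define k where "k = sqrt (C * M)"
    have k: "k \<ge> 0" "k * k = C * M" using C M by (auto simp: k_def)
    have sqrtU: "sqrt (U f) \<le> k * A2_norm \<omega> f" if f: "f \<in> A2 \<omega>" for f
    proof -
      have "sqrt (U f) \<le> sqrt (C * M * (A2_norm \<omega> f)\<^sup>2)" using U_le[OF f] by simp
      also have "\<dots> = k * A2_norm \<omega> f"
        unfolding k_def by (simp only: real_sqrt_mult real_sqrt_abs abs_of_nonneg[OF A2_norm_nonneg])
      finally show ?thesis .
    qed
    define b where "b f g = (LINT z|\<mu>. f z * cnj (g z) * complex_of_real (\<omega> z))" for f g
    have b_int: "integrable \<mu> (\<lambda>z. f z * cnj (g z) * complex_of_real (\<omega> z))"
      and b_le: "norm (b f g) \<le> sqrt (U f) * sqrt (U g)" if f: "f \<in> A2 \<omega>" and g: "g \<in> A2 \<omega>" for f g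
      unfolding b_def U_def using Cauchy_Schwarz_weighted[OF fm[OF f] fm[OF g] wm _ U_int[OF f] U_int[OF g]]
      by (auto simp: sp \<omega>_nonneg)
    have b_cnj: "b g f = cnj (b f g)" for f g
    proof -
      have "cnj (b f g) = (LINT z|\<mu>. cnj (f z * cnj (g z) * complex_of_real (\<omega> z)))"
        unfolding b_def by (rule Bochner_Integration.integral_cnj[symmetric])
      then show ?thesis unfolding b_def by (simp add: mult.commute)
    qed
    show "toeplitz_defined \<omega> \<mu> \<and> (\<forall>f\<in>A2 \<omega>. toeplitz \<omega> \<mu> f \<in> A2 \<omega> \<and>
      A2_norm \<omega> (toeplitz \<omega> \<mu> f) \<le> C * M * A2_norm \<omega> f \<and>
      (A2_norm \<omega> (toeplitz \<omega> \<mu> f))\<^sup>2 \<le> C * M * (LINT z|\<mu>. (norm (f z))\<^sup>2 * \<omega> z) \<and>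
      integrable \<mu> (\<lambda>z. (norm (f z))\<^sup>2 * \<omega> z))"
    proof (intro conjI ballI)
      show "toeplitz_defined \<omega> \<mu>"
        unfolding toeplitz_defined_def using b_int kernel(1) by blast
      fix f assume f: "f \<in> A2 \<omega>"
      have "\<exists>h. h \<in> A2 \<omega> \<and> (\<forall>g\<in>A2 \<omega>. b g f = A2_inner \<omega> g h)"
      proof (rule A2_Riesz[of "\<lambda>g. b g f" "k * sqrt (U f)"])
        fix g h assume g: "g \<in> A2 \<omega>" and h: "h \<in> A2 \<omega>"
        show "b (\<lambda>z. g z + h z) f = b g f + b h f"
          unfolding b_def by (simp add: distrib_right b_int f g h)
      next
        fix c g assume g: "g \<in> A2 \<omega>"
        show "b (\<lambda>z. c * g z) f = c * b g f"
          unfolding b_def by (simp add: mult.assoc)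
        have "sqrt (U g) * sqrt (U f) \<le> k * A2_norm \<omega> g * sqrt (U f)"
          using sqrtU[OF g] U_nonneg[of f] by (intro mult_right_mono) auto
        then show "norm (b g f) \<le> k * sqrt (U f) * A2_norm \<omega> g"
          using b_le[OF g f] by (simp add: mult_ac)
      next
        fix h assume "h \<in> A2 \<omega>" "\<And>g. g \<in> A2 \<omega> \<Longrightarrow> b g f = A2_inner \<omega> g h"
        then show ?thesis by blast
      qed
      then obtain h where h: "h \<in> A2 \<omega>" and rep: "\<And>g. g \<in> A2 \<omega> \<Longrightarrow> b g f = A2_inner \<omega> g h" by blast
      have T_eq: "toeplitz \<omega> \<mu> f z = h z" if z: "z \<in> disk" for z
      proof -
        have "toeplitz \<omega> \<mu> f z = b f (kernel \<omega> z)" by (simp add: toeplitz_def b_def)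
        also have "\<dots> = cnj (A2_inner \<omega> (kernel \<omega> z) h)" by (simp only: b_cnj[of f] rep[OF kernel(1)[OF z]])
        also have "\<dots> = h z" by (simp only: A2_inner_commute[symmetric] kernel(2)[OF z h, symmetric])
        finally show ?thesis .
      qed
      show TA: "toeplitz \<omega> \<mu> f \<in> A2 \<omega>" by (rule A2_cong[OF h]) (simp add: T_eq)
      have Tn: "A2_norm \<omega> (toeplitz \<omega> \<mu> f) = A2_norm \<omega> h"
        unfolding A2_norm_def
        by (intro arg_cong[where f = sqrt] Bochner_Integration.integral_cong) (auto simp: T_eq)
      \<comment> \<open>Testing with \<open>g = h\<close> and dividing by the norm of
        \<open>h\<close> leaves the \<open>\<mu>\<close>-norm of \<open>f\<close> untouched, which
        yields the sharper second bound.\<close>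
      have "(A2_norm \<omega> h)\<^sup>2 = norm (b h f)" by (simp add: rep[OF h] A2_inner_self norm_power)
      also have "\<dots> \<le> sqrt (U h) * sqrt (U f)" by (rule b_le[OF h f])
      also have "\<dots> \<le> (k * A2_norm \<omega> h) * sqrt (U f)"
        using U_nonneg[of f] by (intro mult_right_mono sqrtU h) auto
      finally have "A2_norm \<omega> h * A2_norm \<omega> h \<le> A2_norm \<omega> h * (k * sqrt (U f))"
        by (simp add: power2_eq_square mult_ac)
      then have le: "A2_norm \<omega> h \<le> k * sqrt (U f)"
        using A2_norm_nonneg[of h] U_nonneg[of f] k
        by (cases "A2_norm \<omega> h = 0") (auto dest: mult_left_le_imp_le)
      also have "\<dots> \<le> k * (k * A2_norm \<omega> f)" by (intro mult_left_mono sqrtU f k)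
      finally show "A2_norm \<omega> (toeplitz \<omega> \<mu> f) \<le> C * M * A2_norm \<omega> f"
        by (simp only: Tn mult.assoc[symmetric] k(2))
      have "(A2_norm \<omega> h)\<^sup>2 \<le> (k * sqrt (U f))\<^sup>2" by (rule power_mono[OF le]) simp
      also have "\<dots> = C * M * U f" using U_nonneg[of f] k(2) by (simp add: power2_eq_square mult_ac)
      finally show "(A2_norm \<omega> (toeplitz \<omega> \<mu> f))\<^sup>2 \<le> C * M * (LINT z|\<mu>. (norm (f z))\<^sup>2 * \<omega> z)"
        by (simp add: Tn U_def)
      show "integrable \<mu> (\<lambda>z. (norm (f z))\<^sup>2 * \<omega> z)" by (rule U_int[OF f])
    qed
  qed
qed

text \<open>Applied to \<open>K_z\<close> and evaluated at \<open>z\<close>, the Toeplitz integral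
  has the nonnegative integrand \<open>|K_z|^2 * \<omega>\<close>, so it may be restricted to a disk
  on which \<open>kernel_near_diagonal\<close> applies.\<close>

lemma averaging_le_toeplitz_kernel:
  "\<exists>d>0. d \<le> m \<and> (\<exists>c>0. \<forall>\<delta> \<mu> z. 0 < \<delta> \<and> \<delta> < d \<and> finite_borel_disk \<mu> \<and> toeplitz_defined \<omega> \<mu> \<and> z \<in> disk \<longrightarrow>
     c * averaging \<tau> \<mu> \<delta> z * (A2_norm \<omega> (kernel \<omega> z))\<^sup>2 \<le> norm (toeplitz \<omega> \<mu> (kernel \<omega> z) z))"
proof -
  obtain d c where d: "d > 0" "d \<le> m" and c: "c > 0" and near_diag: "\<And>z x. \<lbrakk>z \<in> disk; norm (x - z) < d * \<tau> z\<rbrakk> \<Longrightarrow>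
     c * (A2_norm \<omega> (kernel \<omega> z))\<^sup>2 \<le> (norm (kernel \<omega> z x))\<^sup>2 * \<omega> x * (\<tau> z)\<^sup>2"
    using kernel_near_diagonal by blast
  show ?thesis
  proof (rule exI[of _ d], intro conjI d, rule exI[of _ c], intro conjI c allI impI)
    fix \<delta> \<mu> z assume asm: "0 < \<delta> \<and> \<delta> < d \<and> finite_borel_disk \<mu> \<and> toeplitz_defined \<omega> \<mu> \<and> z \<in> disk"
    then have \<delta>: "0 < \<delta>" "\<delta> < d" and \<mu>: "finite_borel_disk \<mu>" and def: "toeplitz_defined \<omega> \<mu>" and z: "z \<in> disk"
      by auto
    interpret \<mu>: finite_measure \<mu> using \<mu> by (simp add: finite_borel_disk_def)
    have sp: "space \<mu> = disk" by (rule finite_borel_disk_space[OF \<mu>])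
    have T: "\<tau> z > 0" by (rule \<tau>_pos[OF z])
    define K where "K = kernel \<omega> z"
    define N where "N = (A2_norm \<omega> K)\<^sup>2"
    define b where "b = ball z (\<delta> * \<tau> z)"
    have dm: "\<delta> * \<tau> z \<le> m * \<tau> z" using \<delta> d T by (intro mult_right_mono) auto
    have b: "b \<in> sets \<mu>" unfolding b_def finite_borel_disk_sets[OF \<mu>] using ball_subset[OF z dm] by auto
    have eq: "K x * cnj (K x) * complex_of_real (\<omega> x) = of_real ((norm (K x))\<^sup>2 * \<omega> x)" for x
      by (simp only: complex_norm_square[symmetric] of_real_mult)
    have "integrable \<mu> (\<lambda>x. K x * cnj (K x) * complex_of_real (\<omega> x))"
      using def kernel(1)[OF z] z unfolding toeplitz_defined_def K_def by blast
    from integrable_bounded_linear[OF bounded_linear_Re this]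
    have int: "integrable \<mu> (\<lambda>x. (norm (K x))\<^sup>2 * \<omega> x)" by (simp only: eq Re_complex_of_real)
    have "toeplitz \<omega> \<mu> K z = of_real (LINT x|\<mu>. (norm (K x))\<^sup>2 * \<omega> x)"
      unfolding toeplitz_def K_def[symmetric] eq by (rule integral_complex_of_real)
    moreover have "c * N / (\<tau> z)\<^sup>2 * measure \<mu> b \<le> (LINT x|\<mu>. (norm (K x))\<^sup>2 * \<omega> x)"
    proof -
      have "c * N / (\<tau> z)\<^sup>2 * measure \<mu> b = (LINT x|\<mu>. c * N / (\<tau> z)\<^sup>2 * indicator b x)"
        using b by simp
      also have "\<dots> \<le> (LINT x|\<mu>. (norm (K x))\<^sup>2 * \<omega> x)"
      proof (rule integral_mono[OF _ int])
        show "integrable \<mu> (\<lambda>x. c * N / (\<tau> z)\<^sup>2 * indicator b x)" using b by (simp add: \<mu>.emeasure_eq_measure)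
        fix x assume "x \<in> space \<mu>"
        then have x: "x \<in> disk" by (simp add: sp)
        show "c * N / (\<tau> z)\<^sup>2 * indicator b x \<le> (norm (K x))\<^sup>2 * \<omega> x"
        proof (cases "x \<in> b")
          case True
          have "\<delta> * \<tau> z < d * \<tau> z" using \<delta> T by simp
          then have "norm (x - z) < d * \<tau> z" using True by (simp add: b_def dist_norm norm_minus_commute)
          from near_diag[OF z this] show ?thesis using True T by (simp add: N_def K_def field_simps)
        next
          case False then show ?thesis using \<omega>_nonneg[OF x] by simp
        qed
      qed
      finally show ?thesis .
    qed
    moreover have "c * N / (\<tau> z)\<^sup>2 * measure \<mu> b = c * averaging \<tau> \<mu> \<delta> z * N"
      by (simp add: averaging_def b_def)
    ultimately show "c * averaging \<tau> \<mu> \<delta> z * (A2_norm \<omega> (kernel \<omega> z))\<^sup>2 \<le> norm (toeplitz \<omega> \<mu> (kernel \<omega> z) z)"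
      unfolding K_def N_def by (simp only: norm_of_real)
  qed
qed

section \<open>Boundary behaviour, operator norm and compactness\<close>

lemma kernel_norm_pos: "z \<in> disk \<Longrightarrow> A2_norm \<omega> (kernel \<omega> z) > 0"
proof -
  assume z: "z \<in> disk"
  have "1 / (A2_norm \<omega> (\<lambda>z. z ^ 0))\<^sup>2 \<le> (A2_norm \<omega> (kernel \<omega> z))\<^sup>2"
    using kernel_norm_ge_sum[OF z, of "{0}"] by simp
  moreover have "1 / (A2_norm \<omega> (\<lambda>z. z ^ 0))\<^sup>2 > 0" using monomial_norm_pos[of 0] by (intro divide_pos_pos zero_less_power) auto
  ultimately have "A2_norm \<omega> (kernel \<omega> z) \<noteq> 0" by auto
  then show ?thesis using A2_norm_nonneg[of "kernel \<omega> z"] by linarith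
qed

text \<open>The normalised kernels converge weakly to 0 at the boundary.\<close>

lemma evaluation_vanishes:
  assumes g: "g \<in> A2 \<omega>" and e: "e > 0"
  shows "\<exists>r<1. \<forall>z\<in>disk. norm z > r \<longrightarrow> norm (g z) \<le> e * A2_norm \<omega> (kernel \<omega> z)"
proof -
  obtain C where C: "C > 0" and smv: "\<And>a \<rho> f. \<lbrakk>a \<in> disk; 0 < \<rho>; \<rho> \<le> m * \<tau> a; f holomorphic_on disk\<rbrakk> \<Longrightarrow>
     ennreal ((norm (f a))\<^sup>2 * \<omega> a * \<rho>\<^sup>2)
       \<le> ennreal C * (\<integral>\<^sup>+z. ennreal ((norm (f z))\<^sup>2 * \<omega> z) * indicator (ball a \<rho>) z \<partial>dA)"
    using sub_mean_value by blast
  obtain c0 where c0: "c0 > 0" and lower: "\<And>z. z \<in> disk \<Longrightarrow>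
      c0 \<le> (A2_norm \<omega> (kernel \<omega> z))\<^sup>2 * \<omega> z * (\<tau> z)\<^sup>2"
    using kernel_norm_lower by blast
  define F where "F w = (norm (g w))\<^sup>2 * \<omega> w" for w
  define t where "t n = 1 - inverse (real (Suc n))" for n
  define S where "S n = {w \<in> disk. t n < norm w}" for n
  have S[measurable]: "S n \<in> sets dA" for n
    unfolding sets_dA_iff S_def by (auto intro!: borel_open open_Collect_conj open_Collect_less continuous_intros
        simp: open_ball[of 0 1, unfolded ball_def])
  have [measurable]: "F \<in> borel_measurable dA"
    unfolding F_def by (rule norm_squared_measurable[OF A2_continuous[OF g]])
  have F0: "F w \<ge> 0" if "w \<in> disk" for w using \<omega>_nonneg[OF that] by (simp add: F_def)
  have Fint: "integrable dA F" unfolding F_def by (rule A2_integrable[OF g])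
  have lim: "(\<lambda>n. LINT w|dA. F w * indicator (S n) w) \<longlonglongrightarrow> (LINT w|dA. 0)"
  proof (rule integral_dominated_convergence[where w = F])
    show "AE w in dA. (\<lambda>n. F w * indicator (S n) w) \<longlonglongrightarrow> 0"
    proof (rule AE_I2)
      fix w assume "w \<in> space dA"
      then have w: "norm w < 1" by simp
      obtain n0 where n0: "inverse (real (Suc n0)) < 1 - norm w" using reals_Archimedean[of "1 - norm w"] w by auto
      have "w \<notin> S n" if "n \<ge> n0" for n
      proof -
        have "inverse (real (Suc n)) \<le> inverse (real (Suc n0))" using that by (intro le_imp_inverse_le) auto
        then have "norm w < t n" unfolding t_def using n0 by argo
        then show ?thesis by (simp add: S_def)
      qed
      then have "\<forall>\<^sub>F n in sequentially. F w * indicator (S n) w = 0"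
        unfolding eventually_sequentially by (intro exI[of _ n0]) simp
      then show "(\<lambda>n. F w * indicator (S n) w) \<longlonglongrightarrow> 0" by (rule tendsto_eventually)
    qed
    show "AE w in dA. norm (F w * indicator (S n) w) \<le> F w" for n
      by (rule AE_I2) (auto simp: F0 indicator_def)
  qed (use Fint in simp_all)
  \<comment> \<open>Chosen so that, after the constants of the submean value inequality and of the
    kernel lower bound, exactly \<open>e^2\<close> times the squared kernel norm remains.\<close>
  define \<eta> where "\<eta> = e\<^sup>2 * (c0 * m\<^sup>2 / C)"
  have \<eta>: "\<eta> > 0" using e c0 m_pos C by (simp add: \<eta>_def)
  from order_tendstoD(2)[OF lim, of \<eta>] \<eta>
  obtain n where n: "(LINT w|dA. F w * indicator (S n) w) < \<eta>"
    by (auto simp: eventually_sequentially)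
  have tail: "(\<integral>\<^sup>+w. ennreal (F w) * indicator (S n) w \<partial>dA) \<le> ennreal \<eta>"
  proof -
    have "(\<integral>\<^sup>+w. ennreal (F w) * indicator (S n) w \<partial>dA) = (\<integral>\<^sup>+w. ennreal (F w * indicator (S n) w) \<partial>dA)"
      by (rule nn_integral_cong) (auto simp: indicator_def)
    also have "\<dots> = ennreal (LINT w|dA. F w * indicator (S n) w)"
      by (rule nn_integral_eq_integral) (auto intro!: integrable_real_mult_indicator Fint AE_I2 simp: F0)
    finally show ?thesis using n by (simp add: ennreal_leI)
  qed
  show ?thesis
  \<comment> \<open>Beyond this radius \<open>1 - |z| < 3/4 * (1 - t n)\<close>, so a disk around
    \<open>z\<close> of radius at most \<open>(1 - |z|) / 4\<close> stays outside the circle of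
    radius \<open>t n\<close>.\<close>
  proof (intro exI[of _ "(1 + 3 * t n) / 4"] conjI ballI impI)
    show "(1 + 3 * t n) / 4 < 1" by (simp add: t_def field_simps)
    fix z assume z: "z \<in> disk" and nz: "(1 + 3 * t n) / 4 < norm z"
    have T: "\<tau> z > 0" by (rule \<tau>_pos[OF z])
    have sub: "ball z (m * \<tau> z) \<subseteq> S n"
    proof
      fix w assume w: "w \<in> ball z (m * \<tau> z)"
      then have wd: "w \<in> disk" using ball_subset[OF z, of "m * \<tau> z"] by blast
      have "norm z \<le> norm w + norm (z - w)"
        by (metis add.commute diff_add_cancel norm_triangle_ineq)
      moreover have "norm (z - w) < (1 - norm z) / 4" using w m\<tau>_le[OF z] by (simp add: dist_norm)
      ultimately have "norm z < norm w + (1 - norm z) / 4" by linarith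
      moreover have "t n < 1" by (simp add: t_def)
      ultimately have "t n < norm w" using nz by argo
      then show "w \<in> S n" using wd by (simp add: S_def)
    qed
    have "ennreal (F z * (m * \<tau> z)\<^sup>2) \<le> ennreal C * (\<integral>\<^sup>+w. ennreal (F w) * indicator (ball z (m * \<tau> z)) w \<partial>dA)"
      unfolding F_def using m_pos T by (intro smv z A2_holomorphic[OF g]) auto
    also have "\<dots> \<le> ennreal C * (\<integral>\<^sup>+w. ennreal (F w) * indicator (S n) w \<partial>dA)"
      using sub by (intro mult_left_mono nn_integral_mono) (auto simp: indicator_def)
    also have "\<dots> \<le> ennreal C * ennreal \<eta>" by (intro mult_left_mono tail) simp
    also have "\<dots> = ennreal (C * \<eta>)" using C by (intro ennreal_mult'[symmetric]) simp
    finally have "F z * (m * \<tau> z)\<^sup>2 \<le> C * \<eta>" using C \<eta> by (subst (asm) ennreal_le_iff) auto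
    also have "\<dots> = e\<^sup>2 * c0 * m\<^sup>2" using C by (simp add: \<eta>_def)
    also have "\<dots> \<le> e\<^sup>2 * ((A2_norm \<omega> (kernel \<omega> z))\<^sup>2 * \<omega> z * (\<tau> z)\<^sup>2) * m\<^sup>2"
      by (intro mult_right_mono mult_left_mono lower z) auto
    finally have "(norm (g z))\<^sup>2 * (\<omega> z * (m * \<tau> z)\<^sup>2) \<le> (e * A2_norm \<omega> (kernel \<omega> z))\<^sup>2 * (\<omega> z * (m * \<tau> z)\<^sup>2)"
      by (simp add: F_def power_mult_distrib mult_ac)
    moreover have "\<omega> z * (m * \<tau> z)\<^sup>2 > 0" using \<omega>_pos[OF z] m_pos T by simp
    ultimately have "(norm (g z))\<^sup>2 \<le> (e * A2_norm \<omega> (kernel \<omega> z))\<^sup>2" by (rule mult_right_le_imp_le)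
    then show "norm (g z) \<le> e * A2_norm \<omega> (kernel \<omega> z)"
      by (rule power2_le_imp_le) (use e in simp)
  qed
qed



lemma averaging_le_sup:
  assumes "sup_averaging \<tau> \<mu> \<delta> < \<infinity>" "z \<in> disk"
  shows "averaging \<tau> \<mu> \<delta> z \<le> enn2real (sup_averaging \<tau> \<mu> \<delta>)"
proof -
  have "ennreal (averaging \<tau> \<mu> \<delta> z) \<le> sup_averaging \<tau> \<mu> \<delta>"
    unfolding sup_averaging_def using assms(2) by (intro SUP_upper)
  from enn2real_mono[OF this] assms(1) show ?thesis by (simp add: averaging_nonneg)
qed

lemma A2_opnorm_bound:
  assumes bdd: "A2_bounded \<omega> (toeplitz \<omega> \<mu>)" and f: "f \<in> A2 \<omega>"
  shows "A2_norm \<omega> (toeplitz \<omega> \<mu> f) \<le> A2_opnorm \<omega> (toeplitz \<omega> \<mu>) * A2_norm \<omega> f"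
proof -
  obtain C where C: "\<And>f. f \<in> A2 \<omega> \<Longrightarrow> A2_norm \<omega> (toeplitz \<omega> \<mu> f) \<le> C * A2_norm \<omega> f"
    using bdd unfolding A2_bounded_def by blast
  define a where "a = A2_norm \<omega> f"
  show ?thesis
  proof (cases "a = 0")
    case True then show ?thesis using C[OF f] by (simp add: a_def)
  next
    case False
    then have a: "a > 0" using A2_norm_nonneg[of f] unfolding a_def by linarith
    define g where "g z = of_real (inverse a) * f z" for z
    have g: "g \<in> A2 \<omega>" unfolding g_def[abs_def] by (rule A2_scale[OF f])
    have g1: "A2_norm \<omega> g = 1" unfolding g_def[abs_def] A2_norm_scale norm_of_real using a by (simp add: a_def)
    have "bdd_above ((\<lambda>f. A2_norm \<omega> (toeplitz \<omega> \<mu> f)) ` {f \<in> A2 \<omega>. A2_norm \<omega> f \<le> 1})"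
    proof (rule bdd_aboveI2)
      fix h assume h: "h \<in> {f \<in> A2 \<omega>. A2_norm \<omega> f \<le> 1}"
      then have "A2_norm \<omega> (toeplitz \<omega> \<mu> h) \<le> C * A2_norm \<omega> h" by (intro C) simp
      \<comment> \<open>\<open>A2_bounded\<close> imposes no sign on its constant. The finite upper
        bound obtained here is what makes the real-valued \<open>SUP\<close> meaningful.\<close>
      also have "\<dots> \<le> \<bar>C\<bar> * A2_norm \<omega> h" by (intro mult_right_mono) auto
      also have "\<dots> \<le> \<bar>C\<bar> * 1" using h by (intro mult_left_mono) auto
      finally show "A2_norm \<omega> (toeplitz \<omega> \<mu> h) \<le> \<bar>C\<bar>" by simp
    qed
    then have "A2_norm \<omega> (toeplitz \<omega> \<mu> g) \<le> A2_opnorm \<omega> (toeplitz \<omega> \<mu>)"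
      unfolding A2_opnorm_def using g g1 by (intro cSUP_upper) auto
    moreover have "A2_norm \<omega> (toeplitz \<omega> \<mu> g) = inverse a * A2_norm \<omega> (toeplitz \<omega> \<mu> f)"
      unfolding g_def[abs_def] toeplitz_scale[abs_def] A2_norm_scale norm_of_real using a by simp
    ultimately show ?thesis using a by (simp add: a_def field_simps)
  qed
qed

text \<open>Inside radius \<open>r\<close> the average is at most the total mass divided by
  \<open>\<tau>^2\<close>, and \<open>\<tau>\<close> is bounded below there because it
  decreases.\<close>

lemma averaging_bounded_of_vanishing:
  assumes \<mu>: "finite_borel_disk \<mu>" and r: "r < 1" "\<And>z. z \<in> disk \<Longrightarrow> norm z > r \<Longrightarrow> averaging \<tau> \<mu> \<delta> z \<le> 1"
  shows "\<exists>M\<ge>0. \<forall>z\<in>disk. averaging \<tau> \<mu> \<delta> z \<le> M"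
proof -
  interpret \<mu>: finite_measure \<mu> using \<mu> by (simp add: finite_borel_disk_def)
  define s where "s = max r 0"
  have s: "complex_of_real s \<in> disk" using r(1) by (simp add: s_def)
  have t: "profile \<tau> s > 0" by (rule \<tau>_pos[OF s])
  define M where "M = max 1 (measure \<mu> (space \<mu>) / (profile \<tau> s)\<^sup>2)"
  have "averaging \<tau> \<mu> \<delta> z \<le> M" if z: "z \<in> disk" for z
  proof (cases "norm z > r")
    case True then show ?thesis using r(2)[OF z] by (simp add: M_def)
  next
    case False
    then have "profile \<tau> s \<le> \<tau> z" using z s by (intro \<tau>_mono) (auto simp: s_def)
    then have "(profile \<tau> s)\<^sup>2 \<le> (\<tau> z)\<^sup>2" using t by (intro power_mono) auto
    then have "averaging \<tau> \<mu> \<delta> z \<le> measure \<mu> (space \<mu>) / (profile \<tau> s)\<^sup>2"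
      unfolding averaging_def using t by (intro frac_le \<mu>.bounded_measure) auto
    then show ?thesis by (simp add: M_def)
  qed
  moreover have "M \<ge> 0" by (simp add: M_def)
  ultimately show ?thesis by blast
qed

text \<open>Along points with averages above \<open>e\<close>, the images of the normalised kernels
  have a norm-convergent subsequence. Its limit is evaluated as \<open>o(N k)\<close> at these
  points by \<open>evaluation_vanishes\<close>, while \<open>lower\<close> forces the images to have
  size at least \<open>c * e * N k\<close> there.\<close>

lemma toeplitz_compact_imp_vanishing:
  assumes c: "c > 0" and lower: "\<And>z. z \<in> disk \<Longrightarrow>
      c * averaging \<tau> \<mu> \<delta> z * (A2_norm \<omega> (kernel \<omega> z))\<^sup>2 \<le> norm (toeplitz \<omega> \<mu> (kernel \<omega> z) z)"
    and cpt: "A2_compact \<omega> (toeplitz \<omega> \<mu>)" and e: "e > 0"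
  shows "\<exists>r<1. \<forall>z\<in>disk. norm z > r \<longrightarrow> averaging \<tau> \<mu> \<delta> z \<le> e"
proof (rule ccontr)
  assume no: "\<not> (\<exists>r<1. \<forall>z\<in>disk. norm z > r \<longrightarrow> averaging \<tau> \<mu> \<delta> z \<le> e)"
  have "\<exists>z\<in>disk. norm z > 1 - inverse (real (Suc n)) \<and> averaging \<tau> \<mu> \<delta> z > e" for n
  proof (rule ccontr)
    assume "\<not> ?thesis"
    then have "\<forall>z\<in>disk. norm z > 1 - inverse (real (Suc n)) \<longrightarrow> averaging \<tau> \<mu> \<delta> z \<le> e" by (auto simp: not_less)
    moreover have "1 - inverse (real (Suc n)) < 1" by simp
    ultimately show False using no by blast
  qed
  then obtain z where z: "\<And>n. z n \<in> disk" "\<And>n. norm (z n) > 1 - inverse (real (Suc n))"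
    "\<And>n. averaging \<tau> \<mu> \<delta> (z n) > e" by metis
  define N where "N n = A2_norm \<omega> (kernel \<omega> (z n))" for n
  have N: "N n > 0" for n unfolding N_def by (rule kernel_norm_pos[OF z(1)])
  define F where "F n x = of_real (inverse (N n)) * kernel \<omega> (z n) x" for n x
  have F: "F n \<in> A2 \<omega>" for n unfolding F_def[abs_def] by (rule A2_scale[OF kernel(1)[OF z(1)]])
  have F1: "A2_norm \<omega> (F n) \<le> 1" for n
    unfolding F_def[abs_def] A2_norm_scale norm_of_real N_def[symmetric] using N[of n] by simp
  have TA: "toeplitz \<omega> \<mu> f \<in> A2 \<omega>" if "f \<in> A2 \<omega>" for f
    using cpt that by (simp add: A2_compact_def)
  have "\<exists>g\<in>A2 \<omega>. \<exists>s :: nat \<Rightarrow> nat. strict_mono s \<and>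
      (\<lambda>n. A2_norm \<omega> (\<lambda>x. toeplitz \<omega> \<mu> (F (s n)) x - g x)) \<longlonglongrightarrow> 0"
    using cpt F F1 unfolding A2_compact_def by blast
  then obtain g and s :: "nat \<Rightarrow> nat" where g: "g \<in> A2 \<omega>" and s: "strict_mono s"
    and conv: "(\<lambda>n. A2_norm \<omega> (\<lambda>x. toeplitz \<omega> \<mu> (F (s n)) x - g x)) \<longlonglongrightarrow> 0" by blast
  \<comment> \<open>Half of \<open>c * e\<close>, as there are two errors: the distance to the limit
    \<open>g\<close> and the value of \<open>g\<close> itself.\<close>
  define \<eta> where "\<eta> = c * e / 2"
  have \<eta>: "\<eta> > 0" using c e by (simp add: \<eta>_def)
  obtain r where r: "r < 1" "\<And>x. x \<in> disk \<Longrightarrow> norm x > r \<Longrightarrow> norm (g x) \<le> \<eta> * A2_norm \<omega> (kernel \<omega> x)"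
    using evaluation_vanishes[OF g \<eta>] by blast
  obtain n1 where n1: "\<And>n. n \<ge> n1 \<Longrightarrow> A2_norm \<omega> (\<lambda>x. toeplitz \<omega> \<mu> (F (s n)) x - g x) < \<eta>"
    using order_tendstoD(2)[OF conv \<eta>] unfolding eventually_sequentially by blast
  obtain n2 where n2: "inverse (real (Suc n2)) < 1 - r" using reals_Archimedean[of "1 - r"] r(1) by auto
  define n where "n = max n1 n2"
  define k where "k = s n"
  have "n2 \<le> k" using seq_suble[OF s, of n] by (simp add: n_def k_def)
  then have "inverse (real (Suc k)) \<le> inverse (real (Suc n2))" by (intro le_imp_inverse_le) auto
  then have "norm (z k) > r" using z(2)[of k] n2 by argo
  then have gz: "norm (g (z k)) \<le> \<eta> * N k" unfolding N_def by (intro r z)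
  have d: "(\<lambda>x. toeplitz \<omega> \<mu> (F k) x - g x) \<in> A2 \<omega>" by (intro A2_diff TA F g)
  have "norm (toeplitz \<omega> \<mu> (F k) (z k) - g (z k)) \<le> A2_norm \<omega> (\<lambda>x. toeplitz \<omega> \<mu> (F k) x - g x) * N k"
    unfolding N_def using kernel_extremal[OF z(1) d] by simp
  also have "\<dots> < \<eta> * N k"
    using n1[of n] N[of k] by (intro mult_strict_right_mono) (auto simp: k_def n_def)
  finally have "norm (toeplitz \<omega> \<mu> (F k) (z k)) < 2 * (\<eta> * N k)"
    using gz norm_triangle_ineq[of "toeplitz \<omega> \<mu> (F k) (z k) - g (z k)" "g (z k)"] by simp
  also have "toeplitz \<omega> \<mu> (F k) (z k) = of_real (inverse (N k)) * toeplitz \<omega> \<mu> (kernel \<omega> (z k)) (z k)"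
    unfolding F_def[abs_def] by (rule toeplitz_scale)
  finally have "inverse (N k) * norm (toeplitz \<omega> \<mu> (kernel \<omega> (z k)) (z k)) < c * e * N k"
    unfolding norm_mult norm_of_real using N[of k] by (simp add: \<eta>_def)
  then have "norm (toeplitz \<omega> \<mu> (kernel \<omega> (z k)) (z k)) < c * e * (N k)\<^sup>2"
    using N[of k] by (simp add: field_simps power2_eq_square)
  moreover have "c * e * (N k)\<^sup>2 \<le> c * averaging \<tau> \<mu> \<delta> (z k) * (N k)\<^sup>2"
    using z(3)[of k] c by (intro mult_right_mono mult_left_mono) auto
  moreover have "c * averaging \<tau> \<mu> \<delta> (z k) * (N k)\<^sup>2 \<le> norm (toeplitz \<omega> \<mu> (kernel \<omega> (z k)) (z k))"
    unfolding N_def by (rule lower[OF z(1)])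
  ultimately show False by linarith
qed

text \<open>Outside a disk of radius \<open>\<rho>\<close> the Carleson embedding applies with
  averages at most \<open>e\<close>, uniformly in \<open>n\<close>; inside, uniform convergence and
  the finiteness of \<open>\<mu>\<close> suffice.\<close>

lemma integral_vanishes_of_locally_uniform:
  assumes \<delta>: "0 < \<delta>" "\<delta> \<le> m" and \<mu>: "finite_borel_disk \<mu>"
    and vanish: "\<And>e. e > 0 \<Longrightarrow> \<exists>r<1. \<forall>z\<in>disk. norm z > r \<longrightarrow> averaging \<tau> \<mu> \<delta> z \<le> e"
    and D: "\<And>n. D n \<in> A2 \<omega>" "\<And>n. A2_norm \<omega> (D n) \<le> b"
    and int: "\<And>n. integrable \<mu> (\<lambda>z. (norm (D n z))\<^sup>2 * \<omega> z)"
    and unif: "\<And>K. \<lbrakk>compact K; K \<subseteq> disk\<rbrakk> \<Longrightarrow> uniform_limit K D (\<lambda>_. 0) sequentially"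
  shows "(\<lambda>n. LINT z|\<mu>. (norm (D n z))\<^sup>2 * \<omega> z) \<longlonglongrightarrow> 0"
proof (rule LIMSEQ_I)
  fix \<epsilon> :: real assume \<epsilon>: "\<epsilon> > 0"
  interpret \<mu>: finite_measure \<mu> using \<mu> by (simp add: finite_borel_disk_def)
  have sp: "space \<mu> = disk" by (rule finite_borel_disk_space[OF \<mu>])
  obtain C where C: "C > 0" and carl: "\<forall>\<mu> S M f. finite_borel_disk \<mu> \<and> S \<in> sets \<mu> \<and> M \<ge> 0 \<and>
     (\<forall>w\<in>disk. \<forall>z\<in>S. norm (z - w) < \<delta> * \<tau> w \<longrightarrow> averaging \<tau> \<mu> \<delta> w \<le> M) \<and> f \<in> A2 \<omega> \<longrightarrow>
     (\<integral>\<^sup>+z. ennreal ((norm (f z))\<^sup>2 * \<omega> z) * indicator S z \<partial>\<mu>) \<le> ennreal (C * M * (A2_norm \<omega> f)\<^sup>2)"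
    using Carleson_embedding[OF \<delta>] by (elim exE conjE) (rule that)
  define X where "X = C * b\<^sup>2 + 1"
  have X: "X > 0" unfolding X_def using C by (intro add_nonneg_pos) auto
  define e where "e = \<epsilon> / (4 * X)"
  have e: "e > 0" "C * e * b\<^sup>2 \<le> \<epsilon> / 4"
  proof -
    show "e > 0" using \<epsilon> X by (simp add: e_def)
    have "e * X = \<epsilon> / 4" using X by (simp add: e_def)
    then show "C * e * b\<^sup>2 \<le> \<epsilon> / 4" using \<open>e > 0\<close> by (simp add: X_def algebra_simps)
  qed
  define Y where "Y = \<omega> 0 * measure \<mu> disk"
  have Y: "Y \<ge> 0" using \<omega>_pos[of 0] by (simp add: Y_def)
  define Z where "Z = Y + 1"
  have Z: "Z > 0" using Y by (simp add: Z_def)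
  define t where "t = sqrt (\<epsilon> / (4 * Z))"
  have t: "t > 0" "t\<^sup>2 * Y \<le> \<epsilon> / 4"
  proof -
    show "t > 0" using \<epsilon> Z by (simp add: t_def)
    have "t\<^sup>2 * Z = \<epsilon> / 4" using \<epsilon> Z by (simp add: t_def)
    then have "t\<^sup>2 * Y + t\<^sup>2 = \<epsilon> / 4" by (simp add: Z_def algebra_simps)
    then show "t\<^sup>2 * Y \<le> \<epsilon> / 4" using zero_le_power2[of t] by argo
  qed
  obtain r0 where r0: "r0 < 1" "\<And>z. z \<in> disk \<Longrightarrow> norm z > r0 \<Longrightarrow> averaging \<tau> \<mu> \<delta> z \<le> e"
    using vanish[OF e(1)] by blast
  \<comment> \<open>If the disk around \<open>w\<close> reaches a point with
    \<open>|z| > \<rho>\<close>, then \<open>|z| \<le> (3 * |w| + 1) / 4\<close> forces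
    \<open>|w| > r0\<close>.\<close>
  define \<rho> where "\<rho> = (3 * r0 + 1) / 4"
  have \<rho>: "\<rho> < 1" using r0(1) by (simp add: \<rho>_def)
  define S where "S = disk - cball 0 \<rho>"
  have Ssets: "S \<in> sets \<mu>" by (auto simp: finite_borel_disk_sets[OF \<mu>] S_def)
  have avg: "averaging \<tau> \<mu> \<delta> w \<le> e" if w: "w \<in> disk" and z: "z \<in> S" and zw: "norm (z - w) < \<delta> * \<tau> w" for w z
  proof (rule r0(2)[OF w])
    have "\<delta> * \<tau> w \<le> m * \<tau> w" using \<delta> \<tau>_pos[OF w] by (intro mult_right_mono) auto
    then have "norm z \<le> norm w + (1 - norm w) / 4" using zw by (intro near(2)[OF w]) auto
    moreover have "norm z > \<rho>" using z by (simp add: S_def)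
    ultimately show "norm w > r0" unfolding \<rho>_def by argo
  qed
  have "uniform_limit (cball 0 \<rho>) D (\<lambda>_. 0) sequentially" using \<rho> by (intro unif) (auto simp: cball_subset_ball_iff)
  then have "\<forall>\<^sub>F n in sequentially. \<forall>x\<in>cball 0 \<rho>. dist (D n x) 0 < t" using t(1) by (rule uniform_limitD)
  then obtain n0 where "\<forall>n\<ge>n0. \<forall>x\<in>cball 0 \<rho>. norm (D n x) < t"
    unfolding eventually_sequentially dist_norm diff_zero by blast
  then have n0: "norm (D n x) < t" if "n \<ge> n0" "x \<in> cball 0 \<rho>" for n x
    using that by blast
  have "norm ((LINT z|\<mu>. (norm (D n z))\<^sup>2 * \<omega> z) - 0) < \<epsilon>" if n: "n \<ge> n0" for n
  proof -
    define G where "G z = ennreal ((norm (D n z))\<^sup>2 * \<omega> z)" for z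
    have "ennreal (LINT z|\<mu>. (norm (D n z))\<^sup>2 * \<omega> z) = (\<integral>\<^sup>+z. G z \<partial>\<mu>)"
      unfolding G_def by (rule nn_integral_eq_integral[OF int, symmetric]) (auto simp: sp \<omega>_nonneg)
    also have "\<dots> \<le> (\<integral>\<^sup>+z. G z * indicator S z + ennreal (t\<^sup>2 * \<omega> 0) * indicator disk z \<partial>\<mu>)"
    proof (rule nn_integral_mono)
      fix z assume "z \<in> space \<mu>"
      then have z: "z \<in> disk" by (simp add: sp)
      show "G z \<le> G z * indicator S z + ennreal (t\<^sup>2 * \<omega> 0) * indicator disk z"
      proof (cases "z \<in> S")
        case False
        then have "norm (D n z) < t" using n0[OF n, of z] z by (simp add: S_def)
        then have "(norm (D n z))\<^sup>2 * \<omega> z \<le> t\<^sup>2 * \<omega> 0"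
          using \<omega>_mono[of 0 z] \<omega>_nonneg[OF z] z by (intro mult_mono power_mono) auto
        then show ?thesis using False z by (simp add: G_def ennreal_leI)
      qed simp
    qed
    also have "\<dots> = (\<integral>\<^sup>+z. G z * indicator S z \<partial>\<mu>) + (\<integral>\<^sup>+z. ennreal (t\<^sup>2 * \<omega> 0) * indicator disk z \<partial>\<mu>)"
    proof (rule nn_integral_add)
      have "(\<lambda>z. (norm (D n z))\<^sup>2 * \<omega> z) \<in> borel_measurable \<mu>" using int by (rule borel_measurable_integrable)
      then have "G \<in> borel_measurable \<mu>" unfolding G_def by simp
      then show "(\<lambda>z. G z * indicator S z) \<in> borel_measurable \<mu>"
        using Ssets by (intro borel_measurable_times_ennreal borel_measurable_indicator)
      show "(\<lambda>z. ennreal (t\<^sup>2 * \<omega> 0) * indicator disk z) \<in> borel_measurable \<mu>"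
        by (intro borel_measurable_times_ennreal borel_measurable_indicator) (auto simp: finite_borel_disk_sets[OF \<mu>])
    qed
    also have "\<dots> \<le> ennreal (C * e * b\<^sup>2) + ennreal (t\<^sup>2 * Y)"
    proof (rule add_mono)
      have "(\<integral>\<^sup>+z. G z * indicator S z \<partial>\<mu>) \<le> ennreal (C * e * (A2_norm \<omega> (D n))\<^sup>2)"
        unfolding G_def using \<mu> Ssets e(1) avg D(1) by (intro carl[rule_format]) auto
      also have "\<dots> \<le> ennreal (C * e * b\<^sup>2)"
        using C e(1) D(2)[of n] by (intro ennreal_leI mult_left_mono power_mono) auto
      finally show "(\<integral>\<^sup>+z. G z * indicator S z \<partial>\<mu>) \<le> ennreal (C * e * b\<^sup>2)" .
      show "(\<integral>\<^sup>+z. ennreal (t\<^sup>2 * \<omega> 0) * indicator disk z \<partial>\<mu>) \<le> ennreal (t\<^sup>2 * Y)"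
        using \<omega>_pos[of 0] by (subst nn_integral_cmult_indicator)
          (auto simp: finite_borel_disk_sets[OF \<mu>] \<mu>.emeasure_eq_measure Y_def mult.assoc simp flip: ennreal_mult')
    qed
    also have "ennreal (C * e * b\<^sup>2) + ennreal (t\<^sup>2 * Y) = ennreal (C * e * b\<^sup>2 + t\<^sup>2 * Y)"
      using C e(1) Y by (intro ennreal_plus[symmetric]) auto
    finally have "(LINT z|\<mu>. (norm (D n z))\<^sup>2 * \<omega> z) \<le> C * e * b\<^sup>2 + t\<^sup>2 * Y"
      using C e(1) Y by (subst (asm) ennreal_le_iff) auto
    also have "\<dots> < \<epsilon>" using e(2) t(2) \<epsilon> by argo
    finally have "(LINT z|\<mu>. (norm (D n z))\<^sup>2 * \<omega> z) < \<epsilon>" .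
    moreover have "(LINT z|\<mu>. (norm (D n z))\<^sup>2 * \<omega> z) \<ge> 0"
      by (auto intro!: integral_nonneg_AE AE_I2 simp: sp \<omega>_nonneg)
    ultimately show ?thesis by simp
  qed
  then show "\<exists>no. \<forall>n\<ge>no. norm ((LINT z|\<mu>. (norm (D n z))\<^sup>2 * \<omega> z) - 0) < \<epsilon>" by blast
qed

text \<open>A Montel subsequence minus its limit is bounded and tends to 0 locally uniformly. The
  bound by the \<open>\<mu>\<close>-integral then sends its Toeplitz images to 0 in norm.\<close>

lemma vanishing_imp_toeplitz_compact:
  assumes \<delta>: "0 < \<delta>" "\<delta> \<le> m" and \<mu>: "finite_borel_disk \<mu>"
    and vanish: "\<And>e. e > 0 \<Longrightarrow> \<exists>r<1. \<forall>z\<in>disk. norm z > r \<longrightarrow> averaging \<tau> \<mu> \<delta> z \<le> e"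
  shows "toeplitz_compact \<omega> \<mu>"
proof -
  obtain r1 where "r1 < 1" "\<And>z. z \<in> disk \<Longrightarrow> norm z > r1 \<Longrightarrow> averaging \<tau> \<mu> \<delta> z \<le> 1"
    using vanish[of 1] by auto
  from averaging_bounded_of_vanishing[OF \<mu> this] obtain M where M: "M \<ge> 0" "\<forall>z\<in>disk. averaging \<tau> \<mu> \<delta> z \<le> M"
    by blast
  obtain C where C: "C > 0" and defd: "toeplitz_defined \<omega> \<mu>"
    and T: "\<And>f. f \<in> A2 \<omega> \<Longrightarrow> toeplitz \<omega> \<mu> f \<in> A2 \<omega>"
      "\<And>f. f \<in> A2 \<omega> \<Longrightarrow> (A2_norm \<omega> (toeplitz \<omega> \<mu> f))\<^sup>2 \<le> C * M * (LINT z|\<mu>. (norm (f z))\<^sup>2 * \<omega> z)"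
      "\<And>f. f \<in> A2 \<omega> \<Longrightarrow> integrable \<mu> (\<lambda>z. (norm (f z))\<^sup>2 * \<omega> z)"
    using averaging_bounded_imp_toeplitz[OF \<delta>] \<mu> M by blast
  have "A2_compact \<omega> (toeplitz \<omega> \<mu>)"
    unfolding A2_compact_def
  proof (intro conjI ballI allI impI)
    show "toeplitz \<omega> \<mu> f \<in> A2 \<omega>" if "f \<in> A2 \<omega>" for f by (rule T(1)[OF that])
    fix F :: "nat \<Rightarrow> complex \<Rightarrow> complex"
    assume "(\<forall>n. F n \<in> A2 \<omega>) \<and> (\<exists>b. \<forall>n. A2_norm \<omega> (F n) \<le> b)"
    then obtain b where F: "\<And>n. F n \<in> A2 \<omega>" "\<And>n. A2_norm \<omega> (F n) \<le> b" by blast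
    obtain h and r :: "nat \<Rightarrow> nat" where h: "h \<in> A2 \<omega>" "A2_norm \<omega> h \<le> b" and r: "strict_mono r"
      and unif: "\<And>K. \<lbrakk>compact K; K \<subseteq> disk\<rbrakk> \<Longrightarrow> uniform_limit K (F \<circ> r) h sequentially"
      by (rule A2_Montel[of F b, OF F]) (rule that)
    define D where "D n z = F (r n) z - h z" for n z
    have D: "D n \<in> A2 \<omega>" for n unfolding D_def[abs_def] by (intro A2_diff F h)
    have Db: "A2_norm \<omega> (D n) \<le> 2 * b" for n
    proof -
      have "A2_norm \<omega> (\<lambda>z. F (r n) z + (- 1) * h z) \<le> A2_norm \<omega> (F (r n)) + A2_norm \<omega> (\<lambda>z. (- 1) * h z)"
        by (intro A2_norm_triangle F A2_scale h)
      also have "\<dots> \<le> b + b" unfolding A2_norm_scale using F(2)[of "r n"] h(2) by simp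
      finally show ?thesis by (simp add: D_def[abs_def])
    qed
    have unifD: "uniform_limit K D (\<lambda>_. 0) sequentially" if K: "compact K" "K \<subseteq> disk" for K
    proof (rule uniform_limitI)
      fix e :: real assume "e > 0"
      from uniform_limitD[OF unif[OF K] this] show "\<forall>\<^sub>F n in sequentially. \<forall>x\<in>K. dist (D n x) 0 < e"
        by (simp add: D_def dist_norm)
    qed
    have lim: "(\<lambda>n. LINT z|\<mu>. (norm (D n z))\<^sup>2 * \<omega> z) \<longlonglongrightarrow> 0"
    proof (rule integral_vanishes_of_locally_uniform[OF \<delta> \<mu>, of D "2 * b"])
      show "\<exists>r<1. \<forall>z\<in>disk. norm z > r \<longrightarrow> averaging \<tau> \<mu> \<delta> z \<le> e" if "e > 0" for e
        by (rule vanish[OF that])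
      show "uniform_limit K D (\<lambda>_. 0) sequentially" if "compact K" "K \<subseteq> disk" for K
        by (rule unifD[OF that])
    qed (rule D Db T(3)[OF D])+
    \<comment> \<open>Norms are compared instead of functions: linearity of the Toeplitz integral
      rests on \<open>toeplitz_defined\<close>, which speaks only of points of the disk.\<close>
    have TD: "A2_norm \<omega> (\<lambda>z. toeplitz \<omega> \<mu> (F (r n)) z - toeplitz \<omega> \<mu> h z) = A2_norm \<omega> (toeplitz \<omega> \<mu> (D n))" for n
      unfolding A2_norm_def
    proof (intro arg_cong[where f = sqrt] Bochner_Integration.integral_cong refl)
      fix z assume "z \<in> space dA"
      then have z: "z \<in> disk" by simp
      have "toeplitz \<omega> \<mu> (D n) z = toeplitz \<omega> \<mu> (F (r n)) z - toeplitz \<omega> \<mu> h z"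
        using defd F(1)[of "r n"] h(1) z unfolding toeplitz_defined_def toeplitz_def D_def
        by (simp add: left_diff_distrib)
      then show "(norm (toeplitz \<omega> \<mu> (F (r n)) z - toeplitz \<omega> \<mu> h z))\<^sup>2 * \<omega> z
          = (norm (toeplitz \<omega> \<mu> (D n) z))\<^sup>2 * \<omega> z" by simp
    qed
    have "(\<lambda>n. A2_norm \<omega> (toeplitz \<omega> \<mu> (D n))) \<longlonglongrightarrow> 0"
    proof (rule Lim_null_comparison)
      show "(\<lambda>n. sqrt (C * M * (LINT z|\<mu>. (norm (D n z))\<^sup>2 * \<omega> z))) \<longlonglongrightarrow> 0"
        using tendsto_real_sqrt[OF tendsto_mult_left[OF lim, of "C * M"]] by simp
      show "\<forall>\<^sub>F n in sequentially. norm (A2_norm \<omega> (toeplitz \<omega> \<mu> (D n))) \<le> sqrt (C * M * (LINT z|\<mu>. (norm (D n z))\<^sup>2 * \<omega> z))"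
        using real_le_rsqrt[OF T(2)[OF D]] by simp
    qed
    then show "\<exists>g\<in>A2 \<omega>. \<exists>s :: nat \<Rightarrow> nat. strict_mono s \<and>
        (\<lambda>n. A2_norm \<omega> (\<lambda>z. toeplitz \<omega> \<mu> (F (s n)) z - g z)) \<longlonglongrightarrow> 0"
      using T(1)[OF h(1)] r unfolding TD[symmetric] by blast
  qed
  then show ?thesis using defd by (simp add: toeplitz_compact_def)
qed

text \<open>\<open>\<delta>0\<close> is the \<open>d\<close> of
  \<open>averaging_le_toeplitz_kernel\<close>: below it the operator controls the averages at every
  scale, whereas the converse implications use the single scale \<open>d / 2\<close>. Both norm
  constants are obtained before \<open>\<mu>\<close> is fixed.\<close>

lemma toeplitz_characterization:
  "\<exists>\<delta>0. 0 < \<delta>0 \<and> \<delta>0 \<le> m_const c1 c2 \<and>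
    (\<forall>\<mu>. finite_borel_disk \<mu> \<longrightarrow>
       (toeplitz_bounded \<omega> \<mu> \<longleftrightarrow> (\<forall>\<delta>\<in>{0<..<\<delta>0}. sup_averaging \<tau> \<mu> \<delta> < \<infinity>))) \<and>
    (\<forall>\<delta>\<in>{0<..<\<delta>0}. \<exists>a>0. \<exists>b>0. \<forall>\<mu>. finite_borel_disk \<mu> \<and> toeplitz_bounded \<omega> \<mu> \<longrightarrow>
       ennreal a * sup_averaging \<tau> \<mu> \<delta> \<le> ennreal (A2_opnorm \<omega> (toeplitz \<omega> \<mu>)) \<and>
       ennreal (A2_opnorm \<omega> (toeplitz \<omega> \<mu>)) \<le> ennreal b * sup_averaging \<tau> \<mu> \<delta>) \<and>
    (\<forall>\<mu>. finite_borel_disk \<mu> \<longrightarrow>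
       (toeplitz_compact \<omega> \<mu> \<longleftrightarrow>
          (\<forall>\<delta>\<in>{0<..<\<delta>0}.
             ((\<lambda>r. SUP z\<in>{z \<in> disk. norm z > r}. ennreal (averaging \<tau> \<mu> \<delta> z)) \<longlongrightarrow> 0)
               (at_left 1))))"
proof -
  obtain d c where d: "d > 0" "d \<le> m" and c: "c > 0" and lower: "\<And>\<delta> \<mu> z.
     \<lbrakk>0 < \<delta>; \<delta> < d; finite_borel_disk \<mu>; toeplitz_defined \<omega> \<mu>; z \<in> disk\<rbrakk> \<Longrightarrow>
     c * averaging \<tau> \<mu> \<delta> z * (A2_norm \<omega> (kernel \<omega> z))\<^sup>2 \<le> norm (toeplitz \<omega> \<mu> (kernel \<omega> z) z)"
    using averaging_le_toeplitz_kernel by blast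
  \<comment> \<open>The operator is tested on \<open>K_z\<close>: its image at \<open>z\<close> is
    at most the operator norm times the squared kernel norm, which cancels.\<close>
  have avg_le: "ennreal c * sup_averaging \<tau> \<mu> \<delta> \<le> ennreal (A2_opnorm \<omega> (toeplitz \<omega> \<mu>))"
    if \<delta>: "0 < \<delta>" "\<delta> < d" and \<mu>: "finite_borel_disk \<mu>" and bdd: "toeplitz_bounded \<omega> \<mu>" for \<delta> \<mu>
  proof -
    have "c * averaging \<tau> \<mu> \<delta> z \<le> A2_opnorm \<omega> (toeplitz \<omega> \<mu>)" if z: "z \<in> disk" for z
    proof -
      let ?K = "kernel \<omega> z"
      have N: "A2_norm \<omega> ?K > 0" by (rule kernel_norm_pos[OF z])
      have TK: "toeplitz \<omega> \<mu> ?K \<in> A2 \<omega>"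
        using bdd kernel(1)[OF z] by (simp add: toeplitz_bounded_def A2_bounded_def)
      have "c * averaging \<tau> \<mu> \<delta> z * (A2_norm \<omega> ?K)\<^sup>2 \<le> norm (toeplitz \<omega> \<mu> ?K z)"
        using bdd by (intro lower \<delta> \<mu> z) (simp add: toeplitz_bounded_def)
      also have "\<dots> \<le> A2_norm \<omega> (toeplitz \<omega> \<mu> ?K) * A2_norm \<omega> ?K" by (rule kernel_extremal[OF z TK])
      also have "\<dots> \<le> (A2_opnorm \<omega> (toeplitz \<omega> \<mu>) * A2_norm \<omega> ?K) * A2_norm \<omega> ?K"
        using bdd N by (intro mult_right_mono A2_opnorm_bound kernel(1)[OF z]) (auto simp: toeplitz_bounded_def)
      finally have "c * averaging \<tau> \<mu> \<delta> z * (A2_norm \<omega> ?K)\<^sup>2 \<le> A2_opnorm \<omega> (toeplitz \<omega> \<mu>) * (A2_norm \<omega> ?K)\<^sup>2"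
        by (simp add: power2_eq_square mult.assoc)
      then show ?thesis using N by simp
    qed
    then show ?thesis
      unfolding sup_averaging_def SUP_mult_left_ennreal using c
      by (intro SUP_least) (simp add: ennreal_leI flip: ennreal_mult')
  qed
  have bdd_imp: "sup_averaging \<tau> \<mu> \<delta> < \<infinity>"
    if \<delta>: "0 < \<delta>" "\<delta> < d" and \<mu>: "finite_borel_disk \<mu>" and bdd: "toeplitz_bounded \<omega> \<mu>" for \<delta> \<mu>
  proof (rule ccontr)
    assume "\<not> ?thesis"
    then have "sup_averaging \<tau> \<mu> \<delta> = \<infinity>" by (simp add: less_top[symmetric])
    then show False using avg_le[OF that] c by (simp add: ennreal_mult_top top_unique)
  qed
  show ?thesis
  proof (rule exI[of _ d], intro conjI d allI impI ballI)
    fix \<mu> assume \<mu>: "finite_borel_disk \<mu>"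
    show "toeplitz_bounded \<omega> \<mu> \<longleftrightarrow> (\<forall>\<delta>\<in>{0<..<d}. sup_averaging \<tau> \<mu> \<delta> < \<infinity>)"
    proof
      assume "toeplitz_bounded \<omega> \<mu>"
      then show "\<forall>\<delta>\<in>{0<..<d}. sup_averaging \<tau> \<mu> \<delta> < \<infinity>" using bdd_imp[OF _ _ \<mu>] by simp
    next
      assume "\<forall>\<delta>\<in>{0<..<d}. sup_averaging \<tau> \<mu> \<delta> < \<infinity>"
      then have fin: "sup_averaging \<tau> \<mu> (d / 2) < \<infinity>" using d(1) by simp
      have \<delta>: "0 < d / 2" "d / 2 \<le> m" using d by auto
      have "enn2real (sup_averaging \<tau> \<mu> (d / 2)) \<ge> 0" by simp
      then show "toeplitz_bounded \<omega> \<mu>"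
        using averaging_bounded_imp_toeplitz[OF \<delta>] \<mu> averaging_le_sup[OF fin]
        unfolding toeplitz_bounded_def A2_bounded_def by blast
    qed
  next
    fix \<delta> assume "\<delta> \<in> {0<..<d}"
    then have \<delta>: "0 < \<delta>" "\<delta> < d" "\<delta> \<le> m" using d by auto
    obtain C where C: "C > 0" and T: "\<And>\<mu> M f. \<lbrakk>finite_borel_disk \<mu>; M \<ge> 0;
        \<forall>w\<in>disk. averaging \<tau> \<mu> \<delta> w \<le> M; f \<in> A2 \<omega>\<rbrakk> \<Longrightarrow>
        A2_norm \<omega> (toeplitz \<omega> \<mu> f) \<le> C * M * A2_norm \<omega> f"
      using averaging_bounded_imp_toeplitz[OF \<delta>(1,3)] by blast
    show "\<exists>a>0. \<exists>b>0. \<forall>\<mu>. finite_borel_disk \<mu> \<and> toeplitz_bounded \<omega> \<mu> \<longrightarrow>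
       ennreal a * sup_averaging \<tau> \<mu> \<delta> \<le> ennreal (A2_opnorm \<omega> (toeplitz \<omega> \<mu>)) \<and>
       ennreal (A2_opnorm \<omega> (toeplitz \<omega> \<mu>)) \<le> ennreal b * sup_averaging \<tau> \<mu> \<delta>"
    proof (rule exI[of _ c], intro conjI c, rule exI[of _ C], intro conjI C allI impI)
      fix \<mu> assume "finite_borel_disk \<mu> \<and> toeplitz_bounded \<omega> \<mu>"
      then have \<mu>: "finite_borel_disk \<mu>" and bdd: "toeplitz_bounded \<omega> \<mu>" by auto
      show "ennreal c * sup_averaging \<tau> \<mu> \<delta> \<le> ennreal (A2_opnorm \<omega> (toeplitz \<omega> \<mu>))"
        by (rule avg_le[OF \<delta>(1,2) \<mu> bdd])
      have fin: "sup_averaging \<tau> \<mu> \<delta> < \<infinity>" by (rule bdd_imp[OF \<delta>(1,2) \<mu> bdd])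
      define M where "M = enn2real (sup_averaging \<tau> \<mu> \<delta>)"
      have M: "M \<ge> 0" "\<forall>w\<in>disk. averaging \<tau> \<mu> \<delta> w \<le> M" "sup_averaging \<tau> \<mu> \<delta> = ennreal M"
        using averaging_le_sup[OF fin] fin by (auto simp: M_def)
      have "A2_opnorm \<omega> (toeplitz \<omega> \<mu>) \<le> C * M"
        unfolding A2_opnorm_def
      proof (rule cSUP_least)
        have "A2_norm \<omega> (\<lambda>_. 0) \<le> 1" by (simp add: A2_norm_def)
        then show "{f \<in> A2 \<omega>. A2_norm \<omega> f \<le> 1} \<noteq> {}" using A2_zero by blast
        fix f assume f: "f \<in> {f \<in> A2 \<omega>. A2_norm \<omega> f \<le> 1}"
        then have "A2_norm \<omega> (toeplitz \<omega> \<mu> f) \<le> C * M * A2_norm \<omega> f" by (intro T \<mu> M) auto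
        also have "\<dots> \<le> C * M * 1" using f C M(1) by (intro mult_left_mono) auto
        finally show "A2_norm \<omega> (toeplitz \<omega> \<mu> f) \<le> C * M" by simp
      qed
      then show "ennreal (A2_opnorm \<omega> (toeplitz \<omega> \<mu>)) \<le> ennreal C * sup_averaging \<tau> \<mu> \<delta>"
        unfolding M(3) using C by (simp add: ennreal_leI flip: ennreal_mult')
    qed
  next
    fix \<mu> assume \<mu>: "finite_borel_disk \<mu>"
    show "toeplitz_compact \<omega> \<mu> \<longleftrightarrow> (\<forall>\<delta>\<in>{0<..<d}.
      ((\<lambda>r. SUP z\<in>{z \<in> disk. norm z > r}. ennreal (averaging \<tau> \<mu> \<delta> z)) \<longlongrightarrow> 0) (at_left 1))"
      unfolding averaging_vanishes_iff
    proof
      assume cpt: "toeplitz_compact \<omega> \<mu>"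
      show "\<forall>\<delta>\<in>{0<..<d}. \<forall>e>0. \<exists>r<1. \<forall>z\<in>disk. norm z > r \<longrightarrow> averaging \<tau> \<mu> \<delta> z \<le> e"
      proof (intro ballI allI impI)
        fix \<delta> e :: real assume "\<delta> \<in> {0<..<d}" "e > 0"
        then show "\<exists>r<1. \<forall>z\<in>disk. norm z > r \<longrightarrow> averaging \<tau> \<mu> \<delta> z \<le> e"
          using cpt unfolding toeplitz_compact_def
          by (intro toeplitz_compact_imp_vanishing[OF c lower] \<mu>) auto
      qed
    next
      assume "\<forall>\<delta>\<in>{0<..<d}. \<forall>e>0. \<exists>r<1. \<forall>z\<in>disk. norm z > r \<longrightarrow> averaging \<tau> \<mu> \<delta> z \<le> e"
      moreover have "d / 2 \<in> {0<..<d}" using d by simp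
      ultimately have "\<forall>e>0. \<exists>r<1. \<forall>z\<in>disk. norm z > r \<longrightarrow> averaging \<tau> \<mu> (d / 2) z \<le> e" by blast
      then show "toeplitz_compact \<omega> \<mu>"
        using d by (intro vanishing_imp_toeplitz_compact[of "d / 2"] \<mu>) auto
    qed
  qed
qed

end

theorem theorem1p1:
  fixes \<omega> \<tau> :: "complex \<Rightarrow> real" and c1 c2 :: real
  assumes "class_W \<omega> \<tau>" and "class_L \<tau> c1 c2"
  shows "\<exists>\<delta>0. 0 < \<delta>0 \<and> \<delta>0 \<le> m_const c1 c2 \<and>
    (\<forall>\<mu>. finite_borel_disk \<mu> \<longrightarrow>
       (toeplitz_bounded \<omega> \<mu> \<longleftrightarrow> (\<forall>\<delta>\<in>{0<..<\<delta>0}. sup_averaging \<tau> \<mu> \<delta> < \<infinity>))) \<and>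
    (\<forall>\<delta>\<in>{0<..<\<delta>0}. \<exists>a>0. \<exists>b>0. \<forall>\<mu>. finite_borel_disk \<mu> \<and> toeplitz_bounded \<omega> \<mu> \<longrightarrow>
       ennreal a * sup_averaging \<tau> \<mu> \<delta> \<le> ennreal (A2_opnorm \<omega> (toeplitz \<omega> \<mu>)) \<and>
       ennreal (A2_opnorm \<omega> (toeplitz \<omega> \<mu>)) \<le> ennreal b * sup_averaging \<tau> \<mu> \<delta>) \<and>
    (\<forall>\<mu>. finite_borel_disk \<mu> \<longrightarrow>
       (toeplitz_compact \<omega> \<mu> \<longleftrightarrow>
          (\<forall>\<delta>\<in>{0<..<\<delta>0}.
             ((\<lambda>r. SUP z\<in>{z \<in> disk. norm z > r}. ennreal (averaging \<tau> \<mu> \<delta> z)) \<longlongrightarrow> 0)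
               (at_left 1))))"
proof -
  have \<omega>: "weight \<omega>" "radially_decreasing \<omega>"
    and \<tau>: "\<forall>z\<in>disk. \<tau> z > 0" "radially_decreasing \<tau>" "(profile \<tau> \<longlongrightarrow> 0) (at_left 1)"
    and ex: "\<exists>\<phi>. radial \<phi> \<and> C2_on disk \<phi> \<and>
        (\<forall>z\<in>disk. \<omega> z = exp (- 2 * \<phi> z)) \<and>
        (\<forall>z\<in>disk. laplacian \<phi> z > 0) \<and>
        (\<exists>a>0. \<exists>b>0. \<forall>z\<in>disk.
           a * \<tau> z \<le> laplacian \<phi> z powr (- 1 / 2) \<and>
           laplacian \<phi> z powr (- 1 / 2) \<le> b * \<tau> z)"
    using assms(1) unfolding class_W_def by - (elim conjE, assumption)+
  from ex obtain \<phi> A B where \<phi>: "radial \<phi>" "C2_on disk \<phi>" "\<forall>z\<in>disk. \<omega> z = exp (- 2 * \<phi> z)"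
    "\<forall>z\<in>disk. laplacian \<phi> z > 0" "A > 0" "B > 0"
    "\<forall>z\<in>disk. A * \<tau> z \<le> laplacian \<phi> z powr (- 1 / 2) \<and> laplacian \<phi> z powr (- 1 / 2) \<le> B * \<tau> z"
    by (elim conjE exE) (rule that)
  interpret large_weight \<omega> \<tau> \<phi> c1 c2 A B
    by unfold_locales (use \<omega> \<tau> \<phi> assms(2) in \<open>blast+\<close>)
  show ?thesis by (rule toeplitz_characterization)
qed

end
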